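(* Let $\bar M$ be a compact smooth manifold of dimension $m\ge 3$. For every integer $K>0$, there exists a Riemannian metric $g_K$ of volume one on $\bar M$ such that, for any integer $p\ge1$ and any isometric immersion $X$ from $(\bar M,g_K)$ into the Euclidean space $\mathbb{R}^{m+p}$, the submanifold $M=X(\bar M)$ satisfies the following conditions: (1) there exists a $p$-plane $\Pi\subset\mathbb{R}^{m+p}$ transverse to $M$ which intersects $M$ at least $K$ times; (2) $\|H(M)\|_2>K$; (3) there exists a Euclidean ball $B(x,r)\subset\mathbb{R}^{m+p}$ such that the volume of the portion of $M$ lying in $B(x,r)$ is larger than the volume of $K$ Euclidean balls of radius $r$ and dimension $m$, that is, $$1\ge\mathrm{Vol}_m(B(x,r)\cap M)>K\,\mathrm{Vol}_m(B^m)\,r^m.$$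
   Context: Manifolds are connected and without boundary; immersions are of class $C^2$. $\|H(M)\|_2$ is the $L^2$-norm, with respect to the Riemannian volume, of the mean curvature vector field $H(M)$ of $M$ (the trace of the second fundamental form divided by $m$). $p$-planes are affine. The number of intersection points of $\Pi$ with $M$ is counted with multiplicity at multiple points of $M$ (i.e. one counts points of $X^{-1}(\Pi)$). $B(x,r)$ is the Euclidean ball of center $x$ and radius $r>0$ in $\mathbb{R}^{m+p}$, $B^m$ is the Euclidean unit ball in $\mathbb{R}^m$, and $\mathrm{Vol}_m(B(x,r)\cap M)$ is the induced $m$-dimensional volume of the portion of $M$ lying in $B(x,r)$, i.e. the $g_K$-volume of $X^{-1}(B(x,r))$. *)

theory Defs
  imports "HOL-Analysis.Analysis"
begin

section \<open>Functions of class C^k on open subsets of R^m\<close>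

definition pd :: "'m::finite \<Rightarrow> (real^'m \<Rightarrow> real) \<Rightarrow> real^'m \<Rightarrow> real" where
  "pd i f y = frechet_derivative f (at y) (axis i 1)"

text \<open>Intended for open \<open>S\<close> only.\<close>

fun Ck_on :: "nat \<Rightarrow> (real^'m::finite) set \<Rightarrow> (real^'m \<Rightarrow> real) \<Rightarrow> bool" where
  "Ck_on 0 S f \<longleftrightarrow> continuous_on S f"
| "Ck_on (Suc k) S f \<longleftrightarrow> (\<forall>y\<in>S. f differentiable (at y)) \<and> (\<forall>i. Ck_on k S (pd i f))"

definition smooth_on :: "(real^'m::finite) set \<Rightarrow> (real^'m \<Rightarrow> real) \<Rightarrow> bool" where
  "smooth_on S f \<longleftrightarrow> (\<forall>k. Ck_on k S f)"

section \<open>Smooth manifolds and Riemannian metrics\<close>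

text \<open>
  The underlying topological space is an abstract topology and the dimension is \<open>CARD('m)\<close>.
  A chart is a pair (domain, coordinate map); the values of the coordinate map outside the
  domain are irrelevant. A smooth structure is given by an atlas, not necessarily maximal.
\<close>

type_synonym ('a, 'm) chart = "'a set \<times> ('a \<Rightarrow> real^'m)"

definition chart_image :: "('a, 'm::finite) chart \<Rightarrow> (real^'m) set" where
  "chart_image c = snd c ` fst c"

definition chart_inv :: "('a, 'm::finite) chart \<Rightarrow> real^'m \<Rightarrow> 'a" where
  "chart_inv c = inv_into (fst c) (snd c)"

definition is_chart :: "'a topology \<Rightarrow> ('a, 'm::finite) chart \<Rightarrow> bool" where
  "is_chart T c \<longleftrightarrow> openin T (fst c) \<and> open (chart_image c) \<and>
     homeomorphic_map (subtopology T (fst c)) (top_of_set (chart_image c)) (snd c)"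

definition transition :: "('a, 'm::finite) chart \<Rightarrow> ('a, 'm) chart \<Rightarrow> real^'m \<Rightarrow> real^'m" where
  "transition c d = snd d \<circ> chart_inv c"

definition smooth_atlas :: "'a topology \<Rightarrow> ('a, 'm::finite) chart set \<Rightarrow> bool" where
  "smooth_atlas T A \<longleftrightarrow>
     (\<forall>c\<in>A. is_chart T c) \<and> (\<Union>c\<in>A. fst c) = topspace T \<and>
     (\<forall>c\<in>A. \<forall>d\<in>A. \<forall>i. smooth_on (snd c ` (fst c \<inter> fst d)) (\<lambda>y. transition c d y $ i))"

definition connected_smooth_manifold :: "'a topology \<Rightarrow> ('a, 'm::finite) chart set \<Rightarrow> bool" where
  "connected_smooth_manifold T A \<longleftrightarrow>
     Hausdorff_space T \<and> second_countable T \<and> connected_space T \<and> topspace T \<noteq> {} \<and>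
     smooth_atlas T A"

text \<open>
  A metric tensor is the family of its Gram matrices \<open>g c q\<close> at \<open>q\<close> in the chart \<open>c\<close>;
  the last conjunct is the transformation law of covariant 2-tensors.
\<close>

definition riemannian_metric ::
    "('a, 'm::finite) chart set \<Rightarrow> (('a, 'm) chart \<Rightarrow> 'a \<Rightarrow> real^'m^'m) \<Rightarrow> bool" where
  "riemannian_metric A g \<longleftrightarrow> (\<forall>c\<in>A.
     (\<forall>i j. smooth_on (chart_image c) (\<lambda>y. g c (chart_inv c y) $ i $ j)) \<and>
     (\<forall>q\<in>fst c. transpose (g c q) = g c q \<and> (\<forall>v. v \<noteq> 0 \<longrightarrow> 0 < v \<bullet> (g c q *v v))) \<and>
     (\<forall>d\<in>A. \<forall>q\<in>fst c \<inter> fst d.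
        let J = matrix (frechet_derivative (transition c d) (at (snd c q)))
        in g c q = transpose J ** g d q ** J))"

text \<open>
  \<open>chart_volume T g c\<close> is the Borel measure on the whole space, null outside the domain of \<open>c\<close>,
  with density \<open>sqrt (det g)\<close> in the coordinates of \<open>c\<close>. By the change of variables formula,
  these are the restrictions of the Riemannian volume to the chart domains. The Riemannian volume
  is therefore their least upper bound in the complete lattice of measures: any Borel measure
  dominating all these restrictions dominates the volume, as one sees by splitting a Borel set
  into countably many pieces lying in chart domains.
\<close>

definition borel_algebra :: "'a topology \<Rightarrow> 'a measure" where
  "borel_algebra T = sigma (topspace T) {U. openin T U}"

definition chart_volume ::
    "'a topology \<Rightarrow> (('a, 'm::finite) chart \<Rightarrow> 'a \<Rightarrow> real^'m^'m) \<Rightarrow> ('a, 'm) chart \<Rightarrow> 'a measure"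
where
  "chart_volume T g c =
     distr (density (restrict_space lborel (chart_image c))
                    (\<lambda>y. ennreal (sqrt (det (g c (chart_inv c y))))))
           (borel_algebra T) (chart_inv c)"

definition riemannian_volume ::
    "'a topology \<Rightarrow> ('a, 'm::finite) chart set \<Rightarrow> (('a, 'm) chart \<Rightarrow> 'a \<Rightarrow> real^'m^'m) \<Rightarrow> 'a measure"
where
  "riemannian_volume T A g = (SUP c\<in>A. chart_volume T g c)"

section \<open>The Euclidean space R^N\<close>

text \<open>
  Since the codimension is quantified inside the theorem, R^N is the library's
  \<open>topspace (Euclidean_space N)\<close>: the sequences vanishing from index \<open>N\<close> on.
\<close>

definition eucl_inner :: "nat \<Rightarrow> (nat \<Rightarrow> real) \<Rightarrow> (nat \<Rightarrow> real) \<Rightarrow> real" where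
  "eucl_inner N v w = (\<Sum>j<N. v j * w j)"

definition eucl_norm :: "nat \<Rightarrow> (nat \<Rightarrow> real) \<Rightarrow> real" where
  "eucl_norm N v = sqrt (eucl_inner N v v)"

definition eucl_ball :: "nat \<Rightarrow> (nat \<Rightarrow> real) \<Rightarrow> real \<Rightarrow> (nat \<Rightarrow> real) set" where
  "eucl_ball N x r = {y \<in> topspace (Euclidean_space N). eucl_norm N (\<lambda>j. y j - x j) < r}"

definition affine_plane :: "nat \<Rightarrow> nat \<Rightarrow> (nat \<Rightarrow> real) set \<Rightarrow> bool" where
  "affine_plane N p P \<longleftrightarrow>
     (\<exists>a b. a \<in> topspace (Euclidean_space N) \<and> (\<forall>k<p. b k \<in> topspace (Euclidean_space N)) \<and>
        (\<forall>t :: nat \<Rightarrow> real. (\<forall>j. (\<Sum>k<p. t k * b k j) = 0) \<longrightarrow> (\<forall>k<p. t k = 0)) \<and>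
        P = {x. \<exists>t :: nat \<Rightarrow> real. x = (\<lambda>j. a j + (\<Sum>k<p. t k * b k j))})"

definition direction :: "(nat \<Rightarrow> real) set \<Rightarrow> (nat \<Rightarrow> real) set" where
  "direction P = {w. \<exists>x\<in>P. \<exists>y\<in>P. w = (\<lambda>j. x j - y j)}"

section \<open>Immersed submanifolds\<close>

definition local_rep :: "('a, 'm::finite) chart \<Rightarrow> ('a \<Rightarrow> nat \<Rightarrow> real) \<Rightarrow> nat \<Rightarrow> real^'m \<Rightarrow> real" where
  "local_rep c X j = (\<lambda>y. X (chart_inv c y) j)"

text \<open>The differential of \<open>X\<close> at \<open>q\<close>, tangent vectors being written in the coordinates of \<open>c\<close>.\<close>

definition differential ::
    "('a, 'm::finite) chart \<Rightarrow> ('a \<Rightarrow> nat \<Rightarrow> real) \<Rightarrow> 'a \<Rightarrow> real^'m \<Rightarrow> nat \<Rightarrow> real" where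
  "differential c X q v = (\<lambda>j. frechet_derivative (local_rep c X j) (at (snd c q)) v)"

definition C2_immersion ::
    "'a topology \<Rightarrow> ('a, 'm::finite) chart set \<Rightarrow> nat \<Rightarrow> ('a \<Rightarrow> nat \<Rightarrow> real) \<Rightarrow> bool" where
  "C2_immersion T A N X \<longleftrightarrow>
     X \<in> topspace T \<rightarrow> topspace (Euclidean_space N) \<and>
     (\<forall>c\<in>A. (\<forall>j<N. Ck_on 2 (chart_image c) (local_rep c X j)) \<and>
            (\<forall>q\<in>fst c. inj (differential c X q)))"

definition isometric_immersion ::
    "'a topology \<Rightarrow> ('a, 'm::finite) chart set \<Rightarrow> (('a, 'm) chart \<Rightarrow> 'a \<Rightarrow> real^'m^'m) \<Rightarrow>
     nat \<Rightarrow> ('a \<Rightarrow> nat \<Rightarrow> real) \<Rightarrow> bool" where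
  "isometric_immersion T A g N X \<longleftrightarrow>
     C2_immersion T A N X \<and>
     (\<forall>c\<in>A. \<forall>q\<in>fst c. \<forall>u v.
        eucl_inner N (differential c X q u) (differential c X q v) = u \<bullet> (g c q *v v))"

text \<open>Transversality at all points of \<open>X\<^sup>-\<^sup>1(P)\<close>: tangent space plus direction of \<open>P\<close> is R^N.\<close>

definition transverse ::
    "('a, 'm::finite) chart set \<Rightarrow> nat \<Rightarrow> ('a \<Rightarrow> nat \<Rightarrow> real) \<Rightarrow> (nat \<Rightarrow> real) set \<Rightarrow> bool" where
  "transverse A N X P \<longleftrightarrow>
     (\<forall>c\<in>A. \<forall>q\<in>fst c. X q \<in> P \<longrightarrow>
        (\<forall>w\<in>topspace (Euclidean_space N). \<exists>v. \<exists>d\<in>direction P.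
           w = (\<lambda>j. differential c X q v j + d j)))"

text \<open>
  With \<open>e i\<close> the coordinate tangent vectors and \<open>G\<close> their Gram matrix (the first fundamental
  form), the tangential component of \<open>w\<close> is the sum of \<open>G\<^sup>i\<^sup>j \<langle>w, e i\<rangle> e j\<close>.
  The second fundamental form is the normal component of the second derivatives of \<open>X\<close>.
\<close>

definition first_ff ::
    "('a, 'm::finite) chart \<Rightarrow> nat \<Rightarrow> ('a \<Rightarrow> nat \<Rightarrow> real) \<Rightarrow> 'a \<Rightarrow> real^'m^'m" where
  "first_ff c N X q =
     (\<chi> i j. eucl_inner N (differential c X q (axis i 1)) (differential c X q (axis j 1)))"

definition normal_part ::
    "('a, 'm::finite) chart \<Rightarrow> nat \<Rightarrow> ('a \<Rightarrow> nat \<Rightarrow> real) \<Rightarrow> 'a \<Rightarrow> (nat \<Rightarrow> real) \<Rightarrow> nat \<Rightarrow> real" where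
  "normal_part c N X q w = (\<lambda>l. w l -
     (\<Sum>i\<in>UNIV. \<Sum>j\<in>UNIV. matrix_inv (first_ff c N X q) $ i $ j *
        eucl_inner N w (differential c X q (axis i 1)) * differential c X q (axis j 1) l))"

definition second_ff ::
    "('a, 'm::finite) chart \<Rightarrow> nat \<Rightarrow> ('a \<Rightarrow> nat \<Rightarrow> real) \<Rightarrow> 'a \<Rightarrow> 'm \<Rightarrow> 'm \<Rightarrow> nat \<Rightarrow> real" where
  "second_ff c N X q i j =
     normal_part c N X q (\<lambda>l. pd i (pd j (local_rep c X l)) (snd c q))"

definition mean_curvature_in ::
    "('a, 'm::finite) chart \<Rightarrow> nat \<Rightarrow> ('a \<Rightarrow> nat \<Rightarrow> real) \<Rightarrow> 'a \<Rightarrow> nat \<Rightarrow> real" where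
  "mean_curvature_in c N X q = (\<lambda>l.
     (\<Sum>i\<in>UNIV. \<Sum>j\<in>UNIV. matrix_inv (first_ff c N X q) $ i $ j * second_ff c N X q i j l)
       / real CARD('m))"

text \<open>
  \<open>mean_curvature_in c N X q\<close> does not depend on the chart \<open>c\<close> around \<open>q\<close>, so the choice
  below is immaterial.
\<close>

definition mean_curvature ::
    "('a, 'm::finite) chart set \<Rightarrow> nat \<Rightarrow> ('a \<Rightarrow> nat \<Rightarrow> real) \<Rightarrow> 'a \<Rightarrow> nat \<Rightarrow> real" where
  "mean_curvature A N X q = mean_curvature_in (SOME c. c \<in> A \<and> q \<in> fst c) N X q"

definition mean_curvature_L2 ::
    "'a topology \<Rightarrow> ('a, 'm::finite) chart set \<Rightarrow> (('a, 'm) chart \<Rightarrow> 'a \<Rightarrow> real^'m^'m) \<Rightarrow>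
     nat \<Rightarrow> ('a \<Rightarrow> nat \<Rightarrow> real) \<Rightarrow> real" where
  "mean_curvature_L2 T A g N X =
     sqrt (LINT q|riemannian_volume T A g. (eucl_norm N (mean_curvature A N X q))\<^sup>2)"

definition portion_volume ::
    "'a topology \<Rightarrow> ('a, 'm::finite) chart set \<Rightarrow> (('a, 'm) chart \<Rightarrow> 'a \<Rightarrow> real^'m^'m) \<Rightarrow>
     ('a \<Rightarrow> nat \<Rightarrow> real) \<Rightarrow> (nat \<Rightarrow> real) set \<Rightarrow> real" where
  "portion_volume T A g X B = measure (riemannian_volume T A g) {q \<in> topspace T. X q \<in> B}"

end

theory Submission
  imports Defs
begin

text \<open>An isometric immersion does not increase distances. Take metrics of volume one that are conformal
  to the coordinate metric on a ball \<open>W\<close> of a chart and nearly vanish on the walls of a grid of mesh \<open>\<epsilon>\<close>,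
  while \<open>W\<close> keeps a volume bounded below independently of \<open>\<epsilon>\<close>. Travelling inside the walls, one joins any
  point of \<open>W\<close> to the centre by a path of length \<open>O(\<epsilon>)\<close>, so every isometric immersion \<open>X\<close> sends \<open>W\<close> into a
  Euclidean ball of radius \<open>D = O(\<epsilon>)\<close>. This is (3).
  For (1), project the image to \<open>\<real>\<^sup>m\<close> along a random \<open>p\<close>-dimensional direction: with positive probability
  the image of \<open>W\<close>, counted with multiplicity, has a definite amount of volume in a ball of radius \<open>O(D)\<close>, so many
  regular values have many preimages.
  For (2), integrate the divergence of the tangential part of \<open>X - x\<^sub>0\<close>, cut off inside \<open>W\<close>:
  its main terms are \<open>m\<close> times the volume and \<open>m \<langle>X - x\<^sub>0, H\<rangle>\<close>, and \<open>\<bar>X - x\<^sub>0\<bar> \<le> D\<close>.\<close>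

section \<open>Change of variables for arbitrary finite index types\<close>

text \<open>The metric is chosen before \<open>p\<close> and \<open>X\<close>, so no constant may
  depend on the codimension or on the immersion. Besides its regularity, what enters of
  \<open>X\<close> is the Gram matrix of its differential: on \<open>W\<close> the coordinate
  derivatives of \<open>X\<close>, divided by \<open>sqrt \<phi>\<close>, are orthonormal in any
  ambient dimension. The sign vectors keep the projection argument uniform: their fourth moments
  obey the Gaussian bound with constant 3 in every dimension, so the mean projected Jacobian is
  bounded below by a constant of \<open>m\<close> alone. Multiplicity comes from comparing volumes,
  a fixed amount of Jacobian landing in a ball of volume O(\<open>D ^ m\<close>). Sard's theorem,
  applied in finitely many charts covering the manifold, makes the plane transverse outside
  \<open>W\<close> as well. The grid must be almost free to travel along and yet cost no volume.
  Walls orthogonal to two coordinate directions already connect everything, and a trigonometric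
  profile has a mean that does not depend on the mesh, up to oscillating terms that integrate to
  O(\<epsilon>). An added \<open>\<epsilon>\<^sup>2\<close> keeps the metric definite on the
  walls.\<close>

text \<open>The library's change of variables theorems need a well-ordered index type.\<close>

typedef ('m::finite) enumerated = "{..<CARD('m)}"
  by (rule exI[of _ 0]) simp

instantiation enumerated :: (finite) wellorder
begin

definition less_eq_enumerated :: "'a enumerated \<Rightarrow> 'a enumerated \<Rightarrow> bool" where
  "less_eq_enumerated x y \<longleftrightarrow> Rep_enumerated x \<le> Rep_enumerated y"

definition less_enumerated :: "'a enumerated \<Rightarrow> 'a enumerated \<Rightarrow> bool" where
  "less_enumerated x y \<longleftrightarrow> Rep_enumerated x < Rep_enumerated y"

instance
proof
  fix P :: "'a enumerated \<Rightarrow> bool" and a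
  assume step: "\<And>x. (\<And>y. y < x \<Longrightarrow> P y) \<Longrightarrow> P x"
  show "P a"
    by (induction "Rep_enumerated a" arbitrary: a rule: less_induct)
       (use step in \<open>auto simp: less_enumerated_def\<close>)
qed (auto simp: less_eq_enumerated_def less_enumerated_def Rep_enumerated_inject)

end

instance enumerated :: (finite) finite
proof
  have "(UNIV :: 'a enumerated set) = Abs_enumerated ` {..<CARD('a)}"
    by (metis type_definition.Abs_image type_definition_enumerated)
  then show "finite (UNIV :: 'a enumerated set)"
    by (metis finite_imageI finite_lessThan)
qed

lemma ex_bij_enumerated: "\<exists>e :: 'm::finite enumerated \<Rightarrow> 'm. bij e"
proof -
  have "bij_betw Rep_enumerated (UNIV :: 'm enumerated set) {..<CARD('m)}"
    by (simp add: bij_betw_def inj_on_def Rep_enumerated_inject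
        type_definition.Rep_range[OF type_definition_enumerated])
  moreover obtain h :: "nat \<Rightarrow> 'm" where "bij_betw h {0..<CARD('m)} UNIV"
    using ex_bij_betw_nat_finite[of "UNIV :: 'm set"] by auto
  ultimately show ?thesis
    by (metis bij_betw_trans atLeast0LessThan)
qed

definition reindex :: "('n \<Rightarrow> 'm) \<Rightarrow> real^'m \<Rightarrow> real^'n" where
  "reindex e x = (\<chi> j. x $ e j)"

lemma linear_reindex: "linear (reindex e :: real^'m::finite \<Rightarrow> real^'n::finite)"
  by (auto simp: reindex_def vec_eq_iff intro!: linearI)

lemma reindex_inverse:
  assumes "bij e"
  shows "reindex (inv e) (reindex e x) = x" "reindex e (reindex (inv e) y) = y"
  using assms by (auto simp: reindex_def vec_eq_iff bij_is_surj surj_f_inv_f bij_is_inj)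

lemma has_derivative_reindex:
  fixes e :: "'n::finite \<Rightarrow> 'm::finite"
  shows "(reindex e has_derivative reindex e) (at x within S)"
  by (simp add: linear_imp_has_derivative linear_reindex)

lemma continuous_reindex: "continuous_on S (reindex e :: real^'m::finite \<Rightarrow> real^'n::finite)"
  by (meson linear_continuous_on linear_conv_bounded_linear linear_reindex)

lemma measurable_reindex [measurable]:
  "(reindex e :: real^'m::finite \<Rightarrow> real^'n::finite) \<in> borel_measurable borel"
  by (simp add: borel_measurable_continuous_onI continuous_reindex)

lemma prod_Basis_cart: "(\<Prod>b\<in>Basis. (x :: real^'n::finite) \<bullet> b) = (\<Prod>i\<in>UNIV. x $ i)"
proof -
  have "bij_betw (\<lambda>i. axis i 1) UNIV (Basis :: (real^'n) set)"
    by (auto simp: Basis_vec_def bij_betw_def inj_on_def axis_eq_axis)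
  from prod.reindex_bij_betw[OF this, of "\<lambda>b. x \<bullet> b"] show ?thesis
    by (simp add: inner_axis)
qed

text \<open>Lebesgue measure is determined by its values on boxes, and a relabelling of the
  coordinates permutes the side lengths of a box.\<close>

lemma distr_lborel_reindex:
  fixes e :: "'n::finite \<Rightarrow> 'm::finite"
  assumes e: "bij e"
  shows "distr lborel lborel (reindex e) = lborel"
proof (rule lborel_eqI[symmetric])
  fix l u :: "real^'n"
  assume le: "\<And>b. b \<in> Basis \<Longrightarrow> l \<bullet> b \<le> u \<bullet> b"
  have vim: "reindex e -` box l u = box (reindex (inv e) l) (reindex (inv e) u)"
    using e by (auto simp: reindex_def mem_box_cart)
      (metis bij_inv_eq_iff, metis bij_inv_eq_iff, metis bij_is_inj inv_f_f, metis bij_is_inj inv_f_f)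
  have le': "\<And>i. l $ i \<le> u $ i"
    using le by (metis cart_eq_inner_axis axis_in_Basis_iff Basis_real_def insertI1)
  then have "\<And>b. b \<in> Basis \<Longrightarrow> reindex (inv e) l \<bullet> b \<le> reindex (inv e) u \<bullet> b"
    by (auto simp: Basis_vec_def inner_axis reindex_def)
  then have "emeasure lborel (box (reindex (inv e) l) (reindex (inv e) u)) =
      (\<Prod>b\<in>Basis. (reindex (inv e) u - reindex (inv e) l) \<bullet> b)"
    by (rule emeasure_lborel_box)
  also have "(\<Prod>b\<in>Basis. (reindex (inv e) u - reindex (inv e) l) \<bullet> b) = (\<Prod>i\<in>UNIV. u $ inv e i - l $ inv e i)"
    by (simp add: prod_Basis_cart reindex_def)
  also have "\<dots> = (\<Prod>i\<in>UNIV. u $ i - l $ i)"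
    by (rule prod.reindex_bij_betw) (simp add: e bij_imp_bij_inv)
  also have "\<dots> = (\<Prod>b\<in>Basis. (u - l) \<bullet> b)"
    by (simp add: prod_Basis_cart)
  finally show "emeasure (distr lborel lborel (reindex e)) (box l u) = (\<Prod>b\<in>Basis. (u - l) \<bullet> b)"
    by (subst emeasure_distr) (simp_all add: vim)
qed simp

lemma nn_integral_reindex:
  fixes e :: "'n::finite \<Rightarrow> 'm::finite"
  assumes "bij e" and [measurable]: "h \<in> borel_measurable borel"
  shows "(\<integral>\<^sup>+x. h (reindex e x) \<partial>lborel) = (\<integral>\<^sup>+y. h y \<partial>lborel)"
proof -
  have "(\<integral>\<^sup>+y. h y \<partial>distr lborel lborel (reindex e)) = (\<integral>\<^sup>+x. h (reindex e x) \<partial>lborel)"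
    by (rule nn_integral_distr) auto
  then show ?thesis
    by (simp add: distr_lborel_reindex[OF assms(1)])
qed

text \<open>Conjugation by the relabelling. The two index types differ, so the invariance is read
  off the Leibniz sum: transporting a permutation along \<open>e\<close> is a bijection that
  preserves the sign.\<close>

lemma det_reindex:
  fixes e :: "'n::finite \<Rightarrow> 'm::finite" and f :: "real^'m \<Rightarrow> real^'m"
  assumes e: "bij e"
  shows "det (matrix (\<lambda>y. reindex e (f (reindex (inv e) y)))) = det (matrix f)"
proof -
  have ax: "reindex (inv e) (axis j 1) = axis (e j) 1" for j
    using e by (auto simp: reindex_def vec_eq_iff axis_def bij_is_surj surj_f_inv_f bij_is_inj)
  let ?A = "matrix f"
  have mat: "matrix (\<lambda>y. reindex e (f (reindex (inv e) y))) = (\<chi> i j. ?A $ e i $ e j)"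
    unfolding matrix_def ax by (simp add: reindex_def vec_eq_iff)
  have bij: "bij_betw (\<lambda>p. e \<circ> p \<circ> inv e) {p. p permutes UNIV} {p. p permutes UNIV}"
  proof (rule bij_betwI[where g = "\<lambda>p. inv e \<circ> p \<circ> e"])
    have "bij (e \<circ> p \<circ> inv e)" if "bij p" for p
      using e that by (intro bij_comp bij_imp_bij_inv)
    then show "(\<lambda>p. e \<circ> p \<circ> inv e) \<in> {p. p permutes UNIV} \<rightarrow> {p. p permutes UNIV}"
      by (auto simp: permutes_bij intro: bij_imp_permutes)
    have "bij (inv e \<circ> p \<circ> e)" if "bij p" for p
      using e that by (intro bij_comp bij_imp_bij_inv)
    then show "(\<lambda>p. inv e \<circ> p \<circ> e) \<in> {p. p permutes UNIV} \<rightarrow> {p. p permutes UNIV}"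
      by (auto simp: permutes_bij intro: bij_imp_permutes)
  qed (use e in \<open>auto simp: fun_eq_iff bij_is_inj bij_is_surj surj_f_inv_f\<close>)
  have sgn: "sign (e \<circ> p \<circ> inv e) = sign p" if "p permutes UNIV" for p
  proof -
    have "map_permutation UNIV e p = e \<circ> p \<circ> inv e"
      using e by (auto simp: map_permutation_def fun_eq_iff bij_is_surj restrict_id_def)
    moreover have "sign (map_permutation UNIV e p) = sign p"
      by (rule sign_map_permutation) (use that e in \<open>auto simp: bij_is_inj\<close>)
    ultimately show ?thesis by simp
  qed
  have "det ?A = (\<Sum>p | p permutes UNIV. of_int (sign p) * (\<Prod>i\<in>UNIV. ?A $ i $ p i))"
    by (simp add: det_def)
  also have "\<dots> = (\<Sum>p | p permutes UNIV. of_int (sign (e \<circ> p \<circ> inv e)) * (\<Prod>i\<in>UNIV. ?A $ i $ (e \<circ> p \<circ> inv e) i))"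
    by (rule sum.reindex_bij_betw[OF bij, symmetric])
  also have "\<dots> = (\<Sum>p | p permutes UNIV. of_int (sign p) * (\<Prod>j\<in>UNIV. ?A $ e j $ e (p j)))"
  proof (rule sum.cong[OF refl])
    fix p :: "'n \<Rightarrow> 'n"
    assume "p \<in> {p. p permutes UNIV}"
    moreover have "(\<Prod>i\<in>UNIV. ?A $ i $ (e \<circ> p \<circ> inv e) i) = (\<Prod>j\<in>UNIV. ?A $ e j $ (e \<circ> p \<circ> inv e) (e j))"
      by (rule prod.reindex_bij_betw[symmetric]) (rule e)
    ultimately show "of_int (sign (e \<circ> p \<circ> inv e)) * (\<Prod>i\<in>UNIV. ?A $ i $ (e \<circ> p \<circ> inv e) i) =
        of_int (sign p) * (\<Prod>j\<in>UNIV. ?A $ e j $ e (p j))"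
      using e sgn by (simp add: bij_is_inj)
  qed
  finally show ?thesis
    by (simp add: mat det_def)
qed

text \<open>Extends the change of variables for images of finite measure to an identity between
  extended reals. A Borel image that is not \<open>lmeasurable\<close> has infinite measure, and
  then the integral is infinite too, since its finiteness would make the image
  \<open>lmeasurable\<close>.\<close>

lemma emeasure_image_wellorder:
  fixes f :: "real^'n::{finite,wellorder} \<Rightarrow> real^'n::_"
  assumes E: "E \<in> sets borel" "f ` E \<in> sets borel"
    and der: "\<And>x. x \<in> E \<Longrightarrow> (f has_derivative f' x) (at x)" and inj: "inj_on f E"
    and meas: "(\<lambda>x. indicator E x * \<bar>det (matrix (f' x))\<bar>) \<in> borel_measurable borel"
  shows "emeasure lborel (f ` E) = (\<integral>\<^sup>+x. ennreal (indicator E x * \<bar>det (matrix (f' x))\<bar>) \<partial>lborel)"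
proof -
  have E': "E \<in> sets lebesgue"
    using E by simp
  have der': "\<And>x. x \<in> E \<Longrightarrow> (f has_derivative f' x) (at x within E)"
    using der by (rule has_derivative_at_withinI)
  show ?thesis
  proof (cases "f ` E \<in> lmeasurable")
    case True
    then have "((\<lambda>x. \<bar>det (matrix (f' x))\<bar>) has_integral (measure lebesgue (f ` E))) E"
      using has_measure_differentiable_image[OF E' der' inj] by blast
    from nn_integral_has_integral_lebesgue[OF _ this]
    have "(\<integral>\<^sup>+x. ennreal (indicator E x * \<bar>det (matrix (f' x))\<bar>) \<partial>lborel) = measure lebesgue (f ` E)"
      by simp
    also have "\<dots> = emeasure lebesgue (f ` E)"
      using True by (simp add: emeasure_eq_measure2)
    also have "\<dots> = emeasure lborel (f ` E)"
      using E(2) by simp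
    finally show ?thesis ..
  next
    case False
    have "emeasure lborel (f ` E) = \<infinity>"
      using False E(2) by (auto simp: fmeasurable_def less_top[symmetric])
    moreover have "(\<integral>\<^sup>+x. ennreal (indicator E x * \<bar>det (matrix (f' x))\<bar>) \<partial>lborel) = \<infinity>"
    proof (rule ccontr)
      assume "\<not> ?thesis"
      then have "(\<lambda>x. indicator E x * \<bar>det (matrix (f' x))\<bar>) integrable_on UNIV"
        by (intro nn_integral_integrable_on meas) (auto simp: top.not_eq_extremum)
      then have "(\<lambda>x. if x \<in> E then \<bar>det (matrix (f' x))\<bar> else 0) integrable_on UNIV"
        by (rule integrable_eq) (auto simp: indicator_def)
      then have "(\<lambda>x. \<bar>det (matrix (f' x))\<bar>) integrable_on E"
        by (simp add: integrable_restrict_UNIV)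
      then show False
        using False measurable_differentiable_image_eq[OF E' der' inj] by blast
    qed
    ultimately show ?thesis by simp
  qed
qed

text \<open>Conjugate \<open>f\<close> with the relabelling onto a well-ordered index type;
  measures, Jacobians and integrals are carried over unchanged.\<close>

lemma emeasure_inj_image:
  fixes f :: "real^'m::finite \<Rightarrow> real^'m"
  assumes E: "E \<in> sets borel" "f ` E \<in> sets borel"
    and der: "\<And>x. x \<in> E \<Longrightarrow> (f has_derivative f' x) (at x)" and inj: "inj_on f E"
    and meas: "(\<lambda>x. indicator E x * \<bar>det (matrix (f' x))\<bar>) \<in> borel_measurable borel"
  shows "emeasure lborel (f ` E) = (\<integral>\<^sup>+x. ennreal (indicator E x * \<bar>det (matrix (f' x))\<bar>) \<partial>lborel)"
proof -
  obtain e :: "'m enumerated \<Rightarrow> 'm" where e: "bij e"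
    using ex_bij_enumerated by blast
  let ?P = "reindex e" and ?Q = "reindex (inv e)"
  note [simp] = reindex_inverse[OF e]
  note [measurable] = E meas
  have e': "bij (inv e)"
    using e by (rule bij_imp_bij_inv)
  define F where "F = (\<lambda>y. ?P (f (?Q y)))"
  define F' where "F' = (\<lambda>y h. ?P (f' (?Q y) (?Q h)))"
  have im: "?P ` S = ?Q -` S" for S
    by (auto intro: image_eqI[where x = "?Q _"])
  have FE: "F ` (?P ` E) = ?P ` (f ` E)"
    by (auto simp: F_def image_image)
  have borel_im: "?P ` S \<in> sets borel" if [measurable]: "S \<in> sets borel" for S
    unfolding im using measurable_sets[OF measurable_reindex that, of "inv e"] by simp
  have emeas: "emeasure lborel (?P ` S) = emeasure lborel S" if [measurable]: "S \<in> sets borel" for S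
    using emeasure_distr[of ?Q lborel lborel S] that
    by (simp add: im distr_lborel_reindex[OF e'])
  have ind: "indicator (?P ` E) y = indicator E (?Q y)" for y
    by (simp add: im indicator_def)
  have det: "det (matrix (F' y)) = det (matrix (f' (?Q y)))" for y
    unfolding F'_def by (rule det_reindex[OF e])
  have "emeasure lborel (F ` (?P ` E)) =
      (\<integral>\<^sup>+y. ennreal (indicator (?P ` E) y * \<bar>det (matrix (F' y))\<bar>) \<partial>lborel)"
  proof (rule emeasure_image_wellorder)
    show "(F has_derivative F' y) (at y)" if "y \<in> ?P ` E" for y
    proof -
      have "(f has_derivative f' (?Q y)) (at (?Q y))"
        using that by (intro der) (auto simp: im)
      from has_derivative_compose[OF has_derivative_compose[OF has_derivative_reindex this] has_derivative_reindex]
      show ?thesis unfolding F_def F'_def .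
    qed
    show "inj_on F (?P ` E)"
      using inj by (auto simp: F_def inj_on_def) (metis reindex_inverse(1)[OF e])
    show "(\<lambda>y. indicator (?P ` E) y * \<bar>det (matrix (F' y))\<bar>) \<in> borel_measurable borel"
      unfolding ind det using measurable_compose[OF measurable_reindex meas] .
  qed (auto simp: FE borel_im E)
  also have "\<dots> = (\<integral>\<^sup>+x. ennreal (indicator E x * \<bar>det (matrix (f' x))\<bar>) \<partial>lborel)"
    unfolding ind det by (rule nn_integral_reindex[OF e']) measurable
  finally show ?thesis
    by (simp add: FE emeas E)
qed

text \<open>The equidimensional case of Sard's theorem, where differentiability is enough. It serves
  to discard the critical values of the projections.\<close>

lemma negligible_singular_image:
  fixes f :: "real^'m::finite \<Rightarrow> real^'m"
  assumes der: "\<And>x. x \<in> S \<Longrightarrow> (f has_derivative f' x) (at x)"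
    and det0: "\<And>x. x \<in> S \<Longrightarrow> det (matrix (f' x)) = 0"
  shows "f ` S \<in> null_sets lebesgue"
proof -
  obtain e :: "'m enumerated \<Rightarrow> 'm" where e: "bij e"
    using ex_bij_enumerated by blast
  let ?P = "reindex e" and ?Q = "reindex (inv e)"
  note [simp] = reindex_inverse[OF e]
  define F where "F = (\<lambda>y. ?P (f (?Q y)))"
  define F' where "F' = (\<lambda>y h. ?P (f' (?Q y) (?Q h)))"
  have derF: "(F has_derivative F' y) (at y)" if "y \<in> ?P ` S" for y
  proof -
    have "(f has_derivative f' (?Q y)) (at (?Q y))"
      using that by (intro der) auto
    from has_derivative_compose[OF has_derivative_compose[OF has_derivative_reindex this] has_derivative_reindex]
    show ?thesis unfolding F_def F'_def .
  qed
  have "negligible (F ` (?P ` S))"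
  proof (rule baby_Sard)
    fix y assume y: "y \<in> ?P ` S"
    show "(F has_derivative F' y) (at y within ?P ` S)"
      using derF[OF y] by (rule has_derivative_at_withinI)
    have "det (matrix (F' y)) = 0"
      using y unfolding F'_def det_reindex[OF e] by (auto intro: det0)
    then show "rank (matrix (F' y)) < CARD('m enumerated)"
      by (simp add: det_eq_0_rank)
  qed simp
  then have "negligible (?Q ` (F ` (?P ` S)))"
    by (rule negligible_differentiable_image_negligible[rotated])
       (use bij_betw_same_card[OF e] in
         \<open>auto simp: differentiable_on_def intro: differentiableI has_derivative_reindex\<close>)
  then show ?thesis
    by (simp add: F_def image_image negligible_iff_null_sets)
qed

section \<open>Calculus of functions of class C^k\<close>

lemma pd_eqI: "(f has_derivative f') (at y) \<Longrightarrow> pd i f y = f' (axis i 1)"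
  unfolding pd_def by (metis frechet_derivative_at)

lemma has_derivative_pd:
  fixes f :: "real^'m::finite \<Rightarrow> real"
  assumes "f differentiable (at y)"
  shows "(f has_derivative (\<lambda>v. \<Sum>i\<in>UNIV. v $ i * pd i f y)) (at y)"
proof -
  have der: "(f has_derivative frechet_derivative f (at y)) (at y)"
    using assms frechet_derivative_works by blast
  then have lin: "linear (frechet_derivative f (at y))"
    by (rule has_derivative_linear)
  have "frechet_derivative f (at y) v = (\<Sum>i\<in>UNIV. v $ i * pd i f y)" for v
  proof -
    have "frechet_derivative f (at y) v = frechet_derivative f (at y) (\<Sum>i\<in>UNIV. v $ i *\<^sub>R axis i 1)"
      by (simp add: basis_expansion flip: scalar_mult_eq_scaleR)
    also have "\<dots> = (\<Sum>i\<in>UNIV. v $ i * pd i f y)"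
      by (simp add: linear_sum[OF lin] linear_cmul[OF lin] pd_def)
    finally show ?thesis .
  qed
  then have "frechet_derivative f (at y) = (\<lambda>v. \<Sum>i\<in>UNIV. v $ i * pd i f y)"
    by (rule ext)
  with der show ?thesis by simp
qed

lemma frechet_derivative_pd:
  fixes f :: "real^'m::finite \<Rightarrow> real"
  assumes "f differentiable (at y)"
  shows "frechet_derivative f (at y) v = (\<Sum>i\<in>UNIV. v $ i * pd i f y)"
  using frechet_derivative_at[OF has_derivative_pd[OF assms]] by (simp add: fun_eq_iff)

lemma frechet_derivative_cong_open:
  assumes "open S" "y \<in> S" "\<And>x. x \<in> S \<Longrightarrow> f x = g x"
  shows "frechet_derivative f (at y) = frechet_derivative g (at y)"
proof -
  have "(f has_derivative f') (at y) \<longleftrightarrow> (g has_derivative f') (at y)" for f'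
    by (rule iffI; erule has_derivative_transform_within_open[OF _ assms(1,2)]) (simp_all add: assms(3))
  then show ?thesis
    by (simp add: frechet_derivative_def)
qed

lemma pd_cong:
  assumes "open S" "y \<in> S" "\<And>x. x \<in> S \<Longrightarrow> f x = g x"
  shows "pd i f y = pd i g y"
  using frechet_derivative_cong_open[OF assms] by (simp add: pd_def)

lemma differentiable_cong_open:
  assumes "open S" "y \<in> S" "\<And>x. x \<in> S \<Longrightarrow> f x = g x" "f differentiable (at y)"
  shows "g differentiable (at y)"
proof -
  obtain f' where "(f has_derivative f') (at y)"
    using assms(4) unfolding differentiable_def ..
  then have "(g has_derivative f') (at y)"
    by (rule has_derivative_transform_within_open[OF _ assms(1,2)]) (rule assms(3))
  then show ?thesis
    by (rule differentiableI)
qed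

lemma Ck_on_cong:
  assumes "open S" "\<And>x. x \<in> S \<Longrightarrow> f x = g x"
  shows "Ck_on k S f \<longleftrightarrow> Ck_on k S g"
  using assms(2)
proof (induction k arbitrary: f g)
  case 0
  then show ?case by (auto intro: continuous_on_cong[THEN iffD1, rotated 2])
next
  case (Suc k)
  have "f differentiable (at y) \<longleftrightarrow> g differentiable (at y)" if "y \<in> S" for y
    by (rule iffI; erule differentiable_cong_open[OF assms(1) that, rotated]) (simp_all add: Suc.prems)
  moreover have "Ck_on k S (pd i f) \<longleftrightarrow> Ck_on k S (pd i g)" for i
    by (rule Suc.IH) (rule pd_cong[OF assms(1) _ Suc.prems])
  ultimately show ?case by simp
qed

lemma Ck_on_subset: "Ck_on k S f \<Longrightarrow> S' \<subseteq> S \<Longrightarrow> Ck_on k S' f"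
proof (induction k arbitrary: f)
  case 0
  then show ?case by (simp add: continuous_on_subset)
next
  case (Suc k)
  then show ?case by (simp add: subset_iff)
qed

lemma Ck_on_SucD: "Ck_on (Suc k) S f \<Longrightarrow> Ck_on k S f"
proof (induction k arbitrary: f)
  case 0
  then show ?case
    by (simp add: continuous_at_imp_continuous_on differentiable_imp_continuous_within)
next
  case (Suc k)
  then have "\<And>i. Ck_on (Suc k) S (pd i f)" "\<And>y. y \<in> S \<Longrightarrow> f differentiable (at y)"
    by (simp_all del: Ck_on.simps(2) add: Ck_on.simps(2)[of "Suc k"])
  with Suc.IH show ?case by simp
qed

lemma Ck_on_le:
  assumes "Ck_on k S f" "j \<le> k"
  shows "Ck_on j S f"
  using assms(2,1) by (induction rule: inc_induct) (blast intro: Ck_on_SucD)+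

lemma Ck_on_imp_continuous_on: "Ck_on k S f \<Longrightarrow> continuous_on S f"
  using Ck_on_le[of k S f 0] by simp

text \<open>\<open>Ck_on\<close> speaks of derivatives in the full space, so it is a local
  condition. This is what allows gluing along charts and extension by zero.\<close>

lemma Ck_on_local:
  assumes "\<And>y. y \<in> S \<Longrightarrow> \<exists>V. open V \<and> y \<in> V \<and> Ck_on k V f"
  shows "Ck_on k S f"
  using assms
proof (induction k arbitrary: f)
  case 0
  then show ?case
    by (metis Ck_on.simps(1) continuous_at_imp_continuous_on continuous_on_eq_continuous_at)
next
  case (Suc k)
  then show ?case
    by (metis Ck_on.simps(2))
qed

lemma Ck_on_const: "Ck_on k S (\<lambda>y. c)"
proof (induction k arbitrary: c)
  case (Suc k)
  have "pd i (\<lambda>y. c) = (\<lambda>y::real^'a. 0)" for i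
    by (rule ext) (simp add: pd_eqI[OF has_derivative_const])
  with Suc[of 0] show ?case by simp
qed simp

lemma sum_axis_mult: "(\<Sum>j\<in>UNIV. axis i (1::real) $ j * h j) = h (i :: 'm::finite)"
  by (simp add: axis_def if_distrib[of "\<lambda>x. x * _"] sum.delta cong: if_cong)

lemma pd_add:
  assumes "f differentiable (at y)" "g differentiable (at y)"
  shows "pd i (\<lambda>y. f y + g y) y = pd i f y + pd i g y"
  using pd_eqI[OF has_derivative_add[OF has_derivative_pd[OF assms(1)] has_derivative_pd[OF assms(2)]], of i]
  by (simp add: sum_axis_mult)

lemma Ck_on_add:
  assumes "open S" "Ck_on k S f" "Ck_on k S g"
  shows "Ck_on k S (\<lambda>y. f y + g y)"
  using assms(2,3)
proof (induction k arbitrary: f g)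
  case 0
  then show ?case by (simp add: continuous_on_add)
next
  case (Suc k)
  have pd: "pd i (\<lambda>y. f y + g y) y = pd i f y + pd i g y" if "y \<in> S" for i y
    using Suc.prems that by (intro pd_add) auto
  have "Ck_on k S (\<lambda>y. pd i f y + pd i g y)" for i
    using Suc by auto
  then have "Ck_on k S (pd i (\<lambda>y. f y + g y))" for i
    using Ck_on_cong[OF assms(1), of "pd i (\<lambda>y. f y + g y)" "\<lambda>y. pd i f y + pd i g y"] pd by blast
  then show ?case using Suc.prems by (auto intro: differentiable_add)
qed

lemma pd_mult:
  assumes "f differentiable (at y)" "g differentiable (at y)"
  shows "pd i (\<lambda>y. f y * g y) y = f y * pd i g y + pd i f y * g y"
  using pd_eqI[OF has_derivative_mult[OF has_derivative_pd[OF assms(1)] has_derivative_pd[OF assms(2)]], of i]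
  by (simp add: sum_axis_mult)

lemma Ck_on_mult:
  assumes "open S" "Ck_on k S f" "Ck_on k S g"
  shows "Ck_on k S (\<lambda>y. f y * g y)"
  using assms(2,3)
proof (induction k arbitrary: f g)
  case 0
  then show ?case by (simp add: continuous_on_mult)
next
  case (Suc k)
  have "Ck_on k S (\<lambda>y. f y * pd i g y + pd i f y * g y)" for i
    using Suc.prems Suc.prems[THEN Ck_on_SucD] by (intro Ck_on_add[OF assms(1)] Suc.IH) auto
  then have "Ck_on k S (pd i (\<lambda>y. f y * g y))" for i
    using Ck_on_cong[OF assms(1), of "pd i (\<lambda>y. f y * g y)" "\<lambda>y. f y * pd i g y + pd i f y * g y"]
      pd_mult[of f _ g] Suc.prems by simp
  then show ?case using Suc.prems by (auto intro: differentiable_mult)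
qed

lemma Ck_on_sum:
  assumes "open S" "\<And>a. a \<in> I \<Longrightarrow> Ck_on k S (f a)"
  shows "Ck_on k S (\<lambda>y. \<Sum>a\<in>I. f a y)"
  using assms(2) by (induction I rule: infinite_finite_induct) (simp_all add: Ck_on_const Ck_on_add[OF assms(1)])

lemma has_derivative_vec:
  fixes \<phi> :: "'b::real_normed_vector \<Rightarrow> real^'n::finite"
  assumes "\<And>a. ((\<lambda>y. \<phi> y $ a) has_derivative (\<lambda>v. D v $ a)) F"
  shows "(\<phi> has_derivative D) F"
proof -
  have "((\<lambda>y. \<Sum>a\<in>UNIV. (\<phi> y $ a) *\<^sub>R axis a (1::real)) has_derivative (\<lambda>v. \<Sum>a\<in>UNIV. (D v $ a) *\<^sub>R axis a 1)) F"
    by (intro has_derivative_sum has_derivative_scaleR_left assms)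
  then show ?thesis
    by (simp add: basis_expansion flip: scalar_mult_eq_scaleR)
qed

lemma pd_compose:
  fixes \<phi> :: "real^'m::finite \<Rightarrow> real^'n::finite"
  assumes "F differentiable (at (\<phi> y))" "\<And>a. (\<lambda>y. \<phi> y $ a) differentiable (at y)"
  shows "(\<lambda>y. F (\<phi> y)) differentiable (at y)"
    and "pd i (\<lambda>y. F (\<phi> y)) y = (\<Sum>a\<in>UNIV. pd a F (\<phi> y) * pd i (\<lambda>y. \<phi> y $ a) y)"
proof -
  have "(\<phi> has_derivative (\<lambda>v. \<chi> a. \<Sum>i\<in>UNIV. v $ i * pd i (\<lambda>y. \<phi> y $ a) y)) (at y)"
    using has_derivative_pd[OF assms(2)] by (intro has_derivative_vec) simp
  from has_derivative_compose[OF this has_derivative_pd[OF assms(1)]]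
  have der: "((\<lambda>y. F (\<phi> y)) has_derivative
      (\<lambda>v. \<Sum>a\<in>UNIV. (\<Sum>i\<in>UNIV. v $ i * pd i (\<lambda>y. \<phi> y $ a) y) * pd a F (\<phi> y))) (at y)"
    by simp
  then show "(\<lambda>y. F (\<phi> y)) differentiable (at y)"
    by (rule differentiableI)
  show "pd i (\<lambda>y. F (\<phi> y)) y = (\<Sum>a\<in>UNIV. pd a F (\<phi> y) * pd i (\<lambda>y. \<phi> y $ a) y)"
    by (subst pd_eqI[OF der])
       (simp add: sum_axis_mult mult.commute)
qed

text \<open>\<open>F\<close> is generalised in the induction, because the chain rule replaces it by
  its partial derivatives, composed with the same \<open>\<phi>\<close>.\<close>

lemma Ck_on_compose:
  fixes \<phi> :: "real^'m::finite \<Rightarrow> real^'n::finite"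
  assumes "open S" "open V" "\<phi> ` S \<subseteq> V" "\<And>a. Ck_on k S (\<lambda>y. \<phi> y $ a)" "Ck_on k V F"
  shows "Ck_on k S (\<lambda>y. F (\<phi> y))"
  using assms(4,5)
proof (induction k arbitrary: F)
  case 0
  have "continuous_on S \<phi>"
    using 0(1) continuous_on_vec_lambda[of S "\<lambda>a y. \<phi> y $ a"] by simp
  with 0 show ?case
    using assms(3) by (simp add: continuous_on_compose2)
next
  case (Suc k)
  have diff: "F differentiable (at (\<phi> y))" "(\<lambda>y. \<phi> y $ a) differentiable (at y)" if "y \<in> S" for y a
    using Suc.prems that assms(3) by auto
  have "Ck_on k S (\<lambda>y. \<Sum>a\<in>UNIV. pd a F (\<phi> y) * pd i (\<lambda>y. \<phi> y $ a) y)" for i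
  proof (rule Ck_on_sum[OF assms(1)], rule Ck_on_mult[OF assms(1)])
    fix a
    show "Ck_on k S (\<lambda>y. pd a F (\<phi> y))"
      by (rule Suc.IH) (use Suc.prems Suc.prems(1)[THEN Ck_on_SucD] in auto)
    show "Ck_on k S (pd i (\<lambda>y. \<phi> y $ a))"
      using Suc.prems by simp
  qed
  moreover have "pd i (\<lambda>y. F (\<phi> y)) y = (\<Sum>a\<in>UNIV. pd a F (\<phi> y) * pd i (\<lambda>y. \<phi> y $ a) y)"
    if "y \<in> S" for i y
    by (rule pd_compose(2)) (rule diff[OF that])+
  ultimately have "Ck_on k S (pd i (\<lambda>y. F (\<phi> y)))" for i
    by (subst Ck_on_cong[OF assms(1)]) auto
  moreover have "(\<lambda>y. F (\<phi> y)) differentiable (at y)" if "y \<in> S" for y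
    by (rule pd_compose(1)) (rule diff[OF that])+
  ultimately show ?case by simp
qed

text \<open>A smooth function of one variable is presented as a sequence \<open>D\<close> of
  successive derivatives. The index \<open>n\<close> stays free because the chain rule passes from
  \<open>D n\<close> to \<open>D (Suc n)\<close>.\<close>

lemma Ck_on_compose_real:
  fixes u :: "real^'m::finite \<Rightarrow> real"
  assumes "open S" "u ` S \<subseteq> I" "Ck_on k S u"
    and "\<And>n x. x \<in> I \<Longrightarrow> (D n has_real_derivative D (Suc n) x) (at x)"
  shows "Ck_on k S (\<lambda>y. D n (u y))"
  using assms(3)
proof (induction k arbitrary: n)
  case 0
  have "continuous_on (u ` S) (D n)"
  proof (intro continuous_at_imp_continuous_on ballI)
    fix x assume "x \<in> u ` S"
    then have "x \<in> I" using assms(2) by blast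
    then show "isCont (D n) x" by (rule DERIV_isCont[OF assms(4)])
  qed
  with 0 show ?case
    using continuous_on_compose2[of "u ` S" "D n" S u] by simp
next
  case (Suc k)
  have der: "((\<lambda>y. D n (u y)) has_derivative (\<lambda>v. D (Suc n) (u y) * (\<Sum>i\<in>UNIV. v $ i * pd i u y))) (at y)"
    if "y \<in> S" for y
  proof (rule has_derivative_compose[OF has_derivative_pd])
    show "u differentiable (at y)"
      using Suc.prems that by simp
    have "u y \<in> I" using assms(2) that by blast
    then show "(D n has_derivative (*) (D (Suc n) (u y))) (at (u y))"
      using assms(4) by (simp add: has_field_derivative_def)
  qed
  have pd: "pd i (\<lambda>y. D n (u y)) y = D (Suc n) (u y) * pd i u y" if "y \<in> S" for y i
    by (subst pd_eqI[OF der[OF that]]) (simp add: sum_axis_mult)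
  have "Ck_on k S (\<lambda>y. D (Suc n) (u y) * pd i u y)" for i
    by (rule Ck_on_mult[OF assms(1)]) (use Suc.prems Suc.IH[OF Ck_on_SucD[OF Suc.prems]] in auto)
  then have "Ck_on k S (pd i (\<lambda>y. D n (u y)))" for i
    by (subst Ck_on_cong[OF assms(1)]) (auto simp: pd)
  then show ?case using der by (auto simp: differentiable_def)
qed

lemma Ck_on_nth:
  fixes a :: "'m::finite"
  shows "Ck_on k S (\<lambda>y. y $ a)"
proof (cases k)
  case (Suc k')
  have der: "((\<lambda>y. y $ a) has_derivative (\<lambda>v. v $ a)) (at y)" for y :: "real^'m"
    by (intro bounded_linear_imp_has_derivative bounded_linear_vec_nth)
  have "pd i (\<lambda>y. y $ a) = (\<lambda>y. axis i 1 $ a)" for i :: 'm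
    by (rule ext, rule pd_eqI, rule der)
  with Suc show ?thesis using der by (auto simp: differentiable_def intro: Ck_on_const)
qed (simp add: continuous_on_component)

lemmas Ck_on_intros = Ck_on_const Ck_on_nth Ck_on_add Ck_on_mult Ck_on_sum

section \<open>The area formula as a bound by the multiplicity\<close>

lemma continuous_on_det:
  fixes A :: "'b::topological_space \<Rightarrow> real^'n::finite^'n"
  assumes "\<And>i j. continuous_on S (\<lambda>x. A x $ i $ j)"
  shows "continuous_on S (\<lambda>x. det (A x))"
  unfolding det_def by (intro continuous_intros assms)

lemma matrix_of_linear_mult:
  fixes f :: "real^'n::finite \<Rightarrow> real^'m::finite"
  assumes "linear f"
  shows "matrix f *v x = f x"
  using assms by (simp add: matrix_works linear_matrix_vector_mul_eq)

text \<open>The injectivity half of the inverse function theorem. Continuity of the entries of the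
  derivative is turned into continuity in operator norm by bounding \<open>onorm\<close> by the sum
  of the absolute values of the entries.\<close>

lemma C1_locally_injective:
  fixes f :: "real^'m::finite \<Rightarrow> real^'m"
  assumes U: "open U" "a \<in> U"
    and der: "\<And>x. x \<in> U \<Longrightarrow> (f has_derivative f' x) (at x)"
    and cont: "\<And>i j. continuous_on U (\<lambda>x. matrix (f' x) $ i $ j)"
    and det: "det (matrix (f' a)) \<noteq> 0"
  obtains r where "r > 0" "ball a r \<subseteq> U" "inj_on f (ball a r)"
proof -
  have lin: "linear (f' x)" if "x \<in> U" for x
    using der[OF that] by (rule has_derivative_linear)
  have "invertible (matrix (f' a))"
    using det by (simp add: invertible_det_nz)
  then obtain B where B: "B ** matrix (f' a) = mat 1"
    by (auto simp: invertible_def)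
  have small: "\<exists>d>0. \<forall>x. dist a x < d \<longrightarrow> onorm (\<lambda>v. f' x v - f' a v) < e" if "e > 0" for e
  proof -
    define h where "h x = (\<Sum>i\<in>UNIV. \<Sum>j\<in>UNIV. \<bar>matrix (f' x) $ i $ j - matrix (f' a) $ i $ j\<bar>)" for x
    have "continuous_on U h"
      unfolding h_def by (intro continuous_intros cont)
    then have "isCont h a"
      using U by (simp add: continuous_on_eq_continuous_at)
    then obtain d1 where d1: "d1 > 0" "\<And>x. dist x a < d1 \<Longrightarrow> dist (h x) (h a) < e"
      using \<open>e > 0\<close> unfolding continuous_at_eps_delta by blast
    obtain d2 where d2: "d2 > 0" "ball a d2 \<subseteq> U"
      using U openE by blast
    show ?thesis
    proof (intro exI[of _ "min d1 d2"] conjI allI impI)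
      fix x assume x: "dist a x < min d1 d2"
      then have "x \<in> U" using d2 by auto
      have "(\<lambda>v. f' x v - f' a v) = (*v) (matrix (f' x) - matrix (f' a))"
        by (simp add: fun_eq_iff matrix_vector_mult_diff_rdistrib matrix_of_linear_mult[OF lin[OF \<open>x \<in> U\<close>]]
            matrix_of_linear_mult[OF lin[OF U(2)]])
      then have "onorm (\<lambda>v. f' x v - f' a v) \<le> h x"
        using onorm_le_matrix_component_sum[of "matrix (f' x) - matrix (f' a)"] by (simp add: h_def)
      also have "\<dots> < e"
        using d1(2)[of x] x by (simp add: h_def dist_commute dist_real_def)
      finally show "onorm (\<lambda>v. f' x v - f' a v) < e" .
    qed (use d1 d2 in auto)
  qed
  have "(*v) B \<circ> f' a = id"
    using matrix_of_linear_mult[OF lin[OF U(2)]] B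
    by (simp add: fun_eq_iff) (metis matrix_vector_mul_assoc matrix_vector_mul_lid)
  then show thesis
    using has_derivative_locally_injective[OF U(2,1) matrix_vector_mul_bounded_linear _ der small, of B] that
    by blast
qed

text \<open>By invariance of domain, \<open>f\<close> has a continuous inverse on an open image, so
  the image of a Borel set is a Borel preimage under that inverse.\<close>

lemma borel_inj_image:
  fixes f :: "real^'m::finite \<Rightarrow> real^'m"
  assumes "open V" "continuous_on V f" "inj_on f V" "E \<in> sets borel" "E \<subseteq> V"
  shows "f ` E \<in> sets borel"
proof -
  have op: "open (f ` V)"
    using invariance_of_domain[OF assms(2,1,3)] .
  obtain g where hom: "homeomorphism V (f ` V) f g"
    using invariance_of_domain_homeomorphism[OF assms(1,2) _ assms(3)] by auto
  have "f ` E = g -` E \<inter> f ` V"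
    using hom assms(5) by (auto simp: homeomorphism_def)
  moreover have "g -` E \<inter> f ` V \<in> sets (restrict_space borel (f ` V))"
    using measurable_sets[OF borel_measurable_continuous_on_restrict assms(4), of "f ` V" g] hom
    by (simp add: homeomorphism_def space_restrict_space)
  ultimately show ?thesis
    using op by (simp add: sets_restrict_space_iff)
qed

text \<open>One half of the area formula, in which the Jacobian integral equals the integral of the
  number of preimages. It is applied contrapositively: a large integral over a small target
  \<open>B\<close> forces some value outside the null set \<open>Z\<close> to have more than
  \<open>K\<close> preimages.\<close>

lemma nn_integral_jacobian_le_multiplicity:
  fixes f :: "real^'m::finite \<Rightarrow> real^'m"
  assumes U: "open U"
    and der: "\<And>x. x \<in> U \<Longrightarrow> (f has_derivative f' x) (at x)"
    and cont: "\<And>i j. continuous_on U (\<lambda>x. matrix (f' x) $ i $ j)"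
    and B: "B \<in> sets borel" and Z: "Z \<in> null_sets lebesgue"
    and few: "\<And>y F. y \<in> B - Z \<Longrightarrow> finite F \<Longrightarrow> F \<subseteq> {x \<in> U. f x = y} \<Longrightarrow> card F \<le> K"
  shows "(\<integral>\<^sup>+x. ennreal (indicator {x \<in> U. f x \<in> B} x * \<bar>det (matrix (f' x))\<bar>) \<partial>lborel)
    \<le> K * emeasure lborel B"
proof -
  let ?d = "\<lambda>x. \<bar>det (matrix (f' x))\<bar>"
  have contf: "continuous_on U f"
    using has_derivative_continuous[OF der] by (simp add: continuous_at_imp_continuous_on)
  have contd: "continuous_on U (\<lambda>x. det (matrix (f' x)))"
    by (rule continuous_on_det) (rule cont)
  \<comment> \<open>The points of zero Jacobian contribute nothing to the integral; near all others
    \<open>f\<close> is injective.\<close>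
  define U0 where "U0 = {x \<in> U. det (matrix (f' x)) \<noteq> 0}"
  have U0: "open U0"
  proof -
    have "U0 = U \<inter> (\<lambda>x. det (matrix (f' x))) -` (- {0})"
      by (auto simp: U0_def)
    then show ?thesis
      using continuous_open_preimage[OF contd U, of "- {0}"] by auto
  qed
  define \<V> where "\<V> = {V. open V \<and> V \<subseteq> U0 \<and> inj_on f V}"
  obtain \<V>' where V': "\<V>' \<subseteq> \<V>" "countable \<V>'" "\<Union>\<V>' = \<Union>\<V>"
    using Lindelof[of \<V>] by (auto simp: \<V>_def)
  have cover: "\<Union>\<V> = U0"
  proof
    show "U0 \<subseteq> \<Union>\<V>"
    proof
      fix a assume a: "a \<in> U0"
      obtain r where "r > 0" "ball a r \<subseteq> U0" "inj_on f (ball a r)"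
      proof (rule C1_locally_injective[OF U0 a])
        show "continuous_on U0 (\<lambda>x. matrix (f' x) $ i $ j)" for i j
          by (rule continuous_on_subset[OF cont]) (auto simp: U0_def)
      qed (use a in \<open>auto simp: U0_def intro: der\<close>)
      then show "a \<in> \<Union>\<V>"
        by (auto simp: \<V>_def intro!: exI[of _ "ball a r"])
    qed
  qed (auto simp: \<V>_def)
  \<comment> \<open>The empty set is inserted so that the enumeration is onto even when the
    countable cover is empty.\<close>
  define V where "V = from_nat_into (insert {} \<V>')"
  have rangeV: "range V = insert {} \<V>'"
    unfolding V_def using V'(2) by (intro range_from_nat_into) auto
  have V: "open (V n)" "V n \<subseteq> U0" "inj_on f (V n)" for n
  proof -
    have "V n = {} \<or> V n \<in> \<V>"
      using rangeV V'(1) by (metis insertE rangeI subsetD)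
    then show "open (V n)" "V n \<subseteq> U0" "inj_on f (V n)"
      by (auto simp: \<V>_def)
  qed
  have UnV: "(\<Union>n. V n) = U0"
    using V'(3) by (simp add: rangeV cover)
  define W where "W n = disjointed V n \<inter> (f -` B \<inter> U)" for n
  have fB: "f -` B \<inter> U \<in> sets borel"
    using measurable_sets[OF borel_measurable_continuous_on_restrict[OF contf] B] U
    by (simp add: space_restrict_space sets_restrict_space_iff)
  have Wsub: "W n \<subseteq> V n" for n
    by (auto simp: W_def disjointed_def)
  have W [measurable]: "W n \<in> sets borel" for n
  proof -
    have "disjointed V n \<in> sets borel"
      using V(1) by (auto simp: disjointed_def intro!: sets.Diff sets.finite_UN)
    with fB show ?thesis by (auto simp: W_def)
  qed
  have disj: "disjoint_family W"
    using disjoint_family_disjointed[of V] by (auto simp: disjoint_family_on_def W_def)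
  have UnW: "(\<Union>n. W n) = U0 \<inter> f -` B"
    using UnV UN_disjointed_eq[of V] by (auto simp: W_def U0_def)
  have fW [measurable]: "f ` W n \<in> sets borel" for n
    using V[of n] contf by (intro borel_inj_image[of "V n"] W Wsub)
      (auto simp: U0_def intro: continuous_on_subset)
  have meas [measurable]: "(\<lambda>x. indicator (W n) x * ?d x) \<in> borel_measurable borel" for n
  proof -
    have "W n \<subseteq> U" using Wsub[of n] V(2)[of n] by (auto simp: U0_def)
    then have "continuous_on (W n) ?d"
      by (intro continuous_intros continuous_on_subset[OF contd])
    from borel_measurable_continuous_on_indicator[OF W this] show ?thesis by simp
  qed
  have point: "ennreal (indicator {x \<in> U. f x \<in> B} x * ?d x) = (\<Sum>n. ennreal (indicator (W n) x * ?d x))" for x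
  proof (cases "x \<in> U0 \<inter> f -` B")
    case True
    then obtain n where n: "x \<in> W n" using UnW by blast
    have "(\<Sum>k. ennreal (indicator (W k) x * ?d x)) = (\<Sum>k\<in>{n}. ennreal (indicator (W k) x * ?d x))"
      using n disj by (intro suminf_finite) (auto simp: disjoint_family_on_def indicator_def)
    then show ?thesis using n True by (auto simp: U0_def)
  next
    case False
    then have "\<And>n. x \<notin> W n" using UnW by blast
    then show ?thesis using False by (auto simp: U0_def indicator_def)
  qed
  have count: "(\<Sum>n. indicator (f ` W n) y) \<le> (of_nat K * indicator B y :: ennreal)" if "y \<notin> Z" for y
  proof (rule suminf_le_const)
    fix N
    define I where "I = {n. n < N \<and> y \<in> f ` W n}"
    have "(\<Sum>n<N. indicator (f ` W n) y) = (\<Sum>n\<in>I. 1 :: ennreal)"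
      by (rule sum.mono_neutral_cong_right) (auto simp: I_def indicator_def)
    then have "(\<Sum>n<N. indicator (f ` W n) y) = (of_nat (card I) :: ennreal)"
      by simp
    moreover have "card I \<le> K * indicator B y"
    proof (cases "y \<in> B")
      case False
      then have "I = {}" by (auto simp: I_def W_def)
      then show ?thesis by simp
    next
      case True
      have "\<forall>n\<in>I. \<exists>x. x \<in> W n \<and> f x = y" by (auto simp: I_def)
      then obtain x where x: "\<And>n. n \<in> I \<Longrightarrow> x n \<in> W n \<and> f (x n) = y" by metis
      have "inj_on x I"
        using x disj by (auto simp: inj_on_def disjoint_family_on_def) (metis IntI empty_iff)
      then have "card I = card (x ` I)" by (simp add: card_image)
      also have "\<dots> \<le> K"
        using x True that by (intro few[of y]) (auto simp: I_def W_def)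
      finally show ?thesis using True by simp
    qed
    ultimately show "(\<Sum>n<N. indicator (f ` W n) y) \<le> (of_nat K * indicator B y :: ennreal)"
      by (cases "y \<in> B") (auto simp: indicator_def)
  qed simp
  have "(\<integral>\<^sup>+x. ennreal (indicator {x \<in> U. f x \<in> B} x * ?d x) \<partial>lborel)
      = (\<integral>\<^sup>+x. (\<Sum>n. ennreal (indicator (W n) x * ?d x)) \<partial>lborel)"
    by (simp only: point)
  also have "\<dots> = (\<Sum>n. \<integral>\<^sup>+x. ennreal (indicator (W n) x * ?d x) \<partial>lborel)"
    by (rule nn_integral_suminf) simp
  also have "\<dots> = (\<Sum>n. emeasure lborel (f ` W n))"
  proof (intro suminf_cong emeasure_inj_image[symmetric])
    fix n
    show "inj_on f (W n)" using V(3) Wsub by (rule inj_on_subset)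
    show "(f has_derivative f' x) (at x)" if "x \<in> W n" for x
      using that by (intro der) (auto simp: W_def)
  qed (rule W fW meas)+
  also have "\<dots> = (\<Sum>n. \<integral>\<^sup>+y. indicator (f ` W n) y \<partial>lborel)"
    by simp
  also have "\<dots> = (\<integral>\<^sup>+y. (\<Sum>n. indicator (f ` W n) y) \<partial>lborel)"
    by (rule nn_integral_suminf[symmetric]) simp
  also have "\<dots> \<le> (\<integral>\<^sup>+y. of_nat K * indicator B y \<partial>lborel)"
  proof (rule nn_integral_mono_AE)
    have "AE y in lebesgue. y \<notin> Z"
      using Z by (rule AE_not_in)
    then have "AE y in lborel. y \<notin> Z"
      by (simp add: AE_completion_iff)
    then show "AE y in lborel. (\<Sum>n. indicator (f ` W n) y) \<le> (of_nat K * indicator B y :: ennreal)"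
      by eventually_elim (rule count)
  qed
  also have "\<dots> = K * emeasure lborel B"
    using B by (simp add: nn_integral_cmult)
  finally show ?thesis .
qed

section \<open>Compactly supported functions\<close>

lemma lborel_integral_translation:
  fixes f :: "'a::euclidean_space \<Rightarrow> real"
  assumes [measurable]: "f \<in> borel_measurable borel"
  shows "(LINT y|lborel. f (y + c)) = (LINT y|lborel. f y)"
proof -
  have "(LINT y|distr lborel borel ((+) c). f y) = (LINT y|lborel. f (c + y))"
    by (rule integral_distr) auto
  then show ?thesis
    by (simp add: lborel_distr_plus add.commute)
qed

lemma integrable_continuous_compact_support:
  fixes f :: "'a::euclidean_space \<Rightarrow> real"
  assumes "continuous_on UNIV f" "\<And>y. y \<notin> cball z R \<Longrightarrow> f y = 0"
  shows "integrable lborel f"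
proof -
  have "integrable lborel (\<lambda>y. indicator (cball z R) y *\<^sub>R f y)"
    by (rule borel_integrable_compact[OF compact_cball continuous_on_subset[OF assms(1)]]) simp
  moreover have "(\<lambda>y. indicator (cball z R) y *\<^sub>R f y) = f"
    using assms(2) by (auto simp: fun_eq_iff indicator_def)
  ultimately show ?thesis by simp
qed

lemma pd_eq_0_outside:
  assumes "\<And>y. y \<notin> cball z R \<Longrightarrow> u y = 0" "y \<notin> cball z R"
  shows "pd i u y = 0"
proof -
  have "pd i u y = pd i (\<lambda>y. 0) y"
    by (rule pd_cong[of "- cball z R"]) (use assms in auto)
  also have "\<dots> = 0"
    by (rule pd_eqI) (rule has_derivative_const)
  finally show ?thesis .
qed

text \<open>The difference quotients of \<open>u\<close> have integral zero by translation
  invariance, and they converge to the derivative. The mean value theorem dominates them by a bound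
  of the derivative on the ball enlarged by 1, the steps \<open>h n\<close> being at most 1.\<close>

lemma integral_pd_eq_0:
  fixes u :: "real^'m::finite \<Rightarrow> real"
  assumes C1: "Ck_on 1 UNIV u" and supp: "\<And>y. y \<notin> cball z R \<Longrightarrow> u y = 0"
  shows "integrable lborel (pd i u)" and "(LINT y|lborel. pd i u y) = 0"
proof -
  have diff: "u differentiable (at y)" for y
    using C1 by (simp add: One_nat_def)
  have cont: "continuous_on UNIV (pd i u)"
    using C1 by (simp add: One_nat_def)
  have contu: "continuous_on UNIV u"
    using Ck_on_imp_continuous_on[OF C1] .
  have pd0: "pd i u y = 0" if "y \<notin> cball z R" for y
    using supp that by (rule pd_eq_0_outside)
  show "integrable lborel (pd i u)"
    by (rule integrable_continuous_compact_support[OF cont pd0])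
  have intu: "integrable lborel u"
    by (rule integrable_continuous_compact_support[OF contu supp])
  obtain C where C: "\<And>y. \<bar>pd i u y\<bar> \<le> C"
  proof -
    have "compact (pd i u ` cball z R)"
      by (intro compact_continuous_image continuous_on_subset[OF cont]) auto
    then obtain C where "\<And>y. y \<in> cball z R \<Longrightarrow> \<bar>pd i u y\<bar> \<le> C"
      using compact_imp_bounded by (fastforce simp: bounded_iff)
    then have "\<bar>pd i u y\<bar> \<le> max C 0" for y
      using pd0[of y] by (cases "y \<in> cball z R") (auto simp: le_max_iff_disj)
    then show thesis using that by blast
  qed
  define h where "h n = 1 / real (Suc n)" for n
  have h: "0 < h n" "h n \<le> 1" for n by (auto simp: h_def)
  define q where "q n y = (u (y + h n *\<^sub>R axis i 1) - u y) / h n" for n y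
  have line: "((\<lambda>t. u (y + t *\<^sub>R axis i 1)) has_real_derivative pd i u (y + t *\<^sub>R axis i 1)) (at t)" for y t
  proof -
    have "((\<lambda>t. y + t *\<^sub>R axis i 1) has_derivative (\<lambda>s. s *\<^sub>R axis i 1)) (at t)"
      by (auto intro!: derivative_eq_intros)
    from has_derivative_compose[OF this has_derivative_pd[OF diff]]
    moreover have "(\<Sum>k\<in>UNIV. (s *\<^sub>R axis i 1) $ k * pd k u (y + t *\<^sub>R axis i 1)) = pd i u (y + t *\<^sub>R axis i 1) * s" for s
      using sum_axis_mult[of i "\<lambda>k. pd k u (y + t *\<^sub>R axis i 1)"]
      by (simp add: mult.assoc mult.commute flip: sum_distrib_left)
    ultimately show ?thesis
      by (simp add: has_field_derivative_def)
  qed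
  have bound: "\<bar>q n y\<bar> \<le> C * indicator (cball z (R + 1)) y" for n y
  proof -
    obtain t where t: "0 < t" "t < h n"
      "u (y + h n *\<^sub>R axis i 1) - u (y + 0 *\<^sub>R axis i 1) = (h n - 0) * pd i u (y + t *\<^sub>R axis i 1)"
      using MVT2[OF h(1)[of n], of "\<lambda>t. u (y + t *\<^sub>R axis i 1)" "\<lambda>t. pd i u (y + t *\<^sub>R axis i 1)"] line
      by blast
    have qeq: "q n y = pd i u (y + t *\<^sub>R axis i 1)"
      using t h(1)[of n] by (simp add: q_def)
    show ?thesis
    proof (cases "y \<in> cball z (R + 1)")
      case True
      then show ?thesis using C qeq by simp
    next
      case False
      have "dist y (y + t *\<^sub>R axis i 1) \<le> 1"
        using t h(2)[of n] by (simp add: dist_norm)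
      then have "y + t *\<^sub>R axis i 1 \<notin> cball z R"
        using False dist_triangle[of z y "y + t *\<^sub>R axis i 1"] by (auto simp: dist_commute)
      then show ?thesis using False pd0 qeq by simp
    qed
  qed
  have lim: "(\<lambda>n. q n y) \<longlonglongrightarrow> pd i u y" for y
  proof -
    have "((\<lambda>s. (u (y + s *\<^sub>R axis i 1) - u (y + 0 *\<^sub>R axis i 1)) / s) \<longlongrightarrow> pd i u (y + 0 *\<^sub>R axis i 1)) (at 0)"
      using line[of y 0] by (simp add: DERIV_def)
    moreover have "filterlim h (at 0) sequentially"
      unfolding h_def using LIMSEQ_inverse_real_of_nat
      by (auto simp: filterlim_at inverse_eq_divide)
    ultimately show ?thesis
      using filterlim_compose[of "\<lambda>s. (u (y + s *\<^sub>R axis i 1) - u (y + 0 *\<^sub>R axis i 1)) / s" _ "at 0" h sequentially]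
      by (simp add: q_def)
  qed
  have [measurable]: "u \<in> borel_measurable borel" "pd i u \<in> borel_measurable borel"
    using contu cont by (auto intro: borel_measurable_continuous_onI)
  have "(LINT y|lborel. q n y) = 0" for n
  proof -
    have "integrable lborel (\<lambda>y. u (y + h n *\<^sub>R axis i 1))"
    proof (rule integrable_continuous_compact_support[of _ z "R + 1"])
      show "continuous_on UNIV (\<lambda>y. u (y + h n *\<^sub>R axis i 1))"
        by (intro continuous_on_compose2[OF contu] continuous_intros) auto
      show "u (y + h n *\<^sub>R axis i 1) = 0" if "y \<notin> cball z (R + 1)" for y
      proof (rule supp)
        have "dist y (y + h n *\<^sub>R axis i 1) \<le> 1"
          using h[of n] by (simp add: dist_norm)
        then show "y + h n *\<^sub>R axis i 1 \<notin> cball z R"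
          using that dist_triangle[of z y "y + h n *\<^sub>R axis i 1"] by (auto simp: dist_commute)
      qed
    qed
    then show ?thesis
      using intu lborel_integral_translation[of u "h n *\<^sub>R axis i 1"] by (simp add: q_def)
  qed
  moreover have "(\<lambda>n. LINT y|lborel. q n y) \<longlonglongrightarrow> (LINT y|lborel. pd i u y)"
  proof (rule integral_dominated_convergence[where w = "\<lambda>y. C * indicator (cball z (R + 1)) y"])
    show "integrable lborel (\<lambda>y. C * indicator (cball z (R + 1)) y)"
      by (intro integrable_mult_right integrable_real_indicator) (use emeasure_bounded_finite[of "cball z (R + 1)"] in auto)
    show "q n \<in> borel_measurable lborel" for n
      unfolding q_def by simp
  qed (use lim bound in auto)
  ultimately show "(LINT y|lborel. pd i u y) = 0"
    by (simp add: LIMSEQ_const_iff)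
qed

section \<open>A smooth bump function on the line\<close>

definition bump :: "real \<Rightarrow> real" where
  "bump t = (if t > 0 then exp (- (1 / t)) else 0)"

text \<open>For t > 0 the n-th derivative of \<open>bump\<close> is P(1/t) exp(-1/t) with a
  polynomial P. Differentiating once more replaces P(x) by \<open>x ^ 2\<close> times P(x) - P'(x),
  which is the recursion.\<close>

fun bump_poly :: "nat \<Rightarrow> real poly" where
  "bump_poly 0 = 1"
| "bump_poly (Suc n) = [:0, 0, 1:] * (bump_poly n - pderiv (bump_poly n))"

definition bump_deriv :: "nat \<Rightarrow> real \<Rightarrow> real" where
  "bump_deriv n t = (if t > 0 then poly (bump_poly n) (1 / t) * exp (- (1 / t)) else 0)"

lemma tendsto_poly_times_exp_minus: "((\<lambda>x. poly p x * exp (- x)) \<longlongrightarrow> (0 :: real)) at_top"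
proof -
  have "((\<lambda>x. \<Sum>k\<le>degree p. coeff p k * (x ^ k / exp x)) \<longlongrightarrow> (\<Sum>k\<le>degree p. coeff p k * 0)) at_top"
    by (intro tendsto_sum tendsto_mult tendsto_const tendsto_power_div_exp_0)
  then show ?thesis
    by (simp add: poly_altdef sum_distrib_right exp_minus divide_inverse mult.assoc)
qed

text \<open>Only t = 0 needs an argument: the exponential beats every power of 1/t, so all one-sided
  difference quotients tend to 0.\<close>

lemma bump_deriv_Suc: "(bump_deriv n has_real_derivative bump_deriv (Suc n) t) (at t)"
proof -
  consider "t > 0" | "t < 0" | "t = 0" by linarith
  then show ?thesis
  proof cases
    case 1
    have "((\<lambda>t. poly (bump_poly n) (1 / t) * exp (- (1 / t))) has_real_derivative bump_deriv (Suc n) t) (at t)"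
      using 1 by (auto intro!: derivative_eq_intros DERIV_chain2[OF poly_DERIV]
          simp: bump_deriv_def field_simps power2_eq_square)
    then show ?thesis
      by (rule has_field_derivative_transform_within_open[of _ _ _ "{0<..}"]) (use 1 in \<open>auto simp: bump_deriv_def\<close>)
  next
    case 2
    have "((\<lambda>t. 0) has_real_derivative bump_deriv (Suc n) t) (at t)"
      using 2 by (simp add: bump_deriv_def)
    then show ?thesis
      by (rule has_field_derivative_transform_within_open[of _ _ _ "{..<0}"]) (use 2 in \<open>auto simp: bump_deriv_def\<close>)
  next
    case 3
    have "((\<lambda>s. bump_deriv n s / s) \<longlongrightarrow> 0) (at_right 0)"
    proof -
      \<comment> \<open>\<open>pCons 0\<close> multiplies the polynomial by its variable, here 1/s,
        which accounts for the division by s in the difference quotient.\<close>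
      have "((\<lambda>s. poly (pCons 0 (bump_poly n)) (inverse s) * exp (- inverse s)) \<longlongrightarrow> (0::real)) (at_right 0)"
        by (rule filterlim_compose[OF tendsto_poly_times_exp_minus filterlim_inverse_at_top_right])
      then show ?thesis
        by (rule tendsto_cong[THEN iffD1, rotated])
           (auto simp: bump_deriv_def eventually_at_filter inverse_eq_divide)
    qed
    moreover have "((\<lambda>s. bump_deriv n s / s) \<longlongrightarrow> 0) (at_left 0)"
      by (rule tendsto_eventually) (auto simp: bump_deriv_def eventually_at_filter)
    ultimately have "((\<lambda>s. bump_deriv n s / s) \<longlongrightarrow> 0) (at 0)"
      by (simp add: filterlim_split_at)
    then show ?thesis
      using 3 by (simp add: has_field_derivative_iff bump_deriv_def)
  qed
qed

lemma bump_deriv_0: "bump_deriv 0 = bump"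
  by (simp add: fun_eq_iff bump_deriv_def bump_def)

lemma Ck_on_bump: "open S \<Longrightarrow> Ck_on k S u \<Longrightarrow> Ck_on k S (\<lambda>y. bump (u y))"
  using Ck_on_compose_real[of S u UNIV k bump_deriv 0] by (simp add: bump_deriv_0 bump_deriv_Suc)

lemma bump_nonneg: "0 \<le> bump t" and bump_le_1: "bump t \<le> 1" and bump_pos_iff: "0 < bump t \<longleftrightarrow> 0 < t"
  and bump_eq_0_iff: "bump t = 0 \<longleftrightarrow> t \<le> 0"
  by (auto simp: bump_def)

lemma bump_mono: "s \<le> t \<Longrightarrow> bump s \<le> bump t"
  by (auto simp: bump_def frac_le)

text \<open>Every derivative of the sine is a shift of the sine by a multiple of
  \<open>pi / 2\<close>, which provides the sequence of derivatives in closed form.\<close>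

lemma Ck_on_sin:
  assumes "open S" "Ck_on k S u"
  shows "Ck_on k S (\<lambda>y. sin (u y))"
proof -
  have "((\<lambda>x. sin (x + real n * pi / 2)) has_real_derivative sin (x + real (Suc n) * pi / 2)) (at x)" for n x
  proof -
    have "sin (x + real (Suc n) * pi / 2) = cos (x + real n * pi / 2)"
      using sin_add[of "x + real n * pi / 2" "pi / 2"] by (simp add: algebra_simps add_divide_distrib)
    then show ?thesis by (auto intro!: derivative_eq_intros)
  qed
  then show ?thesis
    using Ck_on_compose_real[OF assms(1) subset_UNIV assms(2), of "\<lambda>n x. sin (x + real n * pi / 2)" 0] by simp
qed

section \<open>Random projections\<close>

text \<open>The rows of \<open>e\<close> are all sign vectors: averaging over them replaces averaging over a sphere.\<close>

lemma ex_rademacher: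
  "\<exists>n (e :: nat \<Rightarrow> nat \<Rightarrow> real). n > 0 \<and>
     (\<forall>a b. (\<Sum>i<n. (\<Sum>j<N. e i j * a j) * (\<Sum>j<N. e i j * b j)) = real n * (\<Sum>j<N. a j * b j)) \<and>
     (\<forall>a. (\<Sum>i<n. (\<Sum>j<N. e i j * a j) ^ 4) \<le> 3 * real n * (\<Sum>j<N. (a j)\<^sup>2)\<^sup>2)"
proof (induction N)
  case 0
  show ?case by (intro exI[of _ 1]) simp
next
  case (Suc N)
  then obtain n and e :: "nat \<Rightarrow> nat \<Rightarrow> real" where n: "n > 0"
    and e2: "\<And>a b. (\<Sum>i<n. (\<Sum>j<N. e i j * a j) * (\<Sum>j<N. e i j * b j)) = real n * (\<Sum>j<N. a j * b j)"
    and e4: "\<And>a. (\<Sum>i<n. (\<Sum>j<N. e i j * a j) ^ 4) \<le> 3 * real n * (\<Sum>j<N. (a j)\<^sup>2)\<^sup>2"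
    by blast
  \<comment> \<open>Every row is used twice, with last entry 1 and with last entry -1. In the sums
    over rows, the terms odd in that entry cancel.\<close>
  define e' where "e' i = (if i < n then (e i)(N := 1) else (e (i - n))(N := - 1))" for i
  have lin: "(\<Sum>j<Suc N. e' i j * a j) = (\<Sum>j<N. e i j * a j) + a N"
    "(\<Sum>j<Suc N. e' (i + n) j * a j) = (\<Sum>j<N. e i j * a j) - a N" if "i < n" for i a
    using that by (auto simp: e'_def intro!: sum.cong)
  have split: "(\<Sum>i<2*n. h (\<lambda>a. \<Sum>j<Suc N. e' i j * a j)) =
      (\<Sum>i<n. h (\<lambda>a. (\<Sum>j<N. e i j * a j) + a N) + h (\<lambda>a. (\<Sum>j<N. e i j * a j) - a N))"
    for h :: "((nat \<Rightarrow> real) \<Rightarrow> real) \<Rightarrow> real"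
  proof -
    have "(\<Sum>i<2*n. h (\<lambda>a. \<Sum>j<Suc N. e' i j * a j)) =
      (\<Sum>i<n. h (\<lambda>a. \<Sum>j<Suc N. e' i j * a j)) + (\<Sum>i\<in>{n..<2*n}. h (\<lambda>a. \<Sum>j<Suc N. e' i j * a j))"
      by (subst sum.union_disjoint[symmetric]) (auto intro!: sum.cong)
    also have "(\<Sum>i\<in>{n..<2*n}. h (\<lambda>a. \<Sum>j<Suc N. e' i j * a j)) = (\<Sum>i<n. h (\<lambda>a. \<Sum>j<Suc N. e' (i + n) j * a j))"
      using sum.shift_bounds_nat_ivl[of "\<lambda>i. h (\<lambda>a. \<Sum>j<Suc N. e' i j * a j)" 0 n n]
      by (simp add: atLeast0LessThan mult_2)
    finally show ?thesis
      using lin by (simp add: sum.distrib del: sum.lessThan_Suc)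
  qed
  have "(\<Sum>i<2*n. (\<Sum>j<Suc N. e' i j * a j) * (\<Sum>j<Suc N. e' i j * b j)) = real (2*n) * (\<Sum>j<Suc N. a j * b j)" for a b
  proof -
    have "(\<Sum>i<2*n. (\<Sum>j<Suc N. e' i j * a j) * (\<Sum>j<Suc N. e' i j * b j)) =
        (\<Sum>i<n. 2 * ((\<Sum>j<N. e i j * a j) * (\<Sum>j<N. e i j * b j)) + 2 * (a N * b N))"
      by (subst split[of "\<lambda>f. f a * f b"]) (simp add: algebra_simps)
    also have "\<dots> = 2 * (real n * (\<Sum>j<N. a j * b j)) + real n * (2 * (a N * b N))"
      by (simp add: sum.distrib flip: sum_distrib_left e2)
    finally show ?thesis by (simp add: algebra_simps)
  qed
  moreover have "(\<Sum>i<2*n. (\<Sum>j<Suc N. e' i j * a j) ^ 4) \<le> 3 * real (2*n) * (\<Sum>j<Suc N. (a j)\<^sup>2)\<^sup>2" for a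
  proof -
    let ?A = "\<Sum>j<N. (a j)\<^sup>2"
    have "(\<Sum>i<2*n. (\<Sum>j<Suc N. e' i j * a j) ^ 4) =
        (\<Sum>i<n. 2 * (\<Sum>j<N. e i j * a j) ^ 4 + 12 * (a N)\<^sup>2 * ((\<Sum>j<N. e i j * a j) * (\<Sum>j<N. e i j * a j)) + 2 * (a N) ^ 4)"
      by (subst split[of "\<lambda>f. f a ^ 4"]) (simp add: algebra_simps power4_eq_xxxx power2_eq_square)
    also have "\<dots> = 2 * (\<Sum>i<n. (\<Sum>j<N. e i j * a j) ^ 4) + 12 * (a N)\<^sup>2 * (real n * ?A) + real n * (2 * (a N) ^ 4)"
      by (simp only: sum.distrib sum_distrib_left[symmetric] e2 power2_eq_square) simp
    \<comment> \<open>Enlarging the coefficient 2 of \<open>(a N) ^ 4\<close> to 6 completes the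
      square, so the constant 3 is reproduced and does not grow with \<open>N\<close>.\<close>
    also have "\<dots> \<le> 2 * (3 * real n * ?A\<^sup>2) + 12 * (a N)\<^sup>2 * (real n * ?A) + real n * (6 * (a N) ^ 4)"
      using e4[of a] by (intro add_mono mult_left_mono) auto
    also have "\<dots> = 3 * real (2*n) * (\<Sum>j<Suc N. (a j)\<^sup>2)\<^sup>2"
      by (simp add: power2_sum power4_eq_xxxx) (simp add: algebra_simps power2_eq_square)
    finally show ?thesis .
  qed
  ultimately show ?case
    using n by (intro exI[of _ "2*n"] exI[of _ e'] conjI) auto
qed

section \<open>Moments of determinants with randomly chosen rows\<close>

definition choices :: "nat \<Rightarrow> ('m::finite \<Rightarrow> nat) set" where
  "choices n = (UNIV :: 'm set) \<rightarrow>\<^sub>E {..<n}"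

text \<open>Independence: \<open>choices n\<close> is the sample space of one uniformly chosen row
  index for each of the coordinates, and the expectation of a product over the coordinates
  factorises. Sums are used without normalisation, so probabilities appear multiplied by
  \<open>n ^ CARD('m)\<close>.\<close>

lemma sum_choices_prod:
  "(\<Sum>g\<in>choices n. \<Prod>a\<in>UNIV. h a (g a)) = (\<Prod>a\<in>(UNIV :: 'm::finite set). \<Sum>i<n. h a i :: real)"
  unfolding choices_def by (rule prod_sum_PiE[symmetric]) auto

lemma sum_choices_single:
  fixes a :: "'m::finite"
  assumes "(\<Sum>i<n. h i) = real n * s"
  shows "(\<Sum>g\<in>choices n. h (g a)) = real n ^ CARD('m) * s"
proof -
  have "(\<Sum>g\<in>choices n. h (g a)) = (\<Sum>g\<in>choices n. \<Prod>b\<in>UNIV. if b = a then h (g b) else 1)"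
    by simp
  also have "\<dots> = (\<Prod>b\<in>UNIV. \<Sum>i<n. if b = a then h i else 1)"
    by (rule sum_choices_prod)
  also have "\<dots> = (\<Prod>b\<in>(UNIV :: 'm set). real n * (if b = a then s else 1))"
    by (intro prod.cong refl) (simp add: assms)
  also have "\<dots> = real n ^ CARD('m) * s"
    by (simp add: prod.distrib)
  finally show ?thesis .
qed

text \<open>The Leibniz sum runs over permutations; summing absolute values over all maps instead
  gives the expanded product of the row sums.\<close>

lemma abs_det_le: "\<bar>det A\<bar> \<le> (\<Prod>a\<in>UNIV. \<Sum>b\<in>UNIV. \<bar>(A :: real^'m::finite^'m) $ a $ b\<bar>)"
proof -
  have "\<bar>det A\<bar> \<le> (\<Sum>p | p permutes (UNIV :: 'm set). \<bar>of_int (sign p) * (\<Prod>a\<in>UNIV. A $ a $ p a)\<bar>)"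
    unfolding det_def by (rule sum_abs)
  also have "\<dots> = (\<Sum>p | p permutes (UNIV :: 'm set). \<Prod>a\<in>UNIV. \<bar>A $ a $ p a\<bar>)"
    by (simp add: abs_mult abs_prod flip: of_int_abs)
  also have "\<dots> \<le> (\<Sum>p\<in>UNIV. \<Prod>a\<in>UNIV. \<bar>A $ a $ p a\<bar>)"
    by (intro sum_mono2) (auto intro: prod_nonneg)
  also have "\<dots> = (\<Prod>a\<in>UNIV. \<Sum>b\<in>UNIV. \<bar>A $ a $ b\<bar>)"
    by (subst prod_sum_PiE) (auto simp: PiE_UNIV_domain)
  finally show ?thesis .
qed

text \<open>The Cauchy-Schwarz inequality twice, each time against the constant function 1.\<close>

lemma power4_sum_le:
  fixes h :: "'m::finite \<Rightarrow> real"
  shows "(\<Sum>b\<in>UNIV. \<bar>h b\<bar>) ^ 4 \<le> real CARD('m) ^ 3 * (\<Sum>b\<in>UNIV. h b ^ 4)"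
proof -
  have "(\<Sum>b\<in>UNIV. \<bar>h b\<bar>) ^ 4 = ((\<Sum>b\<in>UNIV. \<bar>h b\<bar> * 1)\<^sup>2)\<^sup>2"
    by simp
  also have "\<dots> \<le> ((\<Sum>b\<in>UNIV. \<bar>h b\<bar>\<^sup>2) * (\<Sum>b\<in>(UNIV :: 'm set). 1\<^sup>2))\<^sup>2"
    by (intro power_mono Cauchy_Schwarz_ineq_sum) auto
  also have "\<dots> = real CARD('m) ^ 2 * (\<Sum>b\<in>UNIV. (h b)\<^sup>2 * 1)\<^sup>2"
    by (simp add: power_mult_distrib)
  also have "\<dots> \<le> real CARD('m) ^ 2 * ((\<Sum>b\<in>UNIV. ((h b)\<^sup>2)\<^sup>2) * (\<Sum>b\<in>(UNIV :: 'm set). 1\<^sup>2))"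
    by (intro mult_left_mono Cauchy_Schwarz_ineq_sum) auto
  also have "\<dots> = real CARD('m) ^ 3 * (\<Sum>b\<in>UNIV. h b ^ 4)"
    by (simp add: power2_eq_square power3_eq_cube power4_eq_xxxx mult.assoc)
  finally show ?thesis .
qed

context
  fixes n :: nat and r :: "nat \<Rightarrow> real^'m::finite"
  assumes iso: "\<And>b c. (\<Sum>i<n. r i $ b * r i $ c) = (if b = c then real n else 0)"
    and fourth: "\<And>b. (\<Sum>i<n. (r i $ b) ^ 4) \<le> 3 * real n"
begin

text \<open>In the application, the vectors \<open>r i\<close> are the sign vectors read in an
  orthonormal frame of a tangent space. Expanding both determinants over permutations p and q,
  isotropy kills all terms with p different from q, and one term \<open>n ^ CARD('m)\<close> remains
  for each permutation.\<close>

lemma sum_det_square: "(\<Sum>g\<in>choices n. (det (\<chi> a. r (g a)))\<^sup>2) = real n ^ CARD('m) * fact CARD('m)"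
proof -
  let ?P = "{p. p permutes (UNIV :: 'm set)}"
  have "(\<Sum>g\<in>choices n. (det (\<chi> a. r (g a)))\<^sup>2) = (\<Sum>g\<in>choices n. \<Sum>p\<in>?P. \<Sum>q\<in>?P.
      of_int (sign p) * of_int (sign q) * (\<Prod>a\<in>UNIV. r (g a) $ p a * r (g a) $ q a))"
    by (simp add: det_def power2_eq_square sum_product prod.distrib mult_ac)
  also have "\<dots> = (\<Sum>p\<in>?P. \<Sum>q\<in>?P. of_int (sign p) * of_int (sign q) *
      (\<Sum>g\<in>choices n. \<Prod>a\<in>UNIV. r (g a) $ p a * r (g a) $ q a))"
    by (subst sum.swap, rule sum.cong[OF refl], subst sum.swap) (simp add: sum_distrib_left)
  also have "\<dots> = (\<Sum>p\<in>?P. \<Sum>q\<in>?P. if p = q then real n ^ CARD('m) else 0)"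
  proof (intro sum.cong refl)
    fix p q :: "'m \<Rightarrow> 'm"
    have "(\<Sum>g\<in>choices n. \<Prod>a\<in>UNIV. r (g a) $ p a * r (g a) $ q a) = (\<Prod>a\<in>UNIV. if p a = q a then real n else 0)"
      by (subst sum_choices_prod) (simp add: iso)
    also have "\<dots> = (if p = q then real n ^ CARD('m) else 0)"
    proof (cases "p = q")
      case False
      then obtain a where "p a \<noteq> q a" by auto
      then show ?thesis using False by (auto intro!: prod_zero bexI[of _ a])
    qed simp
    finally show "of_int (sign p) * of_int (sign q) * (\<Sum>g\<in>choices n. \<Prod>a\<in>UNIV. r (g a) $ p a * r (g a) $ q a)
        = (if p = q then real n ^ CARD('m) else 0)"
      by (simp flip: of_int_mult)
  qed
  also have "\<dots> = real (card ?P) * real n ^ CARD('m)"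
    by simp
  finally show ?thesis
    by (simp add: card_permutations)
qed

text \<open>The bound by a product over the rows is crude, but it makes independence applicable and
  leaves a constant that depends on the dimension of the manifold only.\<close>

lemma sum_det_power4:
  "(\<Sum>g\<in>choices n. (det (\<chi> a. r (g a))) ^ 4) \<le> real n ^ CARD('m) * (3 * real CARD('m) ^ 4) ^ CARD('m)"
proof -
  let ?M = "real CARD('m)"
  have "(det (\<chi> a. r (g a))) ^ 4 \<le> (\<Prod>a\<in>UNIV. ?M ^ 3 * (\<Sum>b\<in>UNIV. (r (g a) $ b) ^ 4))" for g :: "'m \<Rightarrow> nat"
  proof -
    have "(det (\<chi> a. r (g a))) ^ 4 = \<bar>det (\<chi> a. r (g a))\<bar> ^ 4"
      by simp
    also have "\<dots> \<le> (\<Prod>a\<in>UNIV. \<Sum>b\<in>UNIV. \<bar>r (g a) $ b\<bar>) ^ 4"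
      using abs_det_le[of "\<chi> a. r (g a)"] by (intro power_mono) auto
    also have "\<dots> = (\<Prod>a\<in>UNIV. (\<Sum>b\<in>UNIV. \<bar>r (g a) $ b\<bar>) ^ 4)"
      by (simp add: prod_power_distrib)
    also have "\<dots> \<le> (\<Prod>a\<in>UNIV. ?M ^ 3 * (\<Sum>b\<in>UNIV. (r (g a) $ b) ^ 4))"
      by (intro prod_mono conjI power4_sum_le) auto
    finally show ?thesis .
  qed
  then have "(\<Sum>g\<in>choices n. (det (\<chi> a. r (g a))) ^ 4) \<le>
      (\<Sum>g\<in>choices n. \<Prod>a\<in>(UNIV :: 'm set). ?M ^ 3 * (\<Sum>b\<in>UNIV. (r (g a) $ b) ^ 4))"
    by (rule sum_mono)
  also have "\<dots> = (\<Prod>a\<in>(UNIV :: 'm set). \<Sum>i<n. ?M ^ 3 * (\<Sum>b\<in>UNIV. (r i $ b) ^ 4))"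
    by (rule sum_choices_prod)
  also have "\<dots> \<le> (\<Prod>a\<in>(UNIV :: 'm set). real n * (3 * ?M ^ 4))"
  proof (intro prod_mono conjI)
    have "(\<Sum>i<n. ?M ^ 3 * (\<Sum>b\<in>UNIV. (r i $ b) ^ 4)) = ?M ^ 3 * (\<Sum>b\<in>UNIV. \<Sum>i<n. (r i $ b) ^ 4)"
      by (simp add: sum_distrib_left) (rule sum.swap)
    also have "\<dots> \<le> ?M ^ 3 * (\<Sum>b\<in>(UNIV :: 'm set). 3 * real n)"
      by (intro mult_left_mono sum_mono fourth) auto
    finally show "(\<Sum>i<n. ?M ^ 3 * (\<Sum>b\<in>UNIV. (r i $ b) ^ 4)) \<le> real n * (3 * ?M ^ 4)"
      by (simp add: power3_eq_cube power4_eq_xxxx mult_ac)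
  qed (auto intro!: sum_nonneg mult_nonneg_nonneg)
  also have "\<dots> = real n ^ CARD('m) * (3 * ?M ^ 4) ^ CARD('m)"
    by (simp add: power_mult_distrib)
  finally show ?thesis .
qed

end

text \<open>This is the parameter t of the truncation, chosen so that \<open>t ^ 2\<close> times the
  fourth moment constant \<open>(3 * real CARD('m) ^ 4) ^ CARD('m)\<close> equals 1/2.\<close>

definition proj_const :: "'m::finite itself \<Rightarrow> real" where
  "proj_const _ = 1 / sqrt (2 * (3 * real CARD('m) ^ 4) ^ CARD('m))"

lemma proj_const_pos: "proj_const TYPE('m::finite) > 0"
  by (simp add: proj_const_def)

text \<open>Since \<open>\<bar>d\<bar> \<ge> t d\<^sup>2 - t\<^sup>3 d\<^sup>4\<close>, second and fourth moments bound a first moment from below; the last term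
  pays for the truncation, as in Chebyshev's inequality.\<close>

lemma truncated_abs_ge:
  fixes d w t R :: real
  assumes "t > 0" "R > 0" "w \<ge> 0"
  shows "t * d\<^sup>2 - t ^ 3 * d ^ 4 - w / (4 * t * R\<^sup>2) \<le> (if w \<le> R\<^sup>2 then \<bar>d\<bar> else 0)"
proof (cases "w \<le> R\<^sup>2")
  case True
  have "t * d\<^sup>2 - t ^ 3 * d ^ 4 \<le> \<bar>d\<bar>"
  proof (cases "t * \<bar>d\<bar> \<le> 1")
    case True
    have "t * d\<^sup>2 = (t * \<bar>d\<bar>) * \<bar>d\<bar>"
      by (simp add: power2_eq_square flip: abs_mult)
    also have "\<dots> \<le> 1 * \<bar>d\<bar>"
      using True by (intro mult_right_mono) auto
    finally show ?thesis
      using assms(1) by (smt (verit) mult_nonneg_nonneg zero_le_even_power' zero_le_power even_numeral zero_le_power_eq)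
  next
    case False
    have "t * d\<^sup>2 - t ^ 3 * d ^ 4 = t * d\<^sup>2 * (1 - (t * \<bar>d\<bar>)\<^sup>2)"
      by (simp add: power_mult_distrib algebra_simps power2_eq_square power3_eq_cube power4_eq_xxxx)
    also have "\<dots> \<le> 0"
      using False assms(1) by (intro mult_nonneg_nonpos) (auto simp: one_le_power)
    finally show ?thesis by simp
  qed
  moreover have "0 \<le> w / (4 * t * R\<^sup>2)"
    using assms by simp
  ultimately show ?thesis using True by simp
next
  case False
  \<comment> \<open>Completing the square: the left side never exceeds \<open>1 / (4 * t)\<close>,
    which the subtracted term outweighs once \<open>w\<close> exceeds the square of
    \<open>R\<close>.\<close>
  have "t * d\<^sup>2 - t ^ 3 * d ^ 4 = 1 / (4 * t) - t * (t * d\<^sup>2 - 1 / (2 * t))\<^sup>2"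
    using assms(1) by (simp add: field_simps power2_eq_square power3_eq_cube power4_eq_xxxx)
  also have "\<dots> \<le> 1 / (4 * t)"
    using assms(1) by simp
  also have "\<dots> \<le> w / (4 * t * R\<^sup>2)"
    using False assms by (simp add: field_simps)
  finally show ?thesis using False by simp
qed

text \<open>The pointwise bound is summed over all choices. Per choice, the second moment gives at
  least t, the fourth moment takes at most t/2 by the choice of \<open>proj_const\<close>, and the
  truncation at most t/4 by the hypothesis on \<open>R\<close>; t/4 is left.\<close>

lemma sum_truncated_det_ge:
  fixes r :: "nat \<Rightarrow> real^'m::finite" and y :: "nat \<Rightarrow> real"
  assumes iso: "\<And>b c. (\<Sum>i<n. r i $ b * r i $ c) = (if b = c then real n else 0)"
    and fourth: "\<And>b. (\<Sum>i<n. (r i $ b) ^ 4) \<le> 3 * real n"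
    and y: "(\<Sum>i<n. (y i)\<^sup>2) = real n * s"
    and R: "R > 0" "real CARD('m) * s \<le> (proj_const TYPE('m))\<^sup>2 * R\<^sup>2"
  shows "real n ^ CARD('m) * (proj_const TYPE('m) / 4) \<le>
    (\<Sum>g\<in>choices n. if (\<Sum>a\<in>(UNIV :: 'm set). (y (g a))\<^sup>2) \<le> R\<^sup>2 then \<bar>det (\<chi> a. r (g a))\<bar> else 0)"
proof -
  define t where "t = proj_const TYPE('m)"
  let ?n = "real n ^ CARD('m)" and ?C = "(3 * real CARD('m) ^ 4) ^ CARD('m)"
  have t: "t > 0" by (simp add: t_def proj_const_pos)
  have "?C > 0" by simp
  then have t2: "t\<^sup>2 * ?C = 1 / 2"
    by (simp add: t_def proj_const_def power_divide)
  have "?n * (t / 4) = t * ?n - ?n * (t * (t\<^sup>2 * ?C)) - ?n * (t / 4)"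
    by (simp only: t2) (simp add: field_simps)
  also have "\<dots> \<le> t * (?n * fact CARD('m)) - t ^ 3 * (?n * ?C) - ?n * (real CARD('m) * s) / (4 * t * R\<^sup>2)"
  proof -
    have "t * ?n \<le> t * (?n * fact CARD('m))"
      using t by (intro mult_left_mono mult_le_cancel_left1[THEN iffD2]) (auto simp: fact_ge_1)
    moreover have "?n * (t * (t\<^sup>2 * ?C)) = t ^ 3 * (?n * ?C)"
      by (simp add: power2_eq_square power3_eq_cube)
    moreover have "?n * (real CARD('m) * s) / (4 * t * R\<^sup>2) \<le> ?n * (t\<^sup>2 * R\<^sup>2) / (4 * t * R\<^sup>2)"
      using R t by (intro divide_right_mono mult_left_mono) (auto simp: t_def)
    moreover have "?n * (t\<^sup>2 * R\<^sup>2) / (4 * t * R\<^sup>2) = ?n * (t / 4)"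
      using t R by (simp add: field_simps power2_eq_square)
    ultimately show ?thesis by linarith
  qed
  also have "\<dots> \<le> t * (\<Sum>g\<in>choices n. (det (\<chi> a. r (g a)))\<^sup>2) - t ^ 3 * (\<Sum>g\<in>choices n. (det (\<chi> a. r (g a))) ^ 4)
      - (\<Sum>g\<in>choices n. \<Sum>a\<in>(UNIV :: 'm set). (y (g a))\<^sup>2) / (4 * t * R\<^sup>2)"
  proof -
    have "(\<Sum>g\<in>choices n. \<Sum>a\<in>(UNIV :: 'm set). (y (g a))\<^sup>2) = ?n * (real CARD('m) * s)"
      by (subst sum.swap) (simp add: sum_choices_single[OF y])
    moreover have "t ^ 3 * (\<Sum>g\<in>choices n. (det (\<chi> a. r (g a))) ^ 4) \<le> t ^ 3 * (?n * ?C)"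
      using t sum_det_power4[OF iso fourth] by (intro mult_left_mono) auto
    ultimately show ?thesis
      using sum_det_square[OF iso fourth] by simp
  qed
  also have "\<dots> = (\<Sum>g\<in>choices n. t * (det (\<chi> a. r (g a)))\<^sup>2 - t ^ 3 * (det (\<chi> a. r (g a))) ^ 4
      - (\<Sum>a\<in>(UNIV :: 'm set). (y (g a))\<^sup>2) / (4 * t * R\<^sup>2))"
    by (simp only: sum_subtractf sum_distrib_left sum_divide_distrib)
  also have "\<dots> \<le> (\<Sum>g\<in>choices n. if (\<Sum>a\<in>(UNIV :: 'm set). (y (g a))\<^sup>2) \<le> R\<^sup>2 then \<bar>det (\<chi> a. r (g a))\<bar> else 0)"
    by (intro sum_mono truncated_abs_ge t R sum_nonneg) auto
  finally show ?thesis
    by (simp add: t_def)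
qed

section \<open>Affine planes as level sets\<close>

abbreviation E :: "nat \<Rightarrow> (nat \<Rightarrow> real) set" where
  "E N \<equiv> topspace (Euclidean_space N)"

lemma in_E_iff: "x \<in> E N \<longleftrightarrow> (\<forall>j\<ge>N. x j = 0)"
  by (simp add: topspace_Euclidean_space)

text \<open>The linear counterpart of \<open>affine_plane\<close>, with the same encoding: vectors
  are sequences, and coefficients are functions on \<open>nat\<close> of which only the values below
  \<open>p\<close> matter.\<close>

definition has_basis :: "nat \<Rightarrow> (nat \<Rightarrow> nat \<Rightarrow> real) \<Rightarrow> (nat \<Rightarrow> real) set \<Rightarrow> bool" where
  "has_basis p b V \<longleftrightarrow>
     (\<forall>t :: nat \<Rightarrow> real. (\<forall>j. (\<Sum>k<p. t k * b k j) = 0) \<longrightarrow> (\<forall>k<p. t k = 0)) \<and>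
     V = {x. \<exists>t :: nat \<Rightarrow> real. x = (\<lambda>j. \<Sum>k<p. t k * b k j)}"

lemma has_basis_indep:
  assumes "has_basis p b V" "\<And>j. (\<Sum>k<p. t k * b k j) = 0" "k < p"
  shows "t k = 0"
  using assms(1)[unfolded has_basis_def, THEN conjunct1, THEN spec, of t] assms(2,3) by simp

lemma has_basis_combination:
  assumes "has_basis p b V"
  shows "(\<lambda>j. \<Sum>k<p. t k * b k j) \<in> V"
  using assms unfolding has_basis_def by (auto intro: exI[of _ t])

lemma has_basisE:
  assumes "has_basis p b V" "x \<in> V"
  obtains t where "x = (\<lambda>j. \<Sum>k<p. t k * b k j)"
  using assms unfolding has_basis_def by auto

lemma has_basisI:
  assumes "\<And>t k. (\<And>j. (\<Sum>k<p. t k * b k j) = 0) \<Longrightarrow> k < p \<Longrightarrow> t k = 0"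
    and "\<And>t. (\<lambda>j. \<Sum>k<p. t k * b k j) \<in> V"
    and "\<And>x. x \<in> V \<Longrightarrow> \<exists>t. \<forall>j. x j = (\<Sum>k<p. t k * b k j)"
  shows "has_basis p b V"
proof -
  have "x \<in> V \<longleftrightarrow> (\<exists>t. x = (\<lambda>j. \<Sum>k<p. t k * b k j))" for x
    using assms(2) assms(3)[of x] by (auto simp: fun_eq_iff[symmetric])
  then show ?thesis
    unfolding has_basis_def using assms(1) by auto
qed

lemma has_basis_Euclidean: "has_basis N (\<lambda>k j. if j = k then 1 else 0) (E N)"
proof -
  have sum: "(\<Sum>k<N. t k * (if j = k then 1 else 0)) = (if j < N then t j else 0)" for t :: "nat \<Rightarrow> real" and j
    by (simp add: if_distrib[of "\<lambda>x. _ * x"] sum.delta cong: if_cong)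
  show ?thesis
    unfolding has_basis_def sum by (auto simp: in_E_iff fun_eq_iff intro: exI)
qed

text \<open>Allows a chosen basis vector to be moved to the last place, where it can be
  eliminated.\<close>

lemma has_basis_permute:
  assumes b: "has_basis p b V" and \<pi>: "\<pi> permutes {..<p}"
  shows "has_basis p (b \<circ> \<pi>) V"
proof -
  have \<pi>': "inv \<pi> permutes {..<p}"
    using \<pi> by (rule permutes_inv)
  have sum: "(\<Sum>k<p. t k * b (\<pi> k) j) = (\<Sum>k<p. t (inv \<pi> k) * b k j)" for t :: "nat \<Rightarrow> real" and j
    using sum.permute[OF \<pi>, of "\<lambda>k. t (inv \<pi> k) * b k j"]
    by (simp add: o_def permutes_inverses[OF \<pi>])
  show ?thesis
  proof (rule has_basisI)
    fix t k assume t: "\<And>j. (\<Sum>k<p. t k * (b \<circ> \<pi>) k j) = 0" and k: "k < p"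
    have "\<pi> k < p"
      using permutes_in_image[OF \<pi>, of k] k by simp
    then have "t (inv \<pi> (\<pi> k)) = 0"
      by (rule has_basis_indep[OF b, of "\<lambda>k. t (inv \<pi> k)", rotated]) (use t in \<open>simp add: sum\<close>)
    then show "t k = 0"
      by (simp add: permutes_inverses[OF \<pi>])
  next
    fix t show "(\<lambda>j. \<Sum>k<p. t k * (b \<circ> \<pi>) k j) \<in> V"
      using has_basis_combination[OF b, of "\<lambda>k. t (inv \<pi> k)"] by (simp add: sum)
  next
    fix x assume "x \<in> V"
    then obtain t where t: "x = (\<lambda>j. \<Sum>k<p. t k * b k j)"
      by (rule has_basisE[OF b])
    have "x j = (\<Sum>k<p. (t \<circ> \<pi>) k * (b \<circ> \<pi>) k j)" for j
      using sum[of "t \<circ> \<pi>" j] by (simp add: t permutes_inverses[OF \<pi>])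
    then show "\<exists>t. \<forall>j. x j = (\<Sum>k<p. t k * (b \<circ> \<pi>) k j)" by blast
  qed
qed

text \<open>One elimination step: a basis vector on which \<open>\<phi>\<close> does not vanish goes
  to the last place, and a multiple of it is subtracted from each of the others so that they fall
  into the kernel.\<close>

lemma has_basis_kernel:
  assumes b: "has_basis (Suc p) b V"
    and lin: "\<And>t. \<phi> (\<lambda>j. \<Sum>k<Suc p. t k * b k j) = (\<Sum>k<Suc p. t k * \<phi> (b k))"
    and ne: "\<exists>v\<in>V. \<phi> v \<noteq> (0 :: real)"
  shows "\<exists>c. has_basis p c {x \<in> V. \<phi> x = 0}"
proof -
  obtain t where "\<phi> (\<lambda>j. \<Sum>k<Suc p. t k * b k j) \<noteq> 0"
    using ne b unfolding has_basis_def by auto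
  then obtain k0 where k0: "k0 < Suc p" "\<phi> (b k0) \<noteq> 0"
    unfolding lin by (metis (no_types, lifting) lessThan_iff mult_zero_right sum.neutral)
  define \<pi> where "\<pi> = Transposition.transpose k0 p"
  have \<pi>: "\<pi> permutes {..<Suc p}"
    unfolding \<pi>_def using k0 by (intro permutes_swap_id) auto
  define d where "d = b \<circ> \<pi>"
  have d: "has_basis (Suc p) d V"
    unfolding d_def by (rule has_basis_permute[OF b \<pi>])
  have dp: "\<phi> (d p) \<noteq> 0"
    using k0 by (simp add: d_def \<pi>_def)
  have lind: "\<phi> (\<lambda>j. \<Sum>k<Suc p. t k * d k j) = (\<Sum>k<Suc p. t k * \<phi> (d k))" for t
  proof -
    have perm: "(\<Sum>k<Suc p. t k * f (\<pi> k)) = (\<Sum>k<Suc p. t (inv \<pi> k) * f k)" for f :: "nat \<Rightarrow> real"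
      using sum.permute[OF \<pi>, of "\<lambda>k. t (inv \<pi> k) * f k"] by (simp only: o_def permutes_inverses[OF \<pi>])
    have "\<phi> (\<lambda>j. \<Sum>k<Suc p. t k * d k j) = \<phi> (\<lambda>j. \<Sum>k<Suc p. t (inv \<pi> k) * b k j)"
      unfolding d_def o_def by (simp only: perm[of "\<lambda>k. b k _"])
    also have "\<dots> = (\<Sum>k<Suc p. t (inv \<pi> k) * \<phi> (b k))"
      by (rule lin)
    also have "\<dots> = (\<Sum>k<Suc p. t k * \<phi> (d k))"
      unfolding d_def o_def by (rule perm[symmetric])
    finally show ?thesis .
  qed
  define q where "q k = \<phi> (d k) / \<phi> (d p)" for k
  define c where "c k j = d k j - q k * d p j" for k j
  \<comment> \<open>A combination of the corrected vectors \<open>c\<close> is a combination of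
    \<open>d\<close> whose last coefficient is determined by the others. Conversely, the vanishing
    of \<open>\<phi>\<close> forces exactly this last coefficient.\<close>
  define ext where "ext t = (\<lambda>k. if k < p then t k else - (\<Sum>k<p. t k * q k))" for t :: "nat \<Rightarrow> real"
  have sumc: "(\<Sum>k<p. t k * c k j) = (\<Sum>k<Suc p. ext t k * d k j)" for t :: "nat \<Rightarrow> real" and j
    by (simp add: c_def ext_def algebra_simps sum_subtractf sum_distrib_left sum_distrib_right)
  have "has_basis p c {x \<in> V. \<phi> x = 0}"
  proof (rule has_basisI)
    fix t k assume "\<And>j. (\<Sum>k<p. t k * c k j) = 0" and k: "k < p"
    then have "ext t k = 0"
      using has_basis_indep[OF d, of "ext t" k] unfolding sumc by (simp only: less_SucI)
    then show "t k = 0"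
      using k by (simp add: ext_def)
  next
    fix t
    have "\<phi> (\<lambda>j. \<Sum>k<Suc p. ext t k * d k j) = 0"
      unfolding lind using dp by (simp add: ext_def q_def sum_divide_distrib[symmetric])
    then show "(\<lambda>j. \<Sum>k<p. t k * c k j) \<in> {x \<in> V. \<phi> x = 0}"
      using has_basis_combination[OF d, of "ext t"] by (simp only: sumc mem_Collect_eq)
  next
    fix x assume x: "x \<in> {x \<in> V. \<phi> x = 0}"
    then obtain t where t: "x = (\<lambda>j. \<Sum>k<Suc p. t k * d k j)"
      by (auto elim: has_basisE[OF d])
    have "\<phi> x = (\<Sum>k<Suc p. t k * \<phi> (d k))"
      unfolding t by (rule lind)
    then have "(\<Sum>k<p. t k * \<phi> (d k)) + t p * \<phi> (d p) = 0"
      using x by simp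
    then have "t p = - (\<Sum>k<p. t k * q k)"
      using dp by (simp add: q_def sum_divide_distrib[symmetric] field_simps)
    then have "ext t k = t k" if "k < Suc p" for k
      using that by (auto simp: ext_def less_Suc_eq)
    then have "x j = (\<Sum>k<p. t k * c k j)" for j
      unfolding t sumc by (auto intro!: sum.cong)
    then show "\<exists>t. \<forall>j. x j = (\<Sum>k<p. t k * c k j)" by blast
  qed
  then show ?thesis
    by (intro exI[of _ c])
qed

text \<open>The linear forms are imposed one at a time. Joint surjectivity provides a vector killed
  by the forms already imposed but not by the next one, so each form lowers the dimension by exactly
  one.\<close>

lemma affine_plane_level_set:
  fixes \<phi> :: "'m::finite \<Rightarrow> nat \<Rightarrow> real"
  assumes surj: "\<And>w. \<exists>x\<in>E (CARD('m) + p). \<forall>a. (\<Sum>j<CARD('m) + p. \<phi> a j * x j) = w a"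
  shows "affine_plane (CARD('m) + p) p {x \<in> E (CARD('m) + p). \<forall>a. (\<Sum>j<CARD('m) + p. \<phi> a j * x j) = y a}"
proof -
  define N where "N = CARD('m) + p"
  define L where "L a x = (\<Sum>j<N. \<phi> a j * x j)" for a x
  have L_sum: "L a (\<lambda>j. \<Sum>k<n. t k * b k j) = (\<Sum>k<n. t k * L a (b k))" for a n t b
    unfolding L_def by (simp add: sum_distrib_left mult.left_commute) (rule sum.swap)
  have "\<exists>b. has_basis (N - card S) b {x \<in> E N. \<forall>a\<in>S. L a x = 0}" for S :: "'m set"
  proof (induction S rule: finite_induct[OF finite])
    case 1
    then show ?case using has_basis_Euclidean by auto
  next
    case (2 a S)
    then obtain b where b: "has_basis (N - card S) b {x \<in> E N. \<forall>a\<in>S. L a x = 0}" by blast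
    have "card (insert a S) \<le> CARD('m)" by (rule card_mono) auto
    then have eq: "N - card S = Suc (N - card (insert a S))"
      using 2 by (simp add: N_def)
    obtain x where "x \<in> E N" "\<forall>c. L c x = (if c = a then 1 else 0)"
      using surj[of "\<lambda>c. if c = a then 1 else 0"] by (auto simp: L_def N_def)
    then have ex: "\<exists>v\<in>{x \<in> E N. \<forall>a\<in>S. L a x = 0}. L a v \<noteq> 0"
      using 2 by (intro bexI[of _ x]) auto
    obtain c where "has_basis (N - card (insert a S)) c {x \<in> {x \<in> E N. \<forall>a\<in>S. L a x = 0}. L a x = 0}"
      using has_basis_kernel[OF b[unfolded eq] L_sum ex] ..
    moreover have "{x \<in> {x \<in> E N. \<forall>a\<in>S. L a x = 0}. L a x = 0} = {x \<in> E N. \<forall>a\<in>insert a S. L a x = 0}"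
      by auto
    ultimately show ?case by metis
  qed
  from this[of UNIV] obtain b where b: "has_basis p b {x \<in> E N. \<forall>a. L a x = 0}"
    by (auto simp: N_def)
  obtain x0 where x0: "x0 \<in> E N" "\<And>a. L a x0 = y a"
    using surj[of y] by (auto simp: L_def N_def)
  have bE: "b k \<in> E N" if "k < p" for k
  proof -
    have "(\<lambda>j. \<Sum>i<p. (if i = k then 1 else 0) * b i j) = b k"
      using that by (simp add: if_distrib[of "\<lambda>x. x * _"] sum.delta cong: if_cong)
    then show ?thesis
      using has_basis_combination[OF b, of "\<lambda>i. if i = k then 1 else 0"] by simp
  qed
  have "x \<in> E N \<and> (\<forall>a. L a x = y a) \<longleftrightarrow> (\<exists>t. x = (\<lambda>j. x0 j + (\<Sum>k<p. t k * b k j)))" for x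
  proof -
    have "x \<in> E N \<and> (\<forall>a. L a x = y a) \<longleftrightarrow> (\<lambda>j. x j - x0 j) \<in> {x \<in> E N. \<forall>a. L a x = 0}"
      using x0 by (auto simp: in_E_iff L_def right_diff_distrib sum_subtractf)
    also have "\<dots> \<longleftrightarrow> (\<exists>t. (\<lambda>j. x j - x0 j) = (\<lambda>j. \<Sum>k<p. t k * b k j))"
      using b by (simp add: has_basis_def)
    also have "\<dots> \<longleftrightarrow> (\<exists>t. x = (\<lambda>j. x0 j + (\<Sum>k<p. t k * b k j)))"
      by (auto simp: fun_eq_iff algebra_simps)
    finally show ?thesis .
  qed
  then have "{x \<in> E N. \<forall>a. L a x = y a} = {x. \<exists>t. x = (\<lambda>j. x0 j + (\<Sum>k<p. t k * b k j))}"
    by blast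
  then have "affine_plane N p {x \<in> E N. \<forall>a. L a x = y a}"
    unfolding affine_plane_def using x0(1) bE has_basis_indep[OF b]
    by (intro exI[of _ x0] exI[of _ b]) simp
  then show ?thesis
    by (simp add: N_def L_def)
qed

section \<open>Charts and the Riemannian volume\<close>

text \<open>The formula for images of sets says that two Borel measures coincide; integrating
  \<open>h\<close> against both gives the formula for functions.\<close>

lemma nn_integral_inj_image:
  fixes f :: "real^'m::finite \<Rightarrow> real^'m" and h :: "real^'m \<Rightarrow> ennreal"
  assumes U: "open U" and inj: "inj_on f U"
    and der: "\<And>x. x \<in> U \<Longrightarrow> (f has_derivative f' x) (at x)"
    and cont: "continuous_on U (\<lambda>x. det (matrix (f' x)))"
    and h [measurable]: "h \<in> borel_measurable borel"
  shows "(\<integral>\<^sup>+y. indicator (f ` U) y * h y \<partial>lborel) =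
    (\<integral>\<^sup>+x. indicator U x * ennreal \<bar>det (matrix (f' x))\<bar> * h (f x) \<partial>lborel)"
proof -
  have contf: "continuous_on U f"
    using has_derivative_continuous[OF der] by (simp add: continuous_at_imp_continuous_on)
  have Ub [measurable]: "U \<in> sets borel" using U by simp
  have fU [measurable]: "f ` U \<in> sets borel"
    using invariance_of_domain[OF contf U inj] by simp
  \<comment> \<open>Extension by zero makes \<open>f\<close> Borel on the whole space. The new
    values are harmless, because the density \<open>d\<close> vanishes outside
    \<open>U\<close>.\<close>
  define F where "F x = indicator U x *\<^sub>R f x" for x
  have F [measurable]: "F \<in> borel_measurable borel"
    unfolding F_def by (rule borel_measurable_continuous_on_indicator[OF Ub contf])
  define d where "d x = indicator U x *\<^sub>R \<bar>det (matrix (f' x))\<bar>" for x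
  have d [measurable]: "d \<in> borel_measurable borel"
    unfolding d_def by (intro borel_measurable_continuous_on_indicator Ub continuous_intros cont)
  have eq: "density lborel (indicator (f ` U)) = distr (density lborel (\<lambda>x. ennreal (d x))) borel F"
  proof (rule measure_eqI)
    fix B assume "B \<in> sets (density lborel (indicator (f ` U)))"
    then have B [measurable]: "B \<in> sets borel" by simp
    define W where "W = U \<inter> F -` B"
    have W [measurable]: "W \<in> sets borel"
      unfolding W_def using measurable_sets[OF F B] by (auto intro: sets.Int Ub)
    have fW: "f ` W = f ` U \<inter> B"
      by (auto simp: W_def F_def)
    have "emeasure (density lborel (indicator (f ` U))) B = emeasure lborel (f ` W)"
      by (simp add: emeasure_density fW flip: indicator_inter_arith)
    also have "\<dots> = (\<integral>\<^sup>+x. ennreal (indicator W x * \<bar>det (matrix (f' x))\<bar>) \<partial>lborel)"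
    proof (rule emeasure_inj_image)
      show "inj_on f W" using inj by (rule inj_on_subset) (auto simp: W_def)
      show "(\<lambda>x. indicator W x * \<bar>det (matrix (f' x))\<bar>) \<in> borel_measurable borel"
      proof -
        have "(\<lambda>x. indicator W x * \<bar>det (matrix (f' x))\<bar>) = (\<lambda>x. indicator W x * d x)"
          by (auto simp: d_def W_def indicator_def)
        then show ?thesis by simp
      qed
      show "f ` W \<in> sets borel" unfolding fW by simp
    qed (auto simp: W_def der intro: W[unfolded W_def])
    also have "\<dots> = (\<integral>\<^sup>+x. ennreal (d x) * indicator (F -` B) x \<partial>lborel)"
      by (intro nn_integral_cong) (auto simp: d_def W_def indicator_def)
    also have "\<dots> = emeasure (distr (density lborel (\<lambda>x. ennreal (d x))) borel F) B"
      using measurable_sets[OF F B] by (simp add: emeasure_distr emeasure_density)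
    finally show "emeasure (density lborel (indicator (f ` U))) B =
        emeasure (distr (density lborel (\<lambda>x. ennreal (d x))) borel F) B" .
  qed simp
  have "(\<integral>\<^sup>+y. indicator (f ` U) y * h y \<partial>lborel) = integral\<^sup>N (density lborel (indicator (f ` U))) h"
    by (simp add: nn_integral_density)
  also have "\<dots> = (\<integral>\<^sup>+x. ennreal (d x) * h (F x) \<partial>lborel)"
    by (simp add: eq nn_integral_distr nn_integral_density)
  also have "\<dots> = (\<integral>\<^sup>+x. indicator U x * ennreal \<bar>det (matrix (f' x))\<bar> * h (f x) \<partial>lborel)"
    by (intro nn_integral_cong) (auto simp: d_def F_def indicator_def)
  finally show ?thesis .
qed

definition jac :: "('a, 'm::finite) chart \<Rightarrow> ('a, 'm) chart \<Rightarrow> real^'m \<Rightarrow> real^'m^'m" where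
  "jac c d y = matrix (frechet_derivative (transition c d) (at y))"

locale compact_manifold =
  fixes T :: "'a topology" and A :: "('a, 'm::finite) chart set"
  assumes mfd: "connected_smooth_manifold T A" and compact: "compact_space T"
begin

lemma hausdorff: "Hausdorff_space T" and nonempty: "topspace T \<noteq> {}"
  and charts_cover: "(\<Union>c\<in>A. fst c) = topspace T"
  using mfd by (auto simp: connected_smooth_manifold_def smooth_atlas_def)

lemma is_chart: "c \<in> A \<Longrightarrow> is_chart T c"
  using mfd by (simp add: connected_smooth_manifold_def smooth_atlas_def)

lemma openin_chart: "c \<in> A \<Longrightarrow> openin T (fst c)" and open_chart_image: "c \<in> A \<Longrightarrow> open (chart_image c)"
  using is_chart by (auto simp: is_chart_def)

lemma chart_subset: "c \<in> A \<Longrightarrow> fst c \<subseteq> topspace T"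
  using openin_chart openin_subset by blast

lemma chart_homeo: "c \<in> A \<Longrightarrow> homeomorphic_map (subtopology T (fst c)) (top_of_set (chart_image c)) (snd c)"
  using is_chart by (auto simp: is_chart_def)

lemma snd_in_image: "q \<in> fst c \<Longrightarrow> snd c q \<in> chart_image c"
  by (simp add: chart_image_def)

lemma inj_chart: "c \<in> A \<Longrightarrow> inj_on (snd c) (fst c)"
  using homeomorphic_imp_injective_map[OF chart_homeo] chart_subset
  by (fastforce simp: topspace_subtopology Int_absorb1)

lemma chart_inv_snd: "c \<in> A \<Longrightarrow> q \<in> fst c \<Longrightarrow> chart_inv c (snd c q) = q"
  by (simp add: chart_inv_def inj_chart inv_into_f_f)

lemma snd_chart_inv: "y \<in> chart_image c \<Longrightarrow> snd c (chart_inv c y) = y"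
  by (simp add: chart_inv_def chart_image_def f_inv_into_f)

lemma chart_inv_in: "y \<in> chart_image c \<Longrightarrow> chart_inv c y \<in> fst c"
  by (simp add: chart_inv_def chart_image_def inv_into_into)

lemma chart_inv_in_space: "c \<in> A \<Longrightarrow> y \<in> chart_image c \<Longrightarrow> chart_inv c y \<in> topspace T"
  using chart_inv_in chart_subset by blast

lemma snd_image_eq: "c \<in> A \<Longrightarrow> snd c ` (fst c \<inter> S) = {y \<in> chart_image c. chart_inv c y \<in> S}"
proof -
  assume c: "c \<in> A"
  have "y \<in> snd c ` (fst c \<inter> S)" if "y \<in> chart_image c" "chart_inv c y \<in> S" for y
    using that by (intro image_eqI[of _ _ "chart_inv c y"]) (simp_all add: snd_chart_inv chart_inv_in)
  then show ?thesis
    using c by (auto simp: snd_in_image chart_inv_snd)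
qed

lemma open_chart_preimage: "c \<in> A \<Longrightarrow> openin T U \<Longrightarrow> open {y \<in> chart_image c. chart_inv c y \<in> U}"
proof -
  assume c: "c \<in> A" and U: "openin T U"
  have "openin (subtopology T (fst c)) (fst c \<inter> U)"
    using U by (simp add: openin_subtopology_Int2)
  then have "openin (top_of_set (chart_image c)) (snd c ` (fst c \<inter> U))"
    using homeomorphic_imp_open_map[OF chart_homeo[OF c]] by (simp add: open_map_def)
  then show ?thesis
    using open_chart_image[OF c] by (simp add: snd_image_eq[OF c] openin_open_eq)
qed

lemma openin_chart_preimage: "c \<in> A \<Longrightarrow> open V \<Longrightarrow> openin T {q \<in> fst c. snd c q \<in> V}"
proof -
  assume c: "c \<in> A" and V: "open V"
  have "continuous_map (subtopology T (fst c)) euclidean (snd c)"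
    using homeomorphic_imp_continuous_map[OF chart_homeo[OF c]] continuous_map_into_fulltopology by blast
  then have "openin (subtopology T (fst c)) {q \<in> topspace (subtopology T (fst c)). snd c q \<in> V}"
    by (rule openin_continuous_map_preimage) (use V in auto)
  moreover have "{q \<in> topspace (subtopology T (fst c)). snd c q \<in> V} = {q \<in> fst c. snd c q \<in> V}"
    using chart_subset[OF c] by auto
  ultimately show ?thesis
    using openin_trans_full[OF _ openin_chart[OF c]] by simp
qed

lemma continuous_chart_inv: "c \<in> A \<Longrightarrow> continuous_map (top_of_set (chart_image c)) T (chart_inv c)"
  unfolding continuous_map_def
  using open_chart_preimage open_chart_image chart_inv_in_space by (auto simp: openin_open_eq)

lemma compactin_chart: "c \<in> A \<Longrightarrow> compact K \<Longrightarrow> K \<subseteq> chart_image c \<Longrightarrow> compactin T (chart_inv c ` K)"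
  by (rule image_compactin[OF _ continuous_chart_inv]) (auto simp: compactin_subtopology)

lemma closedin_chart: "c \<in> A \<Longrightarrow> compact K \<Longrightarrow> K \<subseteq> chart_image c \<Longrightarrow> closedin T (chart_inv c ` K)"
  using compactin_chart compactin_imp_closedin[OF hausdorff] by blast

definition dom :: "('a, 'm) chart \<Rightarrow> ('a, 'm) chart \<Rightarrow> (real^'m) set" where
  "dom c d = {y \<in> chart_image c. chart_inv c y \<in> fst d}"

lemma open_dom: "c \<in> A \<Longrightarrow> d \<in> A \<Longrightarrow> open (dom c d)"
  unfolding dom_def by (intro open_chart_preimage openin_chart)

lemma dom_subset: "dom c d \<subseteq> chart_image c"
  by (auto simp: dom_def)

lemma snd_in_dom: "c \<in> A \<Longrightarrow> q \<in> fst c \<Longrightarrow> q \<in> fst d \<Longrightarrow> snd c q \<in> dom c d"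
  by (simp add: dom_def snd_in_image chart_inv_snd)

lemma Ck_transition: "c \<in> A \<Longrightarrow> d \<in> A \<Longrightarrow> Ck_on k (dom c d) (\<lambda>y. transition c d y $ i)"
  using mfd unfolding connected_smooth_manifold_def smooth_atlas_def smooth_on_def
  by (simp add: snd_image_eq dom_def)

lemma transition_in: "d \<in> A \<Longrightarrow> y \<in> dom c d \<Longrightarrow> transition c d y \<in> chart_image d"
  by (simp add: transition_def dom_def snd_in_image)

lemma chart_inv_transition: "d \<in> A \<Longrightarrow> y \<in> dom c d \<Longrightarrow> chart_inv d (transition c d y) = chart_inv c y"
  by (simp add: transition_def dom_def chart_inv_snd)

lemma has_derivative_transition:
  assumes "c \<in> A" "d \<in> A" "y \<in> dom c d"
  shows "(transition c d has_derivative (*v) (jac c d y)) (at y)"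
proof -
  have "(\<lambda>y. transition c d y $ i) differentiable (at y)" for i
    using Ck_transition[OF assms(1,2), of 1 i] assms(3) by simp
  then have "(transition c d has_derivative (\<lambda>v. \<chi> a. \<Sum>i\<in>UNIV. v $ i * pd i (\<lambda>y. transition c d y $ a) y)) (at y)"
    by (intro has_derivative_vec) (simp add: has_derivative_pd)
  then have der: "(transition c d has_derivative frechet_derivative (transition c d) (at y)) (at y)"
    unfolding frechet_derivative_works[symmetric] by (rule differentiableI)
  have "(*v) (jac c d y) = frechet_derivative (transition c d) (at y)"
    unfolding jac_def by (rule ext) (rule matrix_of_linear_mult[OF has_derivative_linear[OF der]])
  with der show ?thesis by simp
qed

lemma jac_nth:
  assumes "c \<in> A" "d \<in> A" "y \<in> dom c d"
  shows "jac c d y $ a $ i = pd i (\<lambda>y. transition c d y $ a) y"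
proof -
  have "((\<lambda>y. transition c d y $ a) has_derivative (\<lambda>v. (jac c d y *v v) $ a)) (at y)"
    by (rule has_derivative_compose[OF has_derivative_transition[OF assms]])
       (intro bounded_linear_imp_has_derivative bounded_linear_vec_nth)
  then show ?thesis
    by (subst pd_eqI, assumption) (simp add: matrix_vector_mult_basis column_def)
qed

lemma jac_chain:
  assumes c: "c \<in> A" and d: "d \<in> A" and e: "e \<in> A" and q: "q \<in> fst c" "q \<in> fst d" "q \<in> fst e"
  shows "jac c e (snd c q) = jac d e (snd d q) ** jac c d (snd c q)"
proof -
  have yd: "snd c q \<in> dom c d" and ye: "snd c q \<in> dom c e" and ze: "snd d q \<in> dom d e"
    using assms by (auto intro: snd_in_dom)
  have "open (dom c d \<inter> dom c e)"
    by (intro open_Int open_dom c d e)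
  moreover have "transition d e (transition c d y) = transition c e y" if "y \<in> dom c d \<inter> dom c e" for y
    using that d by (simp add: transition_def dom_def chart_inv_snd)
  moreover have "((\<lambda>y. transition d e (transition c d y)) has_derivative (\<lambda>v. jac d e (snd d q) *v (jac c d (snd c q) *v v))) (at (snd c q))"
  proof (rule has_derivative_compose[OF has_derivative_transition[OF c d yd]])
    have "transition c d (snd c q) = snd d q"
      using c q by (simp add: transition_def chart_inv_snd)
    then show "(transition d e has_derivative (*v) (jac d e (snd d q))) (at (transition c d (snd c q)))"
      using has_derivative_transition[OF d e ze] by simp
  qed
  ultimately have "(transition c e has_derivative (\<lambda>v. jac d e (snd d q) *v (jac c d (snd c q) *v v))) (at (snd c q))"
    using yd ye by (auto intro: has_derivative_transform_within_open)
  then have "(*v) (jac c e (snd c q)) = (\<lambda>v. jac d e (snd d q) *v (jac c d (snd c q) *v v))"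
    by (rule has_derivative_unique[OF has_derivative_transition[OF c e ye]])
  then show ?thesis
    by (simp add: matrix_eq matrix_vector_mul_assoc fun_eq_iff)
qed

lemma jac_self:
  assumes c: "c \<in> A" and y: "y \<in> chart_image c"
  shows "jac c c y = mat 1"
proof -
  have "(transition c c has_derivative (\<lambda>v. v)) (at y)"
    by (rule has_derivative_transform_within_open[OF has_derivative_ident open_chart_image[OF c] y])
       (simp add: transition_def snd_chart_inv)
  moreover have "y \<in> dom c c" using y by (simp add: dom_def chart_inv_in)
  ultimately have "(*v) (jac c c y) = (\<lambda>v. v)"
    by (intro has_derivative_unique[OF has_derivative_transition[OF c c]])
  then show ?thesis
    by (simp add: matrix_eq fun_eq_iff)
qed

lemma jac_inverse:
  assumes "c \<in> A" "d \<in> A" "q \<in> fst c" "q \<in> fst d"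
  shows "jac d c (snd d q) ** jac c d (snd c q) = mat 1"
  using jac_chain[of c d c q] jac_self[of c "snd c q"] assms by (simp add: snd_in_image)

lemma Ck_jac:
  assumes "c \<in> A" "d \<in> A"
  shows "Ck_on k (dom c d) (\<lambda>y. jac c d y $ a $ i)"
proof -
  have "Ck_on k (dom c d) (pd i (\<lambda>y. transition c d y $ a))"
    using Ck_transition[OF assms, of "Suc k" a] by simp
  then show ?thesis
    by (subst Ck_on_cong[OF open_dom[OF assms]]) (simp_all add: jac_nth[OF assms])
qed

lemma inj_on_transition: "c \<in> A \<Longrightarrow> d \<in> A \<Longrightarrow> inj_on (transition c d) (dom c d)"
proof (rule inj_onI)
  fix x y assume cd: "c \<in> A" "d \<in> A" and xy: "x \<in> dom c d" "y \<in> dom c d" "transition c d x = transition c d y"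
  then have "chart_inv c x = chart_inv c y"
    using chart_inv_transition[of d x c] chart_inv_transition[of d y c] by simp
  then have "snd c (chart_inv c x) = snd c (chart_inv c y)" by simp
  then show "x = y"
    using xy dom_subset[of c d] by (simp add: snd_chart_inv subset_iff)
qed

lemma transition_image: "c \<in> A \<Longrightarrow> d \<in> A \<Longrightarrow> transition c d ` dom c d = dom d c"
proof -
  assume c: "c \<in> A" and d: "d \<in> A"
  have "y \<in> transition c d ` dom c d" if "y \<in> dom d c" for y
  proof (rule image_eqI[of _ _ "snd c (chart_inv d y)"])
    show "y = transition c d (snd c (chart_inv d y))"
      using that c by (simp add: transition_def dom_def chart_inv_snd snd_chart_inv)
    show "snd c (chart_inv d y) \<in> dom c d"
      using that c by (intro snd_in_dom) (auto simp: dom_def chart_inv_in)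
  qed
  moreover have "transition c d y \<in> dom d c" if "y \<in> dom c d" for y
    using that c d by (auto simp: dom_def chart_inv_snd transition_def snd_in_image chart_inv_in)
  ultimately show ?thesis by blast
qed

end

section \<open>The Riemannian volume in charts\<close>

definition vol_density ::
  "(('a, 'm::finite) chart \<Rightarrow> 'a \<Rightarrow> real^'m^'m) \<Rightarrow> ('a, 'm) chart \<Rightarrow> real^'m \<Rightarrow> real" where
  "vol_density g c y = sqrt (det (g c (chart_inv c y)))"

lemma det_scaleR: "det (r *\<^sub>R (M :: real^'n::finite^'n)) = r ^ CARD('n) * det M"
proof -
  have "r *\<^sub>R M = (\<chi> i. r *s M $ i)"
    by (simp add: vec_eq_iff)
  then show ?thesis
    using det_rows_mul[of "\<lambda>_. r" "\<lambda>i. M $ i"] by simp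
qed

context compact_manifold
begin

abbreviation "BT \<equiv> borel_algebra T"

lemma space_BT [simp]: "space BT = topspace T"
  unfolding borel_algebra_def by (rule space_measure_of) (auto dest: openin_subset)

lemma sets_BT: "sets BT = sigma_sets (topspace T) {U. openin T U}"
  unfolding borel_algebra_def by (rule sets_measure_of) (auto dest: openin_subset)

lemma openin_sets: "openin T U \<Longrightarrow> U \<in> sets BT"
  by (simp add: sets_BT sigma_sets.Basic)

lemma closedin_sets: "closedin T C \<Longrightarrow> C \<in> sets BT"
proof -
  assume C: "closedin T C"
  then have "topspace T - C \<in> sets BT"
    by (intro openin_sets) (simp add: closedin_def)
  then have "space BT - (topspace T - C) \<in> sets BT"
    by (rule sets.compl_sets)
  then show ?thesis
    using closedin_subset[OF C] by (simp add: double_diff)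
qed

lemma chart_sets: "c \<in> A \<Longrightarrow> fst c \<in> sets BT"
  by (intro openin_sets openin_chart)

lemma measurable_chart_inv: "c \<in> A \<Longrightarrow> chart_inv c \<in> measurable (restrict_space borel (chart_image c)) BT"
  unfolding borel_algebra_def
proof (rule measurable_measure_of)
  assume c: "c \<in> A"
  show "{U. openin T U} \<subseteq> Pow (topspace T)"
    by (auto dest: openin_subset)
  show "chart_inv c \<in> space (restrict_space borel (chart_image c)) \<rightarrow> topspace T"
    using c by (auto simp: space_restrict_space chart_inv_in_space)
  fix U assume "U \<in> {U. openin T U}"
  then have "open {y \<in> chart_image c. chart_inv c y \<in> U}"
    using c open_chart_preimage by simp
  moreover have "chart_inv c -` U \<inter> space (restrict_space borel (chart_image c)) = {y \<in> chart_image c. chart_inv c y \<in> U}"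
    by (auto simp: space_restrict_space)
  ultimately show "chart_inv c -` U \<inter> space (restrict_space borel (chart_image c)) \<in> sets (restrict_space borel (chart_image c))"
    using open_chart_image[OF c] by (simp add: sets_restrict_space_iff)
qed

lemma sets_chart_volume [simp]: "sets (chart_volume T g c) = sets BT"
  by (simp add: chart_volume_def)

lemma continuous_vol_density:
  assumes "riemannian_metric A g" "c \<in> A"
  shows "continuous_on (chart_image c) (vol_density g c)"
proof -
  have "Ck_on 0 (chart_image c) (\<lambda>y. g c (chart_inv c y) $ i $ j)" for i j
    using assms unfolding riemannian_metric_def smooth_on_def by blast
  then have "continuous_on (chart_image c) (\<lambda>y. det (g c (chart_inv c y)))"
    by (intro continuous_on_det) simp
  then show ?thesis
    unfolding vol_density_def by (intro continuous_intros)
qed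

lemma measurable_vol_density:
  assumes "riemannian_metric A g" "c \<in> A"
  shows "(\<lambda>y. ennreal (vol_density g c y)) \<in> borel_measurable (restrict_space borel (chart_image c))"
  using borel_measurable_continuous_on_restrict[OF continuous_vol_density[OF assms]] by simp

lemma measurable_chart_integrand:
  assumes "riemannian_metric A g" "c \<in> A" "f \<in> borel_measurable BT"
  shows "(\<lambda>y. indicator (chart_image c) y * (ennreal (vol_density g c y) * f (chart_inv c y))) \<in> borel_measurable borel"
proof -
  have "(\<lambda>y. ennreal (vol_density g c y) * f (chart_inv c y)) \<in> borel_measurable (restrict_space borel (chart_image c))"
    using measurable_vol_density[OF assms(1,2)] measurable_compose[OF measurable_chart_inv[OF assms(2)] assms(3)]
    by (rule borel_measurable_times_ennreal)
  then show ?thesis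
    using open_chart_image[OF assms(2)]
    by (subst (asm) borel_measurable_restrict_space_iff_ennreal) (simp_all add: mult.commute)
qed

lemma nn_integral_chart_volume:
  assumes g: "riemannian_metric A g" and c: "c \<in> A" and f: "f \<in> borel_measurable BT"
  shows "integral\<^sup>N (chart_volume T g c) f =
    (\<integral>\<^sup>+y. indicator (chart_image c) y * (ennreal (vol_density g c y) * f (chart_inv c y)) \<partial>lborel)"
proof -
  have meas: "chart_inv c \<in> measurable (restrict_space lborel (chart_image c)) BT"
    using measurable_chart_inv[OF c] by (simp cong: measurable_cong_sets add: sets_restrict_space)
  have dens: "(\<lambda>y. ennreal (vol_density g c y)) \<in> borel_measurable (restrict_space lborel (chart_image c))"
    using measurable_vol_density[OF g c] by (simp cong: measurable_cong_sets add: sets_restrict_space)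
  have "integral\<^sup>N (chart_volume T g c) f =
    (\<integral>\<^sup>+y. ennreal (vol_density g c y) * f (chart_inv c y) \<partial>restrict_space lborel (chart_image c))"
    unfolding chart_volume_def vol_density_def[symmetric]
    using measurable_compose[OF meas f] dens meas f by (simp add: nn_integral_distr nn_integral_density)
  also have "\<dots> = (\<integral>\<^sup>+y. indicator (chart_image c) y * (ennreal (vol_density g c y) * f (chart_inv c y)) \<partial>lborel)"
    using open_chart_image[OF c] by (subst nn_integral_restrict_space) (simp_all add: mult.commute)
  finally show ?thesis .
qed

lemma emeasure_chart_volume:
  assumes "riemannian_metric A g" "c \<in> A" "B \<in> sets BT"
  shows "emeasure (chart_volume T g c) B =
    (\<integral>\<^sup>+y. indicator (chart_image c) y * (ennreal (vol_density g c y) * indicator B (chart_inv c y)) \<partial>lborel)"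
  using nn_integral_chart_volume[OF assms(1,2), of "indicator B"] assms(3) by simp

lemma vol_density_change:
  assumes "riemannian_metric A g" "c \<in> A" "d \<in> A" "y \<in> dom c d"
  shows "vol_density g c y = \<bar>det (jac c d y)\<bar> * vol_density g d (transition c d y)"
proof -
  let ?q = "chart_inv c y"
  have q: "?q \<in> fst c" "?q \<in> fst d" "snd c ?q = y"
    using assms(4) by (auto simp: dom_def chart_inv_in snd_chart_inv)
  then have "g c ?q = transpose (jac c d y) ** g d ?q ** jac c d y"
    using assms(1-3) unfolding riemannian_metric_def Let_def jac_def by (metis IntI)
  then have "det (g c ?q) = (det (jac c d y))\<^sup>2 * det (g d ?q)"
    by (simp add: det_mul det_transpose power2_eq_square)
  then show ?thesis
    using chart_inv_transition[OF assms(3,4)] by (simp add: vol_density_def real_sqrt_mult)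
qed

text \<open>Change of variables by the transition map, whose Jacobian is the quotient of the two
  densities. This consistency is what allows finitely many chart volumes to control the
  supremum.\<close>

lemma emeasure_chart_volume_eq:
  assumes g: "riemannian_metric A g" and c: "c \<in> A" and d: "d \<in> A"
    and B: "B \<in> sets BT" "B \<subseteq> fst c" "B \<subseteq> fst d"
  shows "emeasure (chart_volume T g c) B = emeasure (chart_volume T g d) B"
proof -
  define h where "h y = indicator (chart_image d) y * (ennreal (vol_density g d y) * indicator B (chart_inv d y))" for y
  have h: "h \<in> borel_measurable borel"
    unfolding h_def by (rule measurable_chart_integrand[OF g d]) (use B in simp)
  have "emeasure (chart_volume T g d) B = (\<integral>\<^sup>+y. indicator (transition c d ` dom c d) y * h y \<partial>lborel)"
    unfolding emeasure_chart_volume[OF g d B(1)] transition_image[OF c d]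
    by (intro nn_integral_cong) (use B in \<open>auto simp: h_def dom_def indicator_def\<close>)
  also have "\<dots> = (\<integral>\<^sup>+y. indicator (dom c d) y * ennreal \<bar>det (matrix ((*v) (jac c d y)))\<bar> * h (transition c d y) \<partial>lborel)"
    using Ck_on_imp_continuous_on[OF Ck_jac[OF c d, of 0]]
    by (intro nn_integral_inj_image open_dom c d inj_on_transition has_derivative_transition h)
       (auto intro!: continuous_on_det)
  also have "\<dots> = emeasure (chart_volume T g c) B"
    unfolding emeasure_chart_volume[OF g c B(1)]
  proof (intro nn_integral_cong)
    fix y
    show "indicator (dom c d) y * ennreal \<bar>det (matrix ((*v) (jac c d y)))\<bar> * h (transition c d y) =
      indicator (chart_image c) y * (ennreal (vol_density g c y) * indicator B (chart_inv c y))"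
    proof (cases "y \<in> dom c d")
      case True
      have "ennreal (vol_density g c y) = ennreal \<bar>det (jac c d y)\<bar> * ennreal (vol_density g d (transition c d y))"
        unfolding vol_density_change[OF g c d True] by (simp add: ennreal_mult')
      then show ?thesis
        using True transition_in[OF d True] chart_inv_transition[OF d True] dom_subset[of c d]
        by (auto simp: h_def indicator_def)
    next
      case False
      then show ?thesis using B by (auto simp: dom_def indicator_def)
    qed
  qed
  finally show ?thesis ..
qed

lemma A_nonempty: "A \<noteq> {}"
proof
  assume "A = {}"
  then have "topspace T = {}" using charts_cover by simp
  then show False using nonempty by contradiction
qed

abbreviation "RV g \<equiv> riemannian_volume T A g"

lemma sets_RV [simp]: "sets (RV g) = sets BT"
  unfolding riemannian_volume_def by (rule sets_SUP) (simp_all add: A_nonempty)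

lemma space_RV [simp]: "space (RV g) = topspace T"
  using sets_eq_imp_space_eq[OF sets_RV] by simp

lemma measurable_RV: "measurable (RV g) M = measurable BT M"
  by (rule measurable_cong_sets) simp_all

lemma chart_volume_le_RV: "c \<in> A \<Longrightarrow> chart_volume T g c \<le> RV g"
  unfolding riemannian_volume_def by (rule SUP_upper)

lemma emeasure_chart_volume_le_RV: "c \<in> A \<Longrightarrow> emeasure (chart_volume T g c) B \<le> emeasure (RV g) B"
  by (intro le_measureD3 chart_volume_le_RV) simp_all

lemma nn_integral_chart_volume_le_RV:
  "c \<in> A \<Longrightarrow> integral\<^sup>N (chart_volume T g c) f \<le> integral\<^sup>N (RV g) f"
  by (intro nn_integral_mono_measure chart_volume_le_RV) simp_all

lemma le_measureI:
  assumes "sets M = sets N" "\<And>B. B \<in> sets M \<Longrightarrow> emeasure M B \<le> emeasure N B"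
  shows "M \<le> N"
proof -
  have "emeasure M B \<le> emeasure N B" for B
    using assms by (cases "B \<in> sets M") (auto simp: emeasure_notin_sets)
  then show ?thesis
    using assms(1) sets_eq_imp_space_eq[OF assms(1)] by (simp add: le_measure_iff le_fun_def)
qed

text \<open>The measure that sums the chart volumes of finitely many pieces covering the manifold is an
  upper bound of all chart volumes.\<close>

lemma emeasure_RV_le:
  assumes g: "riemannian_metric A g" and I: "finite I" "\<And>k. k \<in> I \<Longrightarrow> c k \<in> A"
    and Q: "\<And>k. k \<in> I \<Longrightarrow> Q k \<in> sets BT" "\<And>k. k \<in> I \<Longrightarrow> Q k \<subseteq> fst (c k)" "(\<Union>k\<in>I. Q k) = topspace T"
    and B: "B \<in> sets BT"
  shows "emeasure (RV g) B \<le> (\<Sum>k\<in>I. emeasure (chart_volume T g (c k)) (B \<inter> Q k))"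
proof -
  define \<mu> where "\<mu> B = (\<Sum>k\<in>I. emeasure (chart_volume T g (c k)) (B \<inter> Q k))" for B
  define \<nu> where "\<nu> = measure_of (topspace T) (sets BT) \<mu>"
  have \<nu>: "sets \<nu> = sets BT"
    unfolding \<nu>_def using sets.space_closed[of BT] sets.sigma_sets_eq[of BT] by (simp add: sets_measure_of)
  have emeas: "emeasure \<nu> B = \<mu> B" if "B \<in> sets BT" for B
    unfolding \<nu>_def
  proof (rule emeasure_measure_of_sigma)
    show "sigma_algebra (topspace T) (sets BT)"
      using sets.sigma_algebra_axioms[of BT] by simp
    show "positive (sets BT) \<mu>"
      by (simp add: positive_def \<mu>_def)
    show "countably_additive (sets BT) \<mu>"
    proof (rule countably_additiveI)
      fix E :: "nat \<Rightarrow> 'a set"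
      assume E: "range E \<subseteq> sets BT" "disjoint_family E"
      have "(\<Sum>n. \<mu> (E n)) = (\<Sum>k\<in>I. \<Sum>n. emeasure (chart_volume T g (c k)) (E n \<inter> Q k))"
        unfolding \<mu>_def by (rule suminf_sum) simp
      also have "\<dots> = (\<Sum>k\<in>I. emeasure (chart_volume T g (c k)) (\<Union>n. E n \<inter> Q k))"
      proof (intro sum.cong refl suminf_emeasure)
        fix k assume "k \<in> I"
        then show "range (\<lambda>n. E n \<inter> Q k) \<subseteq> sets (chart_volume T g (c k))"
          using E Q by auto
        show "disjoint_family (\<lambda>n. E n \<inter> Q k)"
          using E(2) by (auto simp: disjoint_family_on_def)
      qed
      also have "\<dots> = \<mu> (\<Union>n. E n)"
        by (simp add: \<mu>_def)
      finally show "(\<Sum>n. \<mu> (E n)) = \<mu> (\<Union>n. E n)" .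
    qed
  qed (rule that)
  have "RV g \<le> \<nu>"
    unfolding riemannian_volume_def
  proof (rule SUP_least)
    fix d assume d: "d \<in> A"
    show "chart_volume T g d \<le> \<nu>"
    proof (rule le_measureI)
      fix B assume "B \<in> sets (chart_volume T g d)"
      then have B: "B \<in> sets BT" by simp
      let ?D = "chart_volume T g d"
      have Bd: "B \<inter> fst d \<in> sets BT"
        using B chart_sets[OF d] by auto
      have "emeasure ?D B = emeasure ?D (B \<inter> fst d)"
        unfolding emeasure_chart_volume[OF g d B] emeasure_chart_volume[OF g d Bd]
        by (intro nn_integral_cong) (auto simp: indicator_def chart_inv_in)
      also have "B \<inter> fst d = (\<Union>k\<in>I. B \<inter> fst d \<inter> Q k)"
        using chart_subset[OF d] Q(3) by blast
      also have "emeasure ?D \<dots> \<le> (\<Sum>k\<in>I. emeasure ?D (B \<inter> fst d \<inter> Q k))"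
        using Bd Q I by (intro emeasure_subadditive_finite) auto
      \<comment> \<open>Each piece lies in the domains of both \<open>d\<close> and
        \<open>c k\<close>, where the two chart volumes agree.\<close>
      also have "\<dots> = (\<Sum>k\<in>I. emeasure (chart_volume T g (c k)) (B \<inter> fst d \<inter> Q k))"
        using Bd Q I d by (intro sum.cong refl emeasure_chart_volume_eq g) auto
      also have "\<dots> \<le> (\<Sum>k\<in>I. emeasure (chart_volume T g (c k)) (B \<inter> Q k))"
        using B Q by (intro sum_mono emeasure_mono) auto
      also have "\<dots> = emeasure \<nu> B"
        by (simp add: emeas[OF B] \<mu>_def)
      finally show "emeasure ?D B \<le> emeasure \<nu> B" .
    qed (simp add: \<nu>)
  qed
  then have "emeasure (RV g) B \<le> emeasure \<nu> B"
    by (rule le_measureD3) (simp add: \<nu>)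
  then show ?thesis
    by (simp add: emeas[OF B] \<mu>_def)
qed

text \<open>All chart densities are multiplied by \<open>s ^ CARD('m)\<close>, so the volume of
  \<open>g\<close>, scaled by this factor, dominates every chart volume of \<open>g'\<close> and
  hence their supremum.\<close>

lemma emeasure_RV_scale_le:
  assumes g: "riemannian_metric A g" "riemannian_metric A g'"
    and eq: "\<And>c q. c \<in> A \<Longrightarrow> q \<in> fst c \<Longrightarrow> g' c q = s\<^sup>2 *\<^sub>R g c q" and s: "s > 0"
    and B: "B \<in> sets BT"
  shows "emeasure (RV g') B \<le> ennreal (s ^ CARD('m)) * emeasure (RV g) B"
proof -
  have "RV g' \<le> scale_measure (ennreal (s ^ CARD('m))) (RV g)"
    unfolding riemannian_volume_def[of T A g']
  proof (rule SUP_least, rule le_measureI)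
    fix c B assume c: "c \<in> A" and "B \<in> sets (chart_volume T g' c)"
    then have B: "B \<in> sets BT" by simp
    have dens: "vol_density g' c y = s ^ CARD('m) * vol_density g c y" if "y \<in> chart_image c" for y
    proof -
      have "g' c (chart_inv c y) = s\<^sup>2 *\<^sub>R g c (chart_inv c y)"
        using that c by (intro eq chart_inv_in)
      then have "det (g' c (chart_inv c y)) = (s ^ CARD('m))\<^sup>2 * det (g c (chart_inv c y))"
        by (simp add: det_scaleR power_commutes flip: power_mult) (simp add: mult.commute)
      then show ?thesis
        using s by (simp add: vol_density_def real_sqrt_mult)
    qed
    have "emeasure (chart_volume T g' c) B = (\<integral>\<^sup>+y. ennreal (s ^ CARD('m)) *
        (indicator (chart_image c) y * (ennreal (vol_density g c y) * indicator B (chart_inv c y))) \<partial>lborel)"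
      unfolding emeasure_chart_volume[OF g(2) c B]
      using s by (intro nn_integral_cong) (auto simp: indicator_def dens ennreal_mult')
    also have "\<dots> = ennreal (s ^ CARD('m)) * emeasure (chart_volume T g c) B"
      unfolding emeasure_chart_volume[OF g(1) c B]
      by (intro nn_integral_cmult) (use measurable_chart_integrand[OF g(1) c, of "indicator B"] B in simp)
    also have "\<dots> \<le> ennreal (s ^ CARD('m)) * emeasure (RV g) B"
      by (intro mult_left_mono emeasure_chart_volume_le_RV c) simp
    finally show "emeasure (chart_volume T g' c) B \<le> emeasure (scale_measure (ennreal (s ^ CARD('m))) (RV g)) B"
      by simp
  qed simp
  then have "emeasure (RV g') B \<le> emeasure (scale_measure (ennreal (s ^ CARD('m))) (RV g)) B"
    by (rule le_measureD3) simp
  then show ?thesis by simp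
qed

lemma emeasure_RV_scale:
  assumes g: "riemannian_metric A g" "riemannian_metric A g'"
    and eq: "\<And>c q. c \<in> A \<Longrightarrow> q \<in> fst c \<Longrightarrow> g' c q = s\<^sup>2 *\<^sub>R g c q" and s: "s > 0"
    and B: "B \<in> sets BT"
  shows "emeasure (RV g') B = ennreal (s ^ CARD('m)) * emeasure (RV g) B"
proof (rule antisym)
  \<comment> \<open>Passing back from \<open>g'\<close> to \<open>g\<close> is a scaling by
    \<open>1 / s\<close>, so the inequality already proved also gives its converse.\<close>
  have "emeasure (RV g) B \<le> ennreal ((1 / s) ^ CARD('m)) * emeasure (RV g') B"
    by (rule emeasure_RV_scale_le[OF g(2,1) _ _ B]) (use s eq in \<open>auto simp: power_divide\<close>)
  then have "ennreal (s ^ CARD('m)) * emeasure (RV g) B \<le>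
      ennreal (s ^ CARD('m)) * (ennreal ((1 / s) ^ CARD('m)) * emeasure (RV g') B)"
    by (rule mult_left_mono) simp
  also have "\<dots> = ennreal (s ^ CARD('m) * (1 / s) ^ CARD('m)) * emeasure (RV g') B"
    using s by (simp add: ennreal_mult mult.assoc)
  also have "s ^ CARD('m) * (1 / s) ^ CARD('m) = 1"
    using s by (simp flip: power_mult_distrib)
  finally show "ennreal (s ^ CARD('m)) * emeasure (RV g) B \<le> emeasure (RV g') B"
    by simp
qed (rule emeasure_RV_scale_le[OF assms])

end

section \<open>Metrics glued from coordinate metrics\<close>

type_synonym ('a, 'm) patch = "('a, 'm) chart \<times> (real^'m) \<times> real"

abbreviation patch_chart :: "('a, 'm::finite) patch \<Rightarrow> ('a, 'm) chart" where "patch_chart \<equiv> fst"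
abbreviation patch_centre :: "('a, 'm::finite) patch \<Rightarrow> real^'m" where "patch_centre t \<equiv> fst (snd t)"
abbreviation patch_radius :: "('a, 'm::finite) patch \<Rightarrow> real" where "patch_radius t \<equiv> snd (snd t)"

abbreviation patch_cball :: "('a, 'm::finite) patch \<Rightarrow> (real^'m) set" where
  "patch_cball t \<equiv> cball (patch_centre t) (patch_radius t)"

abbreviation patch_ball :: "('a, 'm::finite) patch \<Rightarrow> (real^'m) set" where
  "patch_ball t \<equiv> ball (patch_centre t) (patch_radius t)"

definition weight :: "(('a, 'm::finite) patch \<Rightarrow> real^'m \<Rightarrow> real) \<Rightarrow> ('a, 'm) patch \<Rightarrow> 'a \<Rightarrow> real" where
  "weight \<phi> t q = (if q \<in> fst (patch_chart t) then \<phi> t (snd (patch_chart t) q) else 0)"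

text \<open>The Euclidean metric of each patch chart, multiplied by its weight and pulled back; in
  the chart \<open>c\<close> its Gram matrix is the transposed Jacobian times the Jacobian. The
  weights need not sum to one: a sum of semidefinite forms is a metric as soon as one of them is
  definite.\<close>

definition patch_metric ::
  "('a, 'm::finite) patch set \<Rightarrow> (('a, 'm) patch \<Rightarrow> real^'m \<Rightarrow> real) \<Rightarrow> ('a, 'm) chart \<Rightarrow> 'a \<Rightarrow> real^'m^'m" where
  "patch_metric I \<phi> c q = (\<Sum>t\<in>I. weight \<phi> t q *\<^sub>R
     (transpose (jac c (patch_chart t) (snd c q)) ** jac c (patch_chart t) (snd c q)))"

lemma sum_matrix_vector_mult:
  fixes M :: "'b \<Rightarrow> real^'n::finite^'m::finite"
  shows "(\<Sum>t\<in>I. M t) *v v = (\<Sum>t\<in>I. M t *v v)"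
  by (induction I rule: infinite_finite_induct) (simp_all add: matrix_vector_mult_add_rdistrib)

lemma inner_gram: "u \<bullet> ((transpose J ** J) *v v) = (J *v u) \<bullet> ((J :: real^'n::finite^'m::finite) *v v)"
  by (metis dot_lmul_matrix matrix_vector_mul_assoc vector_transpose_matrix)

lemma inner_patch_metric:
  "u \<bullet> (patch_metric I \<phi> c q *v v) = (\<Sum>t\<in>I. weight \<phi> t q *
     ((jac c (patch_chart t) (snd c q) *v u) \<bullet> (jac c (patch_chart t) (snd c q) *v v)))"
  by (simp add: patch_metric_def sum_matrix_vector_mult inner_sum_right inner_gram flip: scaleR_matrix_vector_assoc)

lemma matrix_eq_innerI:
  fixes M M' :: "real^'n::finite^'m::finite"
  assumes "\<And>u v. u \<bullet> (M *v v) = u \<bullet> (M' *v v)"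
  shows "M = M'"
proof -
  have "M *v v = M' *v v" for v
    by (rule vector_eq_ldot[THEN iffD1]) (simp add: assms)
  then show ?thesis
    by (simp add: matrix_eq)
qed

lemma inner_transpose: "u \<bullet> (transpose M *v v) = v \<bullet> ((M :: real^'n::finite^'m::finite) *v u)"
  by (metis dot_lmul_matrix inner_commute transpose_matrix_vector)

context compact_manifold
begin

definition valid_patch :: "('a, 'm) patch \<Rightarrow> bool" where
  "valid_patch t \<longleftrightarrow> patch_chart t \<in> A \<and> patch_radius t > 0 \<and> patch_cball t \<subseteq> chart_image (patch_chart t)"

definition patch_set :: "('a, 'm) patch \<Rightarrow> 'a set" where
  "patch_set t = chart_inv (patch_chart t) ` patch_cball t"

text \<open>Positivity exactly on the open balls has two purposes: the weights extend smoothly by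
  zero beyond the closed patch sets, and, as the open balls cover the manifold, some weight is
  positive at every point.\<close>

definition bump_family :: "('a, 'm) patch set \<Rightarrow> (('a, 'm) patch \<Rightarrow> real^'m \<Rightarrow> real) \<Rightarrow> bool" where
  "bump_family I \<phi> \<longleftrightarrow> finite I \<and> (\<forall>t\<in>I. valid_patch t \<and> (\<forall>k. Ck_on k UNIV (\<phi> t)) \<and>
      (\<forall>y. 0 \<le> \<phi> t y) \<and> (\<forall>y. 0 < \<phi> t y \<longleftrightarrow> y \<in> patch_ball t)) \<and>
    (\<forall>q\<in>topspace T. \<exists>t\<in>I. q \<in> fst (patch_chart t) \<and> snd (patch_chart t) q \<in> patch_ball t)"

lemma patch_set_closed: "valid_patch t \<Longrightarrow> closedin T (patch_set t)"
  unfolding patch_set_def valid_patch_def by (intro closedin_chart) auto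

lemma in_patch_set_iff:
  "valid_patch t \<Longrightarrow> q \<in> patch_set t \<longleftrightarrow> q \<in> fst (patch_chart t) \<and> snd (patch_chart t) q \<in> patch_cball t"
  unfolding patch_set_def valid_patch_def
  by (auto simp: chart_inv_in snd_chart_inv subset_iff image_iff) (metis chart_inv_snd mem_cball)

lemma weight_eq_0:
  assumes "bump_family I \<phi>" "t \<in> I" "q \<notin> patch_set t"
  shows "weight \<phi> t q = 0"
proof (cases "q \<in> fst (patch_chart t)")
  case True
  then have "snd (patch_chart t) q \<notin> patch_ball t"
    using assms in_patch_set_iff[of t q] by (auto simp: bump_family_def)
  then have "\<not> 0 < \<phi> t (snd (patch_chart t) q)" "0 \<le> \<phi> t (snd (patch_chart t) q)"
    using assms(1,2) by (auto simp: bump_family_def)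
  then show ?thesis using True by (simp add: weight_def)
qed (simp add: weight_def)

lemma weight_nonneg: "bump_family I \<phi> \<Longrightarrow> t \<in> I \<Longrightarrow> 0 \<le> weight \<phi> t q"
  by (auto simp: weight_def bump_family_def)

text \<open>A point in the overlap with the patch chart has a neighbourhood where the term is a
  product of smooth functions. Any other point lies off the patch set, which is compact and so
  closed in the Hausdorff space \<open>T\<close>, and the term vanishes near it.\<close>

lemma smooth_patch_term:
  assumes fam: "bump_family I \<phi>" and t: "t \<in> I" and c: "c \<in> A"
  shows "Ck_on k (chart_image c) (\<lambda>y. weight \<phi> t (chart_inv c y) *
    (transpose (jac c (patch_chart t) y) ** jac c (patch_chart t) y) $ i $ j)" (is "Ck_on k _ ?f")
proof (rule Ck_on_local)
  let ?d = "patch_chart t"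
  have valid: "valid_patch t" and d: "?d \<in> A" and sm: "Ck_on k UNIV (\<phi> t)"
    using fam t by (auto simp: bump_family_def valid_patch_def)
  fix y assume y: "y \<in> chart_image c"
  show "\<exists>V. open V \<and> y \<in> V \<and> Ck_on k V ?f"
  proof (cases "y \<in> dom c ?d")
    case True
    have "Ck_on k (dom c ?d) (\<lambda>y. \<phi> t (transition c ?d y) * (\<Sum>a\<in>UNIV. jac c ?d y $ a $ i * jac c ?d y $ a $ j))"
      by (intro Ck_on_mult Ck_on_sum open_dom c d Ck_jac Ck_on_compose[OF _ open_UNIV _ Ck_transition sm]) auto
    moreover have "\<phi> t (transition c ?d y) * (\<Sum>a\<in>UNIV. jac c ?d y $ a $ i * jac c ?d y $ a $ j) = ?f y"
      if "y \<in> dom c ?d" for y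
      using that by (simp add: weight_def dom_def transition_def matrix_matrix_mult_def transpose_def)
    ultimately have "Ck_on k (dom c ?d) ?f"
      by (subst (asm) Ck_on_cong[OF open_dom[OF c d]])
    then show ?thesis
      using True open_dom[OF c d] by blast
  next
    case False
    define V where "V = {y \<in> chart_image c. chart_inv c y \<in> topspace T - patch_set t}"
    have "open V"
      unfolding V_def using patch_set_closed[OF valid] by (intro open_chart_preimage c) (simp add: closedin_def)
    moreover have "y \<in> V"
      using y False in_patch_set_iff[OF valid] chart_inv_in_space[OF c y] by (auto simp: V_def dom_def)
    moreover have "Ck_on k V ?f"
      by (subst Ck_on_cong[OF \<open>open V\<close>, of _ "\<lambda>_. 0"])
         (auto simp: V_def weight_eq_0[OF fam t] intro: Ck_on_const)
    ultimately show ?thesis by blast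
  qed
qed

text \<open>Definiteness comes from a patch of positive weight and the invertibility of the Jacobian
  of its chart change; the transformation law is the chain rule in every summand.\<close>

lemma riemannian_patch_metric:
  assumes fam: "bump_family I \<phi>"
  shows "riemannian_metric A (patch_metric I \<phi>)"
proof -
  have I: "\<And>t. t \<in> I \<Longrightarrow> patch_chart t \<in> A"
    using fam by (auto simp: bump_family_def valid_patch_def)
  have smooth: "smooth_on (chart_image c) (\<lambda>y. patch_metric I \<phi> c (chart_inv c y) $ i $ j)" if c: "c \<in> A" for c i j
    unfolding smooth_on_def
  proof
    fix k
    have "Ck_on k (chart_image c) (\<lambda>y. \<Sum>t\<in>I. weight \<phi> t (chart_inv c y) *
        (transpose (jac c (patch_chart t) y) ** jac c (patch_chart t) y) $ i $ j)"
      by (intro Ck_on_sum open_chart_image c smooth_patch_term[OF fam])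
    moreover have "(\<Sum>t\<in>I. weight \<phi> t (chart_inv c y) *
        (transpose (jac c (patch_chart t) y) ** jac c (patch_chart t) y) $ i $ j) =
        patch_metric I \<phi> c (chart_inv c y) $ i $ j" if "y \<in> chart_image c" for y
      using that by (simp add: patch_metric_def snd_chart_inv)
    ultimately show "Ck_on k (chart_image c) (\<lambda>y. patch_metric I \<phi> c (chart_inv c y) $ i $ j)"
      by (subst (asm) Ck_on_cong[OF open_chart_image[OF c]])
  qed
  have sym: "transpose (patch_metric I \<phi> c q) = patch_metric I \<phi> c q" for c q
    by (rule matrix_eq_innerI) (simp only: inner_transpose inner_patch_metric inner_commute)
  have pos: "0 < v \<bullet> (patch_metric I \<phi> c q *v v)" if c: "c \<in> A" and q: "q \<in> fst c" and v: "v \<noteq> 0" for c q v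
  proof -
    obtain t where t: "t \<in> I" "q \<in> fst (patch_chart t)" "snd (patch_chart t) q \<in> patch_ball t"
      using fam chart_subset[OF c] q unfolding bump_family_def by blast
    let ?d = "patch_chart t"
    have "0 < weight \<phi> t q"
      using t fam by (simp add: weight_def bump_family_def)
    moreover have "jac c ?d (snd c q) *v v \<noteq> 0"
    proof
      assume "jac c ?d (snd c q) *v v = 0"
      then have "(jac ?d c (snd ?d q) ** jac c ?d (snd c q)) *v v = 0"
        by (simp flip: matrix_vector_mul_assoc)
      then show False
        using jac_inverse[OF c I[OF t(1)] q t(2)] v by simp
    qed
    ultimately have "0 < weight \<phi> t q * ((jac c ?d (snd c q) *v v) \<bullet> (jac c ?d (snd c q) *v v))"
      by simp
    then show ?thesis
      unfolding inner_patch_metric using t(1) fam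
      by (intro sum_pos2[of _ t]) (auto simp: bump_family_def weight_nonneg[OF fam])
  qed
  have change: "patch_metric I \<phi> c q = transpose (jac c d (snd c q)) ** patch_metric I \<phi> d q ** jac c d (snd c q)"
    if c: "c \<in> A" and d: "d \<in> A" and q: "q \<in> fst c" "q \<in> fst d" for c d q
  proof (rule matrix_eq_innerI)
    fix u v
    let ?J = "jac c d (snd c q)"
    have "u \<bullet> ((transpose ?J ** patch_metric I \<phi> d q ** ?J) *v v) = (?J *v u) \<bullet> (patch_metric I \<phi> d q *v (?J *v v))"
      by (metis (no_types, lifting) inner_commute inner_transpose matrix_vector_mul_assoc)
    also have "\<dots> = u \<bullet> (patch_metric I \<phi> c q *v v)"
      unfolding inner_patch_metric
    proof (intro sum.cong refl)
      fix t assume t: "t \<in> I"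
      show "weight \<phi> t q * ((jac d (patch_chart t) (snd d q) *v (?J *v u)) \<bullet> (jac d (patch_chart t) (snd d q) *v (?J *v v))) =
        weight \<phi> t q * ((jac c (patch_chart t) (snd c q) *v u) \<bullet> (jac c (patch_chart t) (snd c q) *v v))"
        using jac_chain[OF c d I[OF t] q] by (cases "q \<in> fst (patch_chart t)") (simp_all add: weight_def matrix_vector_mul_assoc)
    qed
    finally show "u \<bullet> (patch_metric I \<phi> c q *v v) = u \<bullet> ((transpose ?J ** patch_metric I \<phi> d q ** ?J) *v v)" ..
  qed
  show ?thesis
    unfolding riemannian_metric_def Let_def jac_def[symmetric] using smooth sym pos change by blast
qed

lemma patch_metric_scale:
  assumes "\<And>t y. t \<in> I \<Longrightarrow> \<phi>' t y = r * \<phi> t y"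
  shows "patch_metric I \<phi>' c q = r *\<^sub>R patch_metric I \<phi> c q"
  unfolding patch_metric_def scaleR_sum_right
  by (intro sum.cong refl) (simp add: weight_def assms)

text \<open>At a point reached by one patch only, the metric is a multiple of the Euclidean metric
  of that patch's chart. The grid is placed in such a region.\<close>

lemma patch_metric_conformal:
  assumes fam: "bump_family I \<phi>" and t: "t \<in> I" and q: "q \<in> fst (patch_chart t)"
    and other: "\<And>s. s \<in> I \<Longrightarrow> s \<noteq> t \<Longrightarrow> q \<notin> patch_set s"
  shows "patch_metric I \<phi> (patch_chart t) q = \<phi> t (snd (patch_chart t) q) *\<^sub>R mat 1"
proof -
  let ?c = "patch_chart t"
  have c: "?c \<in> A" and "finite I"
    using fam t by (auto simp: bump_family_def valid_patch_def)
  have "patch_metric I \<phi> ?c q = (\<Sum>s\<in>I. if s = t then \<phi> t (snd ?c q) *\<^sub>R mat 1 else 0)"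
    unfolding patch_metric_def
    using q weight_eq_0[OF fam _ other] jac_self[OF c snd_in_image[OF q]]
    by (intro sum.cong refl) (auto simp: weight_def[of _ t] transpose_mat)
  then show ?thesis
    using t \<open>finite I\<close> by simp
qed

text \<open>Points outside the coordinate ball of radius \<open>R\<close> lie off the compact image
  of the ball of radius \<open>R1\<close>, hence have small patches avoiding it, and compactness
  selects finitely many. On the smaller ball the distinguished patch is then alone.\<close>

lemma ex_patches:
  assumes c0: "c0 \<in> A" and R: "cball z0 R \<subseteq> chart_image c0" "0 < R1" "R1 < R"
  shows "\<exists>I. finite I \<and> (\<forall>t\<in>I. valid_patch t \<and> patch_set t \<inter> chart_inv c0 ` cball z0 R1 = {}) \<and>
    (\<forall>q\<in>topspace T. (q \<in> fst c0 \<and> snd c0 q \<in> ball z0 R) \<or>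
       (\<exists>t\<in>I. q \<in> fst (patch_chart t) \<and> snd (patch_chart t) q \<in> patch_ball t))"
proof -
  define K where "K = chart_inv c0 ` cball z0 R1"
  have R1: "cball z0 R1 \<subseteq> ball z0 R" using R by auto
  have K: "closedin T K"
    unfolding K_def using R R1 by (intro closedin_chart c0) (auto intro: subset_trans)
  define N where "N t = {q \<in> fst (patch_chart t). snd (patch_chart t) q \<in> patch_ball t}" for t :: "('a, 'm) patch"
  define P where "P = {t. valid_patch t \<and> patch_set t \<inter> K = {}}"
  have openN: "openin T (N t)" if "patch_chart t \<in> A" for t
    unfolding N_def using that by (intro openin_chart_preimage) auto
  have cover: "q \<in> N (c0, z0, R) \<or> (\<exists>t\<in>P. q \<in> N t)" if q: "q \<in> topspace T" for q
  proof (cases "q \<in> N (c0, z0, R)")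
    case False
    have "q \<notin> K"
      using False R R1 by (auto simp: K_def N_def chart_inv_in snd_chart_inv subset_iff)
    obtain c where c: "c \<in> A" "q \<in> fst c"
      using q unfolding charts_cover[symmetric] by blast
    define V where "V = {y \<in> chart_image c. chart_inv c y \<in> topspace T - K}"
    have "open V"
      unfolding V_def using K by (intro open_chart_preimage c) (simp add: closedin_def)
    moreover have "snd c q \<in> V"
      using q c \<open>q \<notin> K\<close> by (simp add: V_def snd_in_image chart_inv_snd)
    ultimately obtain r where r: "r > 0" "cball (snd c q) r \<subseteq> V"
      by (metis open_contains_cball)
    have "(c, snd c q, r) \<in> P"
      using r c by (auto simp: P_def valid_patch_def patch_set_def V_def)
    moreover have "q \<in> N (c, snd c q, r)"
      using c r by (simp add: N_def)
    ultimately show ?thesis by blast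
  qed simp
  have "\<exists>\<F>. finite \<F> \<and> \<F> \<subseteq> insert (N (c0, z0, R)) (N ` P) \<and> topspace T \<subseteq> \<Union>\<F>"
  proof (rule compact[unfolded compact_space_alt, THEN spec, THEN mp])
    show "(\<forall>U\<in>insert (N (c0, z0, R)) (N ` P). openin T U) \<and> topspace T \<subseteq> \<Union>(insert (N (c0, z0, R)) (N ` P))"
    proof
      show "\<forall>U\<in>insert (N (c0, z0, R)) (N ` P). openin T U"
        using openN c0 by (auto simp: P_def valid_patch_def)
      show "topspace T \<subseteq> \<Union>(insert (N (c0, z0, R)) (N ` P))"
        using cover by blast
    qed
  qed
  then obtain \<F> where F: "finite \<F>" "\<F> \<subseteq> insert (N (c0, z0, R)) (N ` P)" "topspace T \<subseteq> \<Union>\<F>"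
    by blast
  then have "\<F> - {N (c0, z0, R)} \<subseteq> N ` P" by auto
  then obtain I where I: "I \<subseteq> P" "finite I" "\<F> - {N (c0, z0, R)} = N ` I"
    using F(1) by (meson finite_Diff finite_subset_image)
  have "q \<in> N (c0, z0, R) \<or> (\<exists>t\<in>I. q \<in> N t)" if "q \<in> topspace T" for q
    using that F(3) I(3) by blast
  then show ?thesis
    using I by (intro exI[of _ I]) (auto simp: N_def P_def K_def)
qed

text \<open>The points of the closed ball of \<open>t\<close> that belong to the patch set of
  \<open>s\<close> form a closed ball minus an open set, hence a compact subset of the overlap, on
  which the Jacobian entries are continuous.\<close>

lemma patch_jac_bounded:
  assumes t: "valid_patch t" and s: "valid_patch s"
  shows "\<exists>b. \<forall>y\<in>patch_cball t. chart_inv (patch_chart t) y \<in> patch_set s \<longrightarrow>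
    (\<forall>i j. \<bar>(transpose (jac (patch_chart t) (patch_chart s) y) ** jac (patch_chart t) (patch_chart s) y) $ i $ j\<bar> \<le> b)"
proof -
  let ?c = "patch_chart t" and ?d = "patch_chart s"
  let ?M = "\<lambda>y. transpose (jac ?c ?d y) ** jac ?c ?d y"
  have c: "?c \<in> A" and d: "?d \<in> A"
    using assms by (auto simp: valid_patch_def)
  define C where "C = patch_cball t - {y \<in> chart_image ?c. chart_inv ?c y \<in> topspace T - patch_set s}"
  have "open {y \<in> chart_image ?c. chart_inv ?c y \<in> topspace T - patch_set s}"
    using patch_set_closed[OF s] by (intro open_chart_preimage c) (simp add: closedin_def)
  then have C: "compact C"
    unfolding C_def by (intro compact_diff) auto
  have Cdom: "C \<subseteq> dom ?c ?d"
    using t in_patch_set_iff[OF s] chart_inv_in_space[OF c] by (auto simp: C_def dom_def valid_patch_def)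
  have cont: "continuous_on C (\<lambda>y. ?M y $ i $ j)" for i j
    unfolding matrix_matrix_mult_def transpose_def
    by (simp, intro continuous_intros continuous_on_subset[OF Ck_on_imp_continuous_on[OF Ck_jac[OF c d]] Cdom])
  have "\<exists>b. \<forall>y\<in>C. \<bar>?M y $ i $ j\<bar> \<le> b" for i j
    using compact_imp_bounded[OF compact_continuous_image[OF cont C], of i j] by (auto simp: bounded_iff)
  then obtain b where b: "\<And>i j y. y \<in> C \<Longrightarrow> \<bar>?M y $ i $ j\<bar> \<le> b i j"
    by metis
  have "\<bar>?M y $ i $ j\<bar> \<le> (\<Sum>i\<in>UNIV. \<Sum>j\<in>UNIV. \<bar>b i j\<bar>)" if "y \<in> C" for y i j
  proof -
    have "\<bar>?M y $ i $ j\<bar> \<le> \<bar>b i j\<bar>" using b[OF that, of i j] by linarith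
    also have "\<dots> \<le> (\<Sum>j\<in>UNIV. \<bar>b i j\<bar>)" by (rule member_le_sum) auto
    also have "\<dots> \<le> (\<Sum>i\<in>UNIV. \<Sum>j\<in>UNIV. \<bar>b i j\<bar>)"
      by (rule member_le_sum[where f = "\<lambda>i. \<Sum>j\<in>UNIV. \<bar>b i j\<bar>"]) (auto intro: sum_nonneg)
    finally show ?thesis .
  qed
  moreover have "y \<in> C" if "y \<in> patch_cball t" "chart_inv ?c y \<in> patch_set s" for y
    using that by (simp add: C_def)
  ultimately show ?thesis by blast
qed

text \<open>The patches are fixed while the weights will vary with \<epsilon>. The bound depends on
  the patches only, provided that the weights stay below 2.\<close>

lemma patch_metric_bounded:
  assumes "finite I" "\<And>t. t \<in> I \<Longrightarrow> valid_patch t"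
  shows "\<exists>B\<ge>0. \<forall>\<phi>. bump_family I \<phi> \<and> (\<forall>t\<in>I. \<forall>y. \<phi> t y \<le> 2) \<longrightarrow>
    (\<forall>t\<in>I. \<forall>y\<in>patch_cball t. \<forall>i j. \<bar>patch_metric I \<phi> (patch_chart t) (chart_inv (patch_chart t) y) $ i $ j\<bar> \<le> B)"
proof -
  have "\<forall>t\<in>I. \<forall>s\<in>I. \<exists>b. \<forall>y\<in>patch_cball t. chart_inv (patch_chart t) y \<in> patch_set s \<longrightarrow>
    (\<forall>i j. \<bar>(transpose (jac (patch_chart t) (patch_chart s) y) ** jac (patch_chart t) (patch_chart s) y) $ i $ j\<bar> \<le> b)"
    using patch_jac_bounded assms(2) by blast
  then obtain b where b: "\<And>t s y i j. t \<in> I \<Longrightarrow> s \<in> I \<Longrightarrow> y \<in> patch_cball t \<Longrightarrow> chart_inv (patch_chart t) y \<in> patch_set s \<Longrightarrow>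
    \<bar>(transpose (jac (patch_chart t) (patch_chart s) y) ** jac (patch_chart t) (patch_chart s) y) $ i $ j\<bar> \<le> b t s"
    unfolding bchoice_iff by metis
  define B where "B = (\<Sum>t\<in>I. \<Sum>s\<in>I. 2 * \<bar>b t s\<bar>)"
  have "\<bar>patch_metric I \<phi> (patch_chart t) (chart_inv (patch_chart t) y) $ i $ j\<bar> \<le> B"
    if fam: "bump_family I \<phi>" and le2: "\<forall>t\<in>I. \<forall>y. \<phi> t y \<le> 2" and t: "t \<in> I" and y: "y \<in> patch_cball t" for \<phi> t y i j
  proof -
    let ?c = "patch_chart t" let ?q = "chart_inv ?c y"
    let ?M = "\<lambda>s. transpose (jac ?c (patch_chart s) y) ** jac ?c (patch_chart s) y"
    have "snd ?c ?q = y"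
      using assms(2)[OF t] y by (intro snd_chart_inv) (auto simp: valid_patch_def)
    then have "\<bar>patch_metric I \<phi> ?c ?q $ i $ j\<bar> = \<bar>\<Sum>s\<in>I. weight \<phi> s ?q * ?M s $ i $ j\<bar>"
      by (simp add: patch_metric_def)
    also have "\<dots> \<le> (\<Sum>s\<in>I. \<bar>weight \<phi> s ?q * ?M s $ i $ j\<bar>)"
      by (rule sum_abs)
    also have "\<dots> \<le> (\<Sum>s\<in>I. 2 * \<bar>b t s\<bar>)"
    proof (rule sum_mono)
      fix s assume s: "s \<in> I"
      show "\<bar>weight \<phi> s ?q * ?M s $ i $ j\<bar> \<le> 2 * \<bar>b t s\<bar>"
      proof (cases "?q \<in> patch_set s")
        case True
        have "\<bar>weight \<phi> s ?q\<bar> \<le> 2"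
          using le2 s weight_nonneg[OF fam s, of ?q] by (auto simp: weight_def)
        moreover have "\<bar>?M s $ i $ j\<bar> \<le> \<bar>b t s\<bar>"
          using b[OF t s y True, of i j] by linarith
        ultimately show ?thesis
          unfolding abs_mult by (intro mult_mono) auto
      next
        case False
        then show ?thesis by (simp add: weight_eq_0[OF fam s])
      qed
    qed
    also have "\<dots> \<le> B"
      unfolding B_def using t assms(1) by (intro member_le_sum[where f = "\<lambda>t. \<Sum>s\<in>I. 2 * \<bar>b t s\<bar>"]) (auto intro: sum_nonneg)
    finally show ?thesis .
  qed
  moreover have "B \<ge> 0" by (auto simp: B_def intro!: sum_nonneg)
  ultimately show ?thesis by blast
qed

text \<open>Upper volume bound uniform in the weights, hence in \<epsilon>: the determinant is
  bounded through the entries of the metric, and the finitely many patch sets cover the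
  manifold.\<close>

lemma patch_volume_bounded:
  assumes "finite I" "\<And>t. t \<in> I \<Longrightarrow> valid_patch t"
  shows "\<exists>C. \<forall>\<phi>. bump_family I \<phi> \<and> (\<forall>t\<in>I. \<forall>y. \<phi> t y \<le> 2) \<longrightarrow>
    emeasure (RV (patch_metric I \<phi>)) (topspace T) \<le> ennreal C"
proof -
  obtain B where B: "B \<ge> 0" "\<And>\<phi> t y i j. bump_family I \<phi> \<Longrightarrow> (\<forall>t\<in>I. \<forall>y. \<phi> t y \<le> 2) \<Longrightarrow> t \<in> I \<Longrightarrow> y \<in> patch_cball t \<Longrightarrow>
      \<bar>patch_metric I \<phi> (patch_chart t) (chart_inv (patch_chart t) y) $ i $ j\<bar> \<le> B"
    using patch_metric_bounded[OF assms] by blast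
  define D where "D = sqrt ((real CARD('m) * B) ^ CARD('m))"
  have D: "D \<ge> 0" using B by (simp add: D_def)
  have "emeasure (RV (patch_metric I \<phi>)) (topspace T) \<le> ennreal (\<Sum>t\<in>I. D * measure lborel (patch_cball t))"
    if fam: "bump_family I \<phi>" and le2: "\<forall>t\<in>I. \<forall>y. \<phi> t y \<le> 2" for \<phi>
  proof -
    let ?g = "patch_metric I \<phi>"
    have g: "riemannian_metric A ?g" by (rule riemannian_patch_metric[OF fam])
    have Q: "patch_set t \<in> sets BT" if "t \<in> I" for t
      using closedin_sets[OF patch_set_closed] assms(2) that by blast
    have "(\<Union>t\<in>I. patch_set t) = topspace T"
    proof
      show "topspace T \<subseteq> (\<Union>t\<in>I. patch_set t)"
      proof
        fix q assume "q \<in> topspace T"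
        then obtain t where "t \<in> I" "q \<in> fst (patch_chart t)" "snd (patch_chart t) q \<in> patch_ball t"
          using fam unfolding bump_family_def by blast
        then show "q \<in> (\<Union>t\<in>I. patch_set t)"
          using in_patch_set_iff[OF assms(2), of t q] by auto
      qed
      show "(\<Union>t\<in>I. patch_set t) \<subseteq> topspace T"
        using closedin_subset[OF patch_set_closed[OF assms(2)]] by blast
    qed
    then have "emeasure (RV ?g) (topspace T) \<le> (\<Sum>t\<in>I. emeasure (chart_volume T ?g (patch_chart t)) (topspace T \<inter> patch_set t))"
      using assms Q by (intro emeasure_RV_le[OF g]) (auto simp: in_patch_set_iff valid_patch_def openin_sets)
    also have "\<dots> \<le> (\<Sum>t\<in>I. ennreal (D * measure lborel (patch_cball t)))"
    proof (rule sum_mono)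
      fix t assume t: "t \<in> I"
      have c: "patch_chart t \<in> A" using assms(2)[OF t] by (simp add: valid_patch_def)
      have "topspace T \<inter> patch_set t = patch_set t"
        using closedin_subset[OF patch_set_closed[OF assms(2)[OF t]]] by blast
      then have "emeasure (chart_volume T ?g (patch_chart t)) (topspace T \<inter> patch_set t) =
        (\<integral>\<^sup>+y. indicator (chart_image (patch_chart t)) y * (ennreal (vol_density ?g (patch_chart t) y)
            * indicator (patch_set t) (chart_inv (patch_chart t) y)) \<partial>lborel)"
        by (simp add: emeasure_chart_volume[OF g c Q[OF t]])
      also have "\<dots> \<le> (\<integral>\<^sup>+y. ennreal D * indicator (patch_cball t) y \<partial>lborel)"
      proof (rule nn_integral_mono)
        fix y
        show "indicator (chart_image (patch_chart t)) y * (ennreal (vol_density ?g (patch_chart t) y)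
            * indicator (patch_set t) (chart_inv (patch_chart t) y)) \<le> ennreal D * indicator (patch_cball t) y"
        proof (cases "y \<in> chart_image (patch_chart t) \<and> chart_inv (patch_chart t) y \<in> patch_set t")
          case True
          then have y: "y \<in> patch_cball t"
            using in_patch_set_iff[OF assms(2)[OF t]] snd_chart_inv[of y "patch_chart t"] by simp
          let ?M = "?g (patch_chart t) (chart_inv (patch_chart t) y)"
          have "det ?M \<le> \<bar>det ?M\<bar>" by simp
          also have "\<dots> \<le> (\<Prod>a\<in>UNIV. \<Sum>b\<in>UNIV. \<bar>?M $ a $ b\<bar>)" by (rule abs_det_le)
          also have "\<dots> \<le> (\<Prod>a\<in>(UNIV :: 'm set). \<Sum>b\<in>(UNIV :: 'm set). B)"
            by (intro prod_mono conjI sum_nonneg sum_mono B(2)[OF fam le2 t y]) auto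
          finally have "vol_density ?g (patch_chart t) y \<le> D"
            by (simp add: vol_density_def D_def)
          then show ?thesis using True y by (simp add: ennreal_leI)
        qed auto
      qed
      also have "\<dots> = ennreal (D * measure lborel (patch_cball t))"
        using D emeasure_bounded_finite[of "patch_cball t"]
        by (subst nn_integral_cmult_indicator) (auto simp: ennreal_mult emeasure_eq_ennreal_measure)
      finally show "emeasure (chart_volume T ?g (patch_chart t)) (topspace T \<inter> patch_set t) \<le> ennreal (D * measure lborel (patch_cball t))" .
    qed
    also have "\<dots> = ennreal (\<Sum>t\<in>I. D * measure lborel (patch_cball t))"
      using D by (intro sum_ennreal) auto
    finally show ?thesis .
  qed
  then show ?thesis by blast
qed

end

section \<open>Isometric immersions\<close>

lemma eucl_norm_L2: "eucl_norm N v = L2_set v {..<N}"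
  by (simp add: eucl_norm_def eucl_inner_def L2_set_def power2_eq_square)

lemma eucl_norm_nonneg: "0 \<le> eucl_norm N v"
  by (simp add: eucl_norm_L2)

lemma eucl_norm_square: "(eucl_norm N v)\<^sup>2 = eucl_inner N v v"
  unfolding eucl_norm_def eucl_inner_def by (rule real_sqrt_pow2) (auto intro: sum_nonneg)

lemma abs_eucl_inner_le: "\<bar>eucl_inner N v w\<bar> \<le> eucl_norm N v * eucl_norm N w"
  unfolding eucl_norm_L2 eucl_inner_def
  by (rule order_trans[OF sum_abs]) (simp add: abs_mult L2_set_mult_ineq)

lemma eucl_norm_triangle: "eucl_norm N (\<lambda>j. v j + w j) \<le> eucl_norm N v + eucl_norm N w"
  unfolding eucl_norm_L2 by (rule L2_set_triangle_ineq)

lemma eucl_inner_commute: "eucl_inner N v w = eucl_inner N w v"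
  by (simp add: eucl_inner_def mult.commute)

lemma eucl_inner_sum_left: "eucl_inner N (\<lambda>j. \<Sum>i\<in>I. f i j) w = (\<Sum>i\<in>I. eucl_inner N (f i) w)"
  unfolding eucl_inner_def by (simp add: sum_distrib_right) (rule sum.swap)

lemma eucl_inner_mult_left: "eucl_inner N (\<lambda>j. a * v j) w = a * eucl_inner N v w"
  by (simp add: eucl_inner_def sum_distrib_left mult.assoc)

locale immersed = compact_manifold T A
  for T :: "'a topology" and A :: "('a, 'm::finite) chart set" +
  fixes g :: "('a, 'm) chart \<Rightarrow> 'a \<Rightarrow> real^'m^'m" and N :: nat and X :: "'a \<Rightarrow> nat \<Rightarrow> real"
  assumes metric: "riemannian_metric A g" and iso: "isometric_immersion T A g N X"
begin

lemma X_in_E: "q \<in> topspace T \<Longrightarrow> X q \<in> E N"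
  using iso by (auto simp: isometric_immersion_def C2_immersion_def)

lemma Ck_local_rep: "c \<in> A \<Longrightarrow> Ck_on 2 (chart_image c) (local_rep c X j)"
proof (cases "j < N")
  case False
  assume c: "c \<in> A"
  have "local_rep c X j y = 0" if "y \<in> chart_image c" for y
    using X_in_E[OF chart_inv_in_space[OF c that]] False by (simp add: local_rep_def in_E_iff)
  then show ?thesis
    using Ck_on_cong[OF open_chart_image[OF c], of "local_rep c X j" "\<lambda>_. 0"] by (simp add: Ck_on_const)
qed (use iso in \<open>auto simp: isometric_immersion_def C2_immersion_def\<close>)

lemma differentiable_local_rep: "c \<in> A \<Longrightarrow> y \<in> chart_image c \<Longrightarrow> local_rep c X j differentiable (at y)"
  using Ck_local_rep[of c j] by (simp add: numeral_2_eq_2)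

lemma Ck_pd_local_rep: "c \<in> A \<Longrightarrow> Ck_on 1 (chart_image c) (pd i (local_rep c X j))"
  using Ck_local_rep[of c j] by (simp add: numeral_2_eq_2)

lemma differential_eq:
  "c \<in> A \<Longrightarrow> q \<in> fst c \<Longrightarrow> differential c X q v = (\<lambda>j. \<Sum>i\<in>UNIV. v $ i * pd i (local_rep c X j) (snd c q))"
  unfolding differential_def
  by (rule ext) (rule frechet_derivative_pd, rule differentiable_local_rep, simp_all add: snd_in_image)

lemma differential_axis:
  "c \<in> A \<Longrightarrow> q \<in> fst c \<Longrightarrow> differential c X q (axis i 1) = (\<lambda>j. pd i (local_rep c X j) (snd c q))"
  by (simp add: differential_eq sum_axis_mult)

lemma inner_differential:
  "c \<in> A \<Longrightarrow> q \<in> fst c \<Longrightarrow> eucl_inner N (differential c X q u) (differential c X q v) = u \<bullet> (g c q *v v)"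
  using iso by (auto simp: isometric_immersion_def)

lemma differential_in_E: "c \<in> A \<Longrightarrow> q \<in> fst c \<Longrightarrow> differential c X q v \<in> E N"
proof -
  assume c: "c \<in> A" and q: "q \<in> fst c"
  have "pd i (local_rep c X j) (snd c q) = 0" if "j \<ge> N" for i j
  proof -
    have "pd i (local_rep c X j) (snd c q) = pd i (\<lambda>_. 0) (snd c q)"
      by (rule pd_cong[OF open_chart_image[OF c] snd_in_image[OF q]])
         (use that X_in_E[OF chart_inv_in_space[OF c]] in \<open>auto simp: local_rep_def in_E_iff\<close>)
    then show ?thesis by (simp add: pd_eqI[OF has_derivative_const])
  qed
  then show ?thesis
    by (simp add: in_E_iff differential_eq[OF c q])
qed

lemma local_rep_transition:
  assumes "c \<in> A" "d \<in> A" "y \<in> dom c d"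
  shows "local_rep c X j y = local_rep d X j (transition c d y)"
  using chart_inv_transition[OF assms(2,3)] by (simp add: local_rep_def)

lemma pd_local_rep_change:
  assumes "c \<in> A" "d \<in> A" "y \<in> dom c d"
  shows "pd i (local_rep c X j) y = (\<Sum>a\<in>UNIV. pd a (local_rep d X j) (transition c d y) * jac c d y $ a $ i)"
proof -
  have "pd i (local_rep c X j) y = pd i (\<lambda>y. local_rep d X j (transition c d y)) y"
    by (rule pd_cong[OF open_dom[OF assms(1,2)] assms(3)]) (rule local_rep_transition[OF assms(1,2)])
  also have "\<dots> = (\<Sum>a\<in>UNIV. pd a (local_rep d X j) (transition c d y) * pd i (\<lambda>y. transition c d y $ a) y)"
  proof (rule pd_compose(2))
    show "local_rep d X j differentiable at (transition c d y)"
      by (rule differentiable_local_rep[OF assms(2) transition_in[OF assms(2,3)]])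
    show "(\<lambda>y. transition c d y $ a) differentiable at y" for a
      using Ck_transition[OF assms(1,2), of 1 a] assms(3) by simp
  qed
  finally show ?thesis
    by (simp add: jac_nth[OF assms])
qed

lemma differential_change:
  assumes "c \<in> A" "d \<in> A" "q \<in> fst c" "q \<in> fst d"
  shows "differential c X q v = differential d X q (jac c d (snd c q) *v v)"
proof -
  have "transition c d (snd c q) = snd d q"
    using assms by (simp add: transition_def chart_inv_snd)
  then have "(\<Sum>i\<in>UNIV. v $ i * pd i (local_rep c X j) (snd c q)) =
      (\<Sum>i\<in>UNIV. \<Sum>a\<in>UNIV. v $ i * (pd a (local_rep d X j) (snd d q) * jac c d (snd c q) $ a $ i))" for j
    using pd_local_rep_change[OF assms(1,2) snd_in_dom[OF assms(1,3,4)]] by (simp add: sum_distrib_left)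
  also have "\<dots> j = (\<Sum>a\<in>UNIV. (jac c d (snd c q) *v v) $ a * pd a (local_rep d X j) (snd d q))" for j
    by (subst sum.swap) (simp add: matrix_vector_mult_def sum_distrib_left sum_distrib_right mult_ac)
  finally show ?thesis
    using assms by (simp add: differential_eq)
qed

text \<open>Instead of a length of curves, the mean value theorem is applied to the scalar product
  of \<open>X\<close> along the segment with the total displacement \<open>w\<close>; the
  Cauchy-Schwarz inequality then allows division by the norm of \<open>w\<close>.\<close>

lemma distance_le_segment:
  assumes c: "c \<in> A" and seg: "\<And>t. 0 \<le> t \<Longrightarrow> t \<le> 1 \<Longrightarrow> y + t *\<^sub>R v \<in> chart_image c"
    and L: "\<And>t. 0 \<le> t \<Longrightarrow> t \<le> 1 \<Longrightarrow> eucl_norm N (differential c X (chart_inv c (y + t *\<^sub>R v)) v) \<le> L"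
  shows "eucl_norm N (\<lambda>j. X (chart_inv c (y + v)) j - X (chart_inv c y) j) \<le> L"
proof -
  define w where "w j = X (chart_inv c (y + v)) j - X (chart_inv c y) j" for j
  define h where "h t = (\<Sum>j<N. w j * local_rep c X j (y + t *\<^sub>R v))" for t
  have line: "((\<lambda>t. local_rep c X j (y + t *\<^sub>R v)) has_real_derivative
      differential c X (chart_inv c (y + t *\<^sub>R v)) v j) (at t)" if "0 \<le> t" "t \<le> 1" for t j
  proof -
    have lin: "((\<lambda>t. y + t *\<^sub>R v) has_derivative (\<lambda>s. s *\<^sub>R v)) (at t)"
      by (auto intro!: derivative_eq_intros)
    have "((\<lambda>t. local_rep c X j (y + t *\<^sub>R v)) has_derivative
        (\<lambda>s. \<Sum>i\<in>UNIV. (s *\<^sub>R v) $ i * pd i (local_rep c X j) (y + t *\<^sub>R v))) (at t)"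
      by (rule has_derivative_compose[OF lin has_derivative_pd[OF differentiable_local_rep[OF c seg[OF that]]]])
    moreover have "(\<lambda>s. \<Sum>i\<in>UNIV. (s *\<^sub>R v) $ i * pd i (local_rep c X j) (y + t *\<^sub>R v)) =
        (*) (differential c X (chart_inv c (y + t *\<^sub>R v)) v j)"
      using seg[OF that] c
      by (simp add: fun_eq_iff differential_eq chart_inv_in snd_chart_inv sum_distrib_left mult_ac)
    ultimately show ?thesis by (simp add: has_field_derivative_def)
  qed
  have der: "(h has_real_derivative eucl_inner N w (differential c X (chart_inv c (y + t *\<^sub>R v)) v)) (at t)"
    if "0 \<le> t" "t \<le> 1" for t
    unfolding h_def eucl_inner_def by (intro DERIV_sum DERIV_cmult line that)
  obtain t where t: "0 < t" "t < 1" "h 1 - h 0 = (1 - 0) * eucl_inner N w (differential c X (chart_inv c (y + t *\<^sub>R v)) v)"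
    using MVT2[of 0 1 h "\<lambda>t. eucl_inner N w (differential c X (chart_inv c (y + t *\<^sub>R v)) v)"] der by auto
  have "(eucl_norm N w)\<^sup>2 = h 1 - h 0"
    by (simp add: eucl_norm_square h_def eucl_inner_def local_rep_def w_def algebra_simps flip: sum_subtractf)
  also have "\<dots> \<le> eucl_norm N w * eucl_norm N (differential c X (chart_inv c (y + t *\<^sub>R v)) v)"
    using t(3) abs_eucl_inner_le[of N w "differential c X (chart_inv c (y + t *\<^sub>R v)) v"] by simp
  also have "\<dots> \<le> eucl_norm N w * L"
    using t by (intro mult_left_mono L eucl_norm_nonneg) auto
  finally have "eucl_norm N w * eucl_norm N w \<le> eucl_norm N w * L"
    by (simp add: power2_eq_square)
  moreover have "0 \<le> L"
    using order_trans[OF eucl_norm_nonneg L[of 0]] by simp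
  ultimately have "eucl_norm N w \<le> L"
    using eucl_norm_nonneg[of N w] by (cases "eucl_norm N w = 0") (auto simp: mult_le_cancel_left)
  then show ?thesis
    by (simp add: w_def[abs_def])
qed

end

context compact_manifold
begin

text \<open>The atlas may be uncountable, but the exceptional values collected over its charts have
  to form a null set.\<close>

lemma finite_subatlas: "\<exists>A0\<subseteq>A. finite A0 \<and> topspace T = (\<Union>c\<in>A0. fst c)"
proof -
  have "\<exists>\<F>. finite \<F> \<and> \<F> \<subseteq> fst ` A \<and> topspace T \<subseteq> \<Union>\<F>"
  proof (rule compact[unfolded compact_space_alt, THEN spec, THEN mp], intro conjI ballI)
    show "openin T U" if "U \<in> fst ` A" for U using that openin_chart by auto
    show "topspace T \<subseteq> \<Union>(fst ` A)" using charts_cover by simp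
  qed
  then obtain \<F> where F: "finite \<F>" "\<F> \<subseteq> fst ` A" "topspace T \<subseteq> \<Union>\<F>" by blast
  obtain A0 where "A0 \<subseteq> A" "finite A0" "\<F> = fst ` A0"
    using finite_subset_image[OF F(1,2)] by blast
  moreover from this have "(\<Union>c\<in>A0. fst c) \<subseteq> topspace T"
    using chart_subset by blast
  ultimately show ?thesis
    using F(3) by (intro exI[of _ A0]) auto
qed

end

context immersed
begin

section \<open>Planes meeting the submanifold many times\<close>

definition proj_map :: "('m \<Rightarrow> nat \<Rightarrow> real) \<Rightarrow> (nat \<Rightarrow> real) \<Rightarrow> ('a, 'm) chart \<Rightarrow> real^'m \<Rightarrow> real^'m" where
  "proj_map l x0 c y = (\<chi> a. \<Sum>j<N. l a j * (local_rep c X j y - x0 j))"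

definition proj_deriv :: "('m \<Rightarrow> nat \<Rightarrow> real) \<Rightarrow> ('a, 'm) chart \<Rightarrow> real^'m \<Rightarrow> real^'m \<Rightarrow> real^'m" where
  "proj_deriv l c y v = (\<chi> a. \<Sum>j<N. l a j * differential c X (chart_inv c y) v j)"

lemma has_derivative_proj_map:
  assumes c: "c \<in> A" and y: "y \<in> chart_image c"
  shows "(proj_map l x0 c has_derivative proj_deriv l c y) (at y)"
proof (rule has_derivative_vec)
  fix a
  have "(local_rep c X j has_derivative (\<lambda>v. differential c X (chart_inv c y) v j)) (at y)" for j
    using differentiable_local_rep[OF c y, of j] y
    by (simp add: differential_def snd_chart_inv frechet_derivative_works)
  then have "((\<lambda>y. \<Sum>j<N. l a j * (local_rep c X j y - x0 j)) has_derivative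
      (\<lambda>v. \<Sum>j<N. l a j * (differential c X (chart_inv c y) v j - 0))) (at y)"
    by (intro has_derivative_sum has_derivative_mult_right has_derivative_diff has_derivative_const)
  then show "((\<lambda>y. proj_map l x0 c y $ a) has_derivative (\<lambda>v. proj_deriv l c y v $ a)) (at y)"
    by (simp add: proj_map_def proj_deriv_def)
qed

lemma matrix_proj_deriv:
  assumes c: "c \<in> A" and y: "y \<in> chart_image c"
  shows "matrix (proj_deriv l c y) $ a $ i = (\<Sum>j<N. l a j * pd i (local_rep c X j) y)"
  using differential_axis[OF c chart_inv_in[OF y]] y by (simp add: matrix_def proj_deriv_def snd_chart_inv)

lemma continuous_matrix_proj_deriv:
  assumes c: "c \<in> A"
  shows "continuous_on (chart_image c) (\<lambda>y. matrix (proj_deriv l c y) $ a $ i)"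
proof -
  have "continuous_on (chart_image c) (\<lambda>y. \<Sum>j<N. l a j * pd i (local_rep c X j) y)"
    by (intro continuous_intros Ck_on_imp_continuous_on[OF Ck_pd_local_rep[OF c]])
  then show ?thesis
    using matrix_proj_deriv[OF c] by (simp cong: continuous_on_cong)
qed

text \<open>Divided by \<open>sqrt \<phi>\<close>, the coordinate derivatives of \<open>X\<close>
  are orthonormal, so the sign vectors read in this frame are isotropic; undoing the division gives
  the power of \<open>sqrt \<phi>\<close>. The radius \<open>R\<close> turns the hypothesis of the
  truncation bound into an equality when the distance to \<open>x0\<close> is
  \<open>D\<close>.\<close>

lemma sum_matrix_proj_deriv_ge:
  fixes e :: "nat \<Rightarrow> nat \<Rightarrow> real"
  assumes e2: "\<And>a b. (\<Sum>i<n. (\<Sum>j<N. e i j * a j) * (\<Sum>j<N. e i j * b j)) = real n * (\<Sum>j<N. a j * b j)"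
    and e4: "\<And>a. (\<Sum>i<n. (\<Sum>j<N. e i j * a j) ^ 4) \<le> 3 * real n * (\<Sum>j<N. (a j)\<^sup>2)\<^sup>2"
    and c: "c \<in> A" and y: "y \<in> chart_image c"
    and conf: "g c (chart_inv c y) = \<phi> *\<^sub>R mat 1" "\<phi> > 0"
    and D: "eucl_norm N (\<lambda>j. X (chart_inv c y) j - x0 j) \<le> D" "D > 0"
    and R: "R = sqrt (real CARD('m)) * D / proj_const TYPE('m)"
  shows "real n ^ CARD('m) * (proj_const TYPE('m) / 4) * sqrt \<phi> ^ CARD('m) \<le>
    (\<Sum>\<gamma>\<in>choices n. if proj_map (\<lambda>a. e (\<gamma> a)) x0 c y \<in> cball 0 R
       then \<bar>det (matrix (proj_deriv (\<lambda>a. e (\<gamma> a)) c y))\<bar> else 0)"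
proof -
  define \<rho> where "\<rho> = sqrt \<phi>"
  have \<rho>: "\<rho> > 0" "\<rho> * \<rho> = \<phi>" using conf(2) by (simp_all add: \<rho>_def)
  let ?p = "\<lambda>i j. pd i (local_rep c X j) y"
  define r where "r i = (\<chi> b. \<Sum>j<N. e i j * (?p b j / \<rho>))" for i :: nat
  define w where "w i = (\<Sum>j<N. e i j * (local_rep c X j y - x0 j))" for i
  have gram: "(\<Sum>j<N. ?p b j * ?p d j) = (if b = d then \<phi> else 0)" for b d
    using inner_differential[OF c chart_inv_in[OF y], of "axis b 1" "axis d 1"] y
    by (simp add: differential_axis[OF c chart_inv_in[OF y]] snd_chart_inv eucl_inner_def conf
        inner_axis_axis flip: scaleR_matrix_vector_assoc)
  have orth: "(\<Sum>j<N. ?p b j / \<rho> * (?p d j / \<rho>)) = (if b = d then 1 else 0)" for b d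
  proof -
    have "(\<Sum>j<N. ?p b j / \<rho> * (?p d j / \<rho>)) = (\<Sum>j<N. ?p b j * ?p d j) / (\<rho> * \<rho>)"
      by (simp add: sum_divide_distrib)
    then show ?thesis using \<rho> conf(2) by (simp add: gram)
  qed
  have iso: "(\<Sum>i<n. r i $ b * r i $ d) = (if b = d then real n else 0)" for b d
    unfolding r_def vec_lambda_beta e2 orth by simp
  have fourth: "(\<Sum>i<n. (r i $ b) ^ 4) \<le> 3 * real n" for b
    using e4[of "\<lambda>j. ?p b j / \<rho>"] orth[of b b] by (simp add: r_def power2_eq_square)
  define s where "s = (\<Sum>j<N. (local_rep c X j y - x0 j) * (local_rep c X j y - x0 j))"
  have w: "(\<Sum>i<n. (w i)\<^sup>2) = real n * s"
    by (simp add: w_def power2_eq_square e2 s_def)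
  have "s = (eucl_norm N (\<lambda>j. X (chart_inv c y) j - x0 j))\<^sup>2"
    by (simp add: s_def eucl_norm_square eucl_inner_def local_rep_def)
  then have "s \<le> D\<^sup>2"
    using D(1) eucl_norm_nonneg by (simp add: power_mono)
  then have sR: "real CARD('m) * s \<le> (proj_const TYPE('m))\<^sup>2 * R\<^sup>2"
    using proj_const_pos[where ?'m = 'm] by (simp add: R power_divide power_mult_distrib)
  have Rpos: "R > 0"
    using proj_const_pos[where ?'m = 'm] D(2) by (simp add: R)
  have mat: "matrix (proj_deriv (\<lambda>a. e (\<gamma> a)) c y) = \<rho> *\<^sub>R (\<chi> a. r (\<gamma> a))" for \<gamma>
    using \<rho> by (simp add: vec_eq_iff matrix_proj_deriv[OF c y] r_def sum_distrib_left)
  have inball: "proj_map (\<lambda>a. e (\<gamma> a)) x0 c y \<in> cball 0 R \<longleftrightarrow> (\<Sum>a\<in>UNIV. (w (\<gamma> a))\<^sup>2) \<le> R\<^sup>2" for \<gamma>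
  proof -
    have "norm (proj_map (\<lambda>a. e (\<gamma> a)) x0 c y) = sqrt (\<Sum>a\<in>UNIV. (w (\<gamma> a))\<^sup>2)"
      by (simp add: norm_vec_def L2_set_def proj_map_def w_def)
    then show ?thesis
      using Rpos real_sqrt_le_iff[of "\<Sum>a\<in>UNIV. (w (\<gamma> a))\<^sup>2" "R\<^sup>2"] by simp
  qed
  have "real n ^ CARD('m) * (proj_const TYPE('m) / 4) * \<rho> ^ CARD('m) \<le>
      (\<Sum>\<gamma>\<in>choices n. if (\<Sum>a\<in>(UNIV :: 'm set). (w (\<gamma> a))\<^sup>2) \<le> R\<^sup>2 then \<bar>det (\<chi> a. r (\<gamma> a))\<bar> else 0) * \<rho> ^ CARD('m)"
    using \<rho> by (intro mult_right_mono sum_truncated_det_ge[OF iso fourth w Rpos sR]) auto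
  also have "\<dots> = (\<Sum>\<gamma>\<in>choices n. if proj_map (\<lambda>a. e (\<gamma> a)) x0 c y \<in> cball 0 R
       then \<bar>det (matrix (proj_deriv (\<lambda>a. e (\<gamma> a)) c y))\<bar> else 0)"
    unfolding sum_distrib_right inball mat det_scaleR using \<rho> by (intro sum.cong) (auto simp: abs_mult)
  finally show ?thesis
    by (simp add: \<rho>_def)
qed

definition critical_values :: "('m \<Rightarrow> nat \<Rightarrow> real) \<Rightarrow> (nat \<Rightarrow> real) \<Rightarrow> ('a, 'm) chart \<Rightarrow> (real^'m) set" where
  "critical_values l x0 c = proj_map l x0 c ` {y \<in> chart_image c. det (matrix (proj_deriv l c y)) = 0}"

lemma critical_values_null: "c \<in> A \<Longrightarrow> critical_values l x0 c \<in> null_sets lebesgue"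
  unfolding critical_values_def by (rule negligible_singular_image[OF has_derivative_proj_map]) auto

text \<open>Averaging over the projections: if every regular value of every projection had at most
  \<open>K\<close> preimages in \<open>W\<close>, each Jacobian integral over the preimage of the
  ball would be at most \<open>K\<close> times its volume, and their sum over
  \<open>choices n\<close> would stay below the integrated pointwise bound.\<close>

lemma ex_crowded_value:
  assumes c: "c \<in> A" and W: "open W" "W \<subseteq> chart_image c"
    and conf: "\<And>y. y \<in> W \<Longrightarrow> g c (chart_inv c y) = \<phi> y *\<^sub>R mat 1" "\<And>y. y \<in> W \<Longrightarrow> \<phi> y > 0"
    and D: "\<And>y. y \<in> W \<Longrightarrow> eucl_norm N (\<lambda>j. X (chart_inv c y) j - x0 j) \<le> D" "D > 0"
    and R: "R = sqrt (real CARD('m)) * D / proj_const TYPE('m)"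
    and \<phi>: "(\<lambda>y. indicator W y * sqrt (\<phi> y) ^ CARD('m)) \<in> borel_measurable borel"
    and v: "ennreal v \<le> (\<integral>\<^sup>+y. ennreal (indicator W y * sqrt (\<phi> y) ^ CARD('m)) \<partial>lborel)" "v \<ge> 0"
    and big: "real K * measure lborel (cball (0 :: real^'m) R) < proj_const TYPE('m) / 4 * v"
    and A0: "finite A0" "A0 \<subseteq> A"
  shows "\<exists>l z F. z \<notin> (\<Union>d\<in>A0. critical_values l x0 d) \<and> finite F \<and> F \<subseteq> {y \<in> W. proj_map l x0 c y = z} \<and> K < card F"
proof (rule ccontr)
  assume contra: "\<not> ?thesis"
  obtain n e where n: "n > 0"
    and e2: "\<And>a b. (\<Sum>i<n. (\<Sum>j<N. e i j * a j) * (\<Sum>j<N. e i j * b j)) = real n * (\<Sum>j<N. a j * b j)"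
    and e4: "\<And>a. (\<Sum>i<n. (\<Sum>j<N. e i j * a j) ^ 4) \<le> 3 * real n * (\<Sum>j<N. (a j)\<^sup>2)\<^sup>2"
    using ex_rademacher[of N] by blast
  let ?B = "cball (0 :: real^'m) R" and ?n = "real n ^ CARD('m)" and ?t = "proj_const TYPE('m) / 4"
  let ?f = "\<lambda>\<gamma>. proj_map (\<lambda>a. e (\<gamma> a)) x0 c" and ?f' = "\<lambda>\<gamma>. proj_deriv (\<lambda>a. e (\<gamma> a)) c"
  let ?h = "\<lambda>\<gamma> y. indicator {y \<in> W. ?f \<gamma> y \<in> ?B} y * \<bar>det (matrix (?f' \<gamma> y))\<bar>"
  have t: "?t > 0" using proj_const_pos[where ?'m = 'm] by simp
  have vol: "emeasure lborel ?B = ennreal (measure lborel ?B)"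
    using emeasure_bounded_finite[of ?B] by (intro emeasure_eq_ennreal_measure) auto
  have few: "(\<integral>\<^sup>+y. ennreal (?h \<gamma> y) \<partial>lborel) \<le> of_nat K * emeasure lborel ?B" for \<gamma>
  \<comment> \<open>Critical values are discarded for all charts of \<open>A0\<close>, although
    preimages are counted in \<open>W\<close> only: the plane has to be transverse to the whole
    submanifold.\<close>
  proof (rule nn_integral_jacobian_le_multiplicity[OF W(1), where Z = "\<Union>d\<in>A0. critical_values (\<lambda>a. e (\<gamma> a)) x0 d"])
    show "(?f \<gamma> has_derivative ?f' \<gamma> y) (at y)" if "y \<in> W" for y
      using that W(2) by (intro has_derivative_proj_map c) auto
    show "continuous_on W (\<lambda>y. matrix (?f' \<gamma> y) $ i $ j)" for i j
      by (rule continuous_on_subset[OF continuous_matrix_proj_deriv[OF c] W(2)])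
    show "(\<Union>d\<in>A0. critical_values (\<lambda>a. e (\<gamma> a)) x0 d) \<in> null_sets lebesgue"
      using A0 by (intro null_sets.finite_UN critical_values_null) auto
    show "card F \<le> K" if "z \<in> ?B - (\<Union>d\<in>A0. critical_values (\<lambda>a. e (\<gamma> a)) x0 d)" "finite F" "F \<subseteq> {y \<in> W. ?f \<gamma> y = z}" for z F
      using contra that by (meson DiffD2 not_le)
  qed simp
  have contf: "continuous_on W (?f \<gamma>)" for \<gamma>
    using has_derivative_continuous[OF has_derivative_proj_map[OF c]] W(2)
    by (intro continuous_at_imp_continuous_on) auto
  have meas: "(\<lambda>y. ?h \<gamma> y) \<in> borel_measurable borel" for \<gamma>
  proof -
    have "?f \<gamma> -` ?B \<inter> W \<in> sets borel"
      using measurable_sets[OF borel_measurable_continuous_on_restrict[OF contf], of ?B \<gamma>] W(1)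
      by (simp add: space_restrict_space sets_restrict_space_iff)
    moreover have "{y \<in> W. ?f \<gamma> y \<in> ?B} = ?f \<gamma> -` ?B \<inter> W" by auto
    ultimately have S: "{y \<in> W. ?f \<gamma> y \<in> ?B} \<in> sets borel" by (simp only:)
    have "continuous_on W (\<lambda>y. det (matrix (?f' \<gamma> y)))"
      by (intro continuous_on_det continuous_on_subset[OF continuous_matrix_proj_deriv[OF c] W(2)])
    then have "continuous_on {y \<in> W. ?f \<gamma> y \<in> ?B} (\<lambda>y. \<bar>det (matrix (?f' \<gamma> y))\<bar>)"
      by (intro continuous_intros) (auto intro: continuous_on_subset)
    from borel_measurable_continuous_on_indicator[OF S this] show ?thesis by simp
  qed
  have "ennreal (?n * ?t) * ennreal v \<le> ennreal (?n * ?t) * (\<integral>\<^sup>+y. ennreal (indicator W y * sqrt (\<phi> y) ^ CARD('m)) \<partial>lborel)"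
    by (intro mult_left_mono v) simp
  also have "\<dots> = (\<integral>\<^sup>+y. ennreal (?n * ?t) * ennreal (indicator W y * sqrt (\<phi> y) ^ CARD('m)) \<partial>lborel)"
    using \<phi> by (intro nn_integral_cmult[symmetric]) simp
  also have "\<dots> \<le> (\<integral>\<^sup>+y. (\<Sum>\<gamma>\<in>choices n. ennreal (?h \<gamma> y)) \<partial>lborel)"
  proof (rule nn_integral_mono)
    fix y
    show "ennreal (?n * ?t) * ennreal (indicator W y * sqrt (\<phi> y) ^ CARD('m)) \<le> (\<Sum>\<gamma>\<in>choices n. ennreal (?h \<gamma> y))"
    proof (cases "y \<in> W")
      case True
      have "?n * ?t * sqrt (\<phi> y) ^ CARD('m) \<le> (\<Sum>\<gamma>\<in>choices n. if ?f \<gamma> y \<in> ?B then \<bar>det (matrix (?f' \<gamma> y))\<bar> else 0)"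
        using True W(2) by (intro sum_matrix_proj_deriv_ge[OF e2 e4 c _ conf D R]) auto
      also have "\<dots> = (\<Sum>\<gamma>\<in>choices n. ?h \<gamma> y)"
        using True by (intro sum.cong) (auto simp: indicator_def)
      finally have le: "ennreal (?n * ?t * sqrt (\<phi> y) ^ CARD('m)) \<le> ennreal (\<Sum>\<gamma>\<in>choices n. ?h \<gamma> y)"
        by (rule ennreal_leI)
      have sum_eq: "ennreal (\<Sum>\<gamma>\<in>choices n. ?h \<gamma> y) = (\<Sum>\<gamma>\<in>choices n. ennreal (?h \<gamma> y))"
        by (rule sum_ennreal[symmetric]) simp
      have "ennreal (?n * ?t) * ennreal (indicator W y * sqrt (\<phi> y) ^ CARD('m)) = ennreal (?n * ?t * sqrt (\<phi> y) ^ CARD('m))"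
        using True t by (subst ennreal_mult'[symmetric]) auto
      with le show ?thesis
        unfolding sum_eq by (simp only:)
    qed simp
  qed
  also have "\<dots> = (\<Sum>\<gamma>\<in>choices n. \<integral>\<^sup>+y. ennreal (?h \<gamma> y) \<partial>lborel)"
    using meas by (intro nn_integral_sum) simp
  also have "\<dots> \<le> (\<Sum>\<gamma>\<in>(choices n :: ('m \<Rightarrow> nat) set). of_nat K * emeasure lborel ?B)"
    by (intro sum_mono few)
  also have "\<dots> = of_nat (card (choices n :: ('m \<Rightarrow> nat) set)) * (of_nat K * emeasure lborel ?B)"
    by simp
  also have "card (choices n :: ('m \<Rightarrow> nat) set) = n ^ CARD('m)"
    unfolding choices_def by (simp add: card_PiE)
  also have "of_nat (n ^ CARD('m)) * (of_nat K * emeasure lborel ?B) = ennreal (?n * (real K * measure lborel ?B))"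
    by (simp add: vol ennreal_mult ennreal_of_nat_eq_real_of_nat)
  finally have le: "ennreal (?n * ?t) * ennreal v \<le> ennreal (?n * (real K * measure lborel ?B))" .
  have "ennreal (?n * ?t * v) = ennreal (?n * ?t) * ennreal v"
    by (rule ennreal_mult) (use v(2) t in auto)
  with le have "ennreal (?n * ?t * v) \<le> ennreal (?n * (real K * measure lborel ?B))"
    by (simp only:)
  then have "?n * ?t * v \<le> ?n * (real K * measure lborel ?B)"
    by (subst (asm) ennreal_le_iff) auto
  then show False
    using big n by (simp add: mult.assoc)
qed

text \<open>The plane is the fibre of the projection over the crowded value. Regularity of that
  value says that the linear forms map the tangent space onto their target at every intersection
  point; this yields transversality, and, at any one intersection point, the independence of the
  forms.\<close>

lemma ex_crowded_plane:
  assumes N: "N = CARD('m) + p"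
    and c: "c \<in> A" and W: "open W" "W \<subseteq> chart_image c"
    and conf: "\<And>y. y \<in> W \<Longrightarrow> g c (chart_inv c y) = \<phi> y *\<^sub>R mat 1" "\<And>y. y \<in> W \<Longrightarrow> \<phi> y > 0"
    and D: "\<And>y. y \<in> W \<Longrightarrow> eucl_norm N (\<lambda>j. X (chart_inv c y) j - x0 j) \<le> D" "D > 0"
    and R: "R = sqrt (real CARD('m)) * D / proj_const TYPE('m)"
    and \<phi>: "(\<lambda>y. indicator W y * sqrt (\<phi> y) ^ CARD('m)) \<in> borel_measurable borel"
    and v: "ennreal v \<le> (\<integral>\<^sup>+y. ennreal (indicator W y * sqrt (\<phi> y) ^ CARD('m)) \<partial>lborel)" "v \<ge> 0"
    and big: "real K * measure lborel (cball (0 :: real^'m) R) < proj_const TYPE('m) / 4 * v"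
  shows "\<exists>P. affine_plane N p P \<and> transverse A N X P \<and> (\<exists>F. finite F \<and> F \<subseteq> {q \<in> topspace T. X q \<in> P} \<and> card F \<ge> K)"
proof -
  obtain A0 where A0: "A0 \<subseteq> A" "finite A0" "topspace T = (\<Union>c\<in>A0. fst c)"
    using finite_subatlas by blast
  obtain l z F where z: "z \<notin> (\<Union>d\<in>A0. critical_values l x0 d)"
    and F: "finite F" "F \<subseteq> {y \<in> W. proj_map l x0 c y = z}" "K < card F"
    using ex_crowded_value[OF c W conf D R \<phi> v big A0(2,1)] by blast
  define L where "L a x = (\<Sum>j<N. l a j * x j)" for a and x :: "nat \<Rightarrow> real"
  define P where "P = {x \<in> E N. \<forall>a. L a x = z $ a + L a x0}"
  have XP: "X q \<in> P \<longleftrightarrow> proj_map l x0 d (snd d q) = z" if "d \<in> A" "q \<in> fst d" for d q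
  proof -
    have "X q \<in> E N" using X_in_E chart_subset that by blast
    then have "X q \<in> P \<longleftrightarrow> (\<forall>a. L a (X q) = z $ a + L a x0)"
      by (simp add: P_def)
    also have "\<dots> \<longleftrightarrow> proj_map l x0 d (snd d q) = z"
      using that by (auto simp: vec_eq_iff proj_map_def L_def local_rep_def chart_inv_snd right_diff_distrib sum_subtractf algebra_simps)
    finally show ?thesis .
  qed
  have onto: "\<exists>v. \<forall>a. L a (differential d X q v) = w a" if d: "d \<in> A" and q: "q \<in> fst d" and "X q \<in> P" for d q w
  proof -
    obtain d' where d': "d' \<in> A0" "q \<in> fst d'"
      using A0(3) chart_subset[OF d] q by blast
    have dA: "d' \<in> A" using d' A0 by auto
    let ?y = "snd d' q"
    have y: "?y \<in> chart_image d'" "chart_inv d' ?y = q"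
      using d' dA by (simp_all add: snd_in_image chart_inv_snd)
    have "proj_map l x0 d' ?y = z"
      using XP[OF dA d'(2)] that(3) by simp
    then have "det (matrix (proj_deriv l d' ?y)) \<noteq> 0"
      using z d'(1) y(1) by (auto simp: critical_values_def)
    then have "surj ((*v) (matrix (proj_deriv l d' ?y)))"
      by (simp add: invertible_det_nz invertible_right_inverse matrix_right_invertible_surjective flip: invertible_det_nz)
    then obtain v where "matrix (proj_deriv l d' ?y) *v v = (\<chi> a. w a)"
      by (metis surjD)
    moreover have "matrix (proj_deriv l d' ?y) *v v = proj_deriv l d' ?y v"
      by (rule matrix_of_linear_mult[OF has_derivative_linear[OF has_derivative_proj_map[OF dA y(1)]]])
    ultimately have "\<forall>a. L a (differential d' X q v) = w a"
      by (auto simp: proj_deriv_def vec_eq_iff L_def y)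
    moreover have "differential d' X q v = differential d X q (jac d' d ?y *v v)"
      by (rule differential_change[OF dA d d'(2) q])
    ultimately show ?thesis by auto
  qed
  \<comment> \<open>An intersection point must exist before its differential can show that the forms
    are jointly onto and the fibre has dimension \<open>p\<close>.\<close>
  have "F \<noteq> {}" using F(3) by auto
  then obtain y0 where y0: "y0 \<in> F" by blast
  define q0 where "q0 = chart_inv c y0"
  have q0: "q0 \<in> fst c" "X q0 \<in> P"
    using y0 F(2) W(2) XP[OF c, of q0] by (auto simp: q0_def chart_inv_in snd_chart_inv subset_iff)
  have "affine_plane N p P"
    unfolding P_def L_def N
  proof (rule affine_plane_level_set)
    fix w
    obtain v where "\<forall>a. L a (differential c X q0 v) = w a"
      using onto[OF c q0] by blast
    then show "\<exists>x\<in>E (CARD('m) + p). \<forall>a. (\<Sum>j<CARD('m) + p. l a j * x j) = w a"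
      using differential_in_E[OF c q0(1), of v] by (auto simp: L_def N)
  qed
  moreover have "transverse A N X P"
    unfolding transverse_def
  proof (intro ballI impI)
    fix d q w assume d: "d \<in> A" and q: "q \<in> fst d" and XqP: "X q \<in> P" and w: "w \<in> E N"
    obtain v where v: "\<forall>a. L a (differential d X q v) = L a w"
      using onto[OF d q XqP, of "\<lambda>a. L a w"] by blast
    \<comment> \<open>After subtraction of a tangent vector with the same image under the forms,
      what is left of \<open>w\<close> lies in their common kernel, the direction of
      \<open>P\<close>.\<close>
    define k where "k j = w j - differential d X q v j" for j
    have k: "k \<in> E N" "\<And>a. L a k = 0"
      using w differential_in_E[OF d q, of v] v
      by (auto simp: k_def in_E_iff L_def right_diff_distrib sum_subtractf)
    have "(\<lambda>j. X q j + k j) \<in> P"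
      using XqP k by (auto simp: P_def in_E_iff L_def distrib_left sum.distrib)
    then have "k \<in> direction P"
      using XqP unfolding direction_def by (intro CollectI bexI[of _ "\<lambda>j. X q j + k j"] bexI[of _ "X q"]) auto
    then show "\<exists>v. \<exists>k\<in>direction P. w = (\<lambda>j. differential d X q v j + k j)"
      by (intro exI[of _ v] bexI[of _ k]) (auto simp: k_def)
  qed
  moreover have "finite (chart_inv c ` F)" "chart_inv c ` F \<subseteq> {q \<in> topspace T. X q \<in> P}" "card (chart_inv c ` F) \<ge> K"
  proof -
    show "finite (chart_inv c ` F)" using F by simp
    have FW: "y \<in> chart_image c" "proj_map l x0 c y = z" if "y \<in> F" for y
      using that F(2) W(2) by auto
    then show "chart_inv c ` F \<subseteq> {q \<in> topspace T. X q \<in> P}"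
      using XP[OF c] c by (auto simp: chart_inv_in_space chart_inv_in snd_chart_inv)
    have "inj_on (chart_inv c) F"
      by (rule inj_on_inverseI[of _ "snd c"]) (rule snd_chart_inv[OF FW(1)])
    then show "card (chart_inv c ` F) \<ge> K"
      using F(3) by (simp add: card_image)
  qed
  ultimately show ?thesis by blast
qed

end

section \<open>The mean curvature vector\<close>

lemma matrix_inv_mult:
  assumes "invertible (M :: real^'n::finite^'n)"
  shows "M ** matrix_inv M = mat 1" "matrix_inv M ** M = mat 1"
proof -
  have "M ** matrix_inv M = mat 1 \<and> matrix_inv M ** M = mat 1"
    unfolding matrix_inv_def by (rule someI_ex) (use assms in \<open>simp add: invertible_def\<close>)
  then show "M ** matrix_inv M = mat 1" "matrix_inv M ** M = mat 1" by auto
qed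

lemma matrix_inv_unique:
  assumes "(M :: real^'n::finite^'n) ** M' = mat 1"
  shows "matrix_inv M = M'"
proof -
  have "invertible M"
    using assms matrix_left_right_inverse[of M M'] by (auto simp: invertible_def)
  then have "matrix_inv M = matrix_inv M ** (M ** M')"
    by (simp add: assms)
  also have "\<dots> = M'"
    using matrix_inv_mult(2)[OF \<open>invertible M\<close>] by (simp add: matrix_mul_assoc)
  finally show ?thesis .
qed

text \<open>Cramer's rule, which makes the continuity of the inverse a consequence of the continuity
  of determinants.\<close>

lemma matrix_inv_nth:
  assumes "det (M :: real^'n::finite^'n) \<noteq> 0"
  shows "matrix_inv M $ i $ j = det (\<chi> k l. if l = i then axis j 1 $ k else M $ k $ l) / det M"
proof -
  have "M ** matrix_inv M = mat 1"
    using assms by (intro matrix_inv_mult) (simp add: invertible_det_nz)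
  then have "M *v (matrix_inv M *v axis j 1) = axis j 1"
    by (simp add: matrix_vector_mul_assoc)
  then have "matrix_inv M *v axis j 1 = (\<chi> k. det (\<chi> i l. if l = k then axis j 1 $ i else M $ i $ l) / det M)"
    using cramer[OF assms] by simp
  then have "(matrix_inv M *v axis j 1) $ i = det (\<chi> k l. if l = i then axis j 1 $ k else M $ k $ l) / det M"
    by simp
  then show ?thesis
    by (simp add: matrix_vector_mult_basis column_def)
qed

lemma continuous_on_matrix_inv:
  fixes M :: "'b::topological_space \<Rightarrow> real^'n::finite^'n"
  assumes "\<And>i j. continuous_on S (\<lambda>x. M x $ i $ j)" "\<And>x. x \<in> S \<Longrightarrow> det (M x) \<noteq> 0"
  shows "continuous_on S (\<lambda>x. matrix_inv (M x) $ i $ j)"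
proof -
  have num: "continuous_on S (\<lambda>x. (\<chi> k l. if l = i then axis j 1 $ k else M x $ k $ l) $ k $ l)" for k l
    using assms(1) by (cases "l = i") simp_all
  have "continuous_on S (\<lambda>x. det (\<chi> k l. if l = i then axis j 1 $ k else M x $ k $ l) / det (M x))"
    using continuous_on_divide[OF continuous_on_det[OF num] continuous_on_det[OF assms(1)]] assms(2) by blast
  then show ?thesis
    using matrix_inv_nth[OF assms(2)] by (simp cong: continuous_on_cong)
qed

text \<open>Two applications of the mean value theorem: in direction i to the difference of
  \<open>f\<close> in direction k, and then in direction k to the partial derivative in direction
  i.\<close>

lemma second_difference_MVT:
  fixes f :: "real^'m::finite \<Rightarrow> real"
  assumes f: "Ck_on 2 (ball y r) f" and h: "0 < h" "2 * h < r"
  obtains z where "z \<in> cball y (2 * h)"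
    "f (y + h *\<^sub>R axis i 1 + h *\<^sub>R axis k 1) - f (y + h *\<^sub>R axis i 1) - f (y + h *\<^sub>R axis k 1) + f y = h * h * pd k (pd i f) z"
proof -
  have C1: "f differentiable (at x)" "pd i f differentiable (at x)" if "x \<in> ball y r" for x
    using f that by (simp_all add: numeral_2_eq_2)
  have line: "((\<lambda>t. F (x + t *\<^sub>R axis l 1)) has_real_derivative pd l F (x + t *\<^sub>R axis l 1)) (at t)"
    if "F differentiable (at (x + t *\<^sub>R axis l 1))" for F :: "real^'m \<Rightarrow> real" and x t l
  proof -
    have "((\<lambda>t. x + t *\<^sub>R axis l 1) has_derivative (\<lambda>s. s *\<^sub>R axis l 1)) (at t)"
      by (auto intro!: derivative_eq_intros)
    from has_derivative_compose[OF this has_derivative_pd[OF that]]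
    have "((\<lambda>t. F (x + t *\<^sub>R axis l 1)) has_derivative (\<lambda>s. \<Sum>k\<in>UNIV. (s *\<^sub>R axis l 1) $ k * pd k F (x + t *\<^sub>R axis l 1))) (at t)" .
    moreover have "(\<Sum>k\<in>UNIV. (s *\<^sub>R axis l 1) $ k * pd k F (x + t *\<^sub>R axis l 1)) = pd l F (x + t *\<^sub>R axis l 1) * s" for s
      using sum_axis_mult[of l "\<lambda>k. pd k F (x + t *\<^sub>R axis l 1)"]
      by (simp add: mult.assoc mult.commute flip: sum_distrib_left)
    ultimately show ?thesis by (simp add: has_field_derivative_def)
  qed
  have near: "norm (t *\<^sub>R axis i (1::real) + s *\<^sub>R axis k 1) \<le> 2 * h" if "0 \<le> t" "t \<le> h" "0 \<le> s" "s \<le> h" for s t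
  proof -
    have "norm (t *\<^sub>R axis i (1::real) + s *\<^sub>R axis k 1) \<le> norm (t *\<^sub>R axis i (1::real)) + norm (s *\<^sub>R axis k (1::real))"
      by (rule norm_triangle_ineq)
    then show ?thesis using that by simp
  qed
  have inball: "y + t *\<^sub>R axis i 1 + s *\<^sub>R axis k 1 \<in> cball y (2 * h)" if "0 \<le> t" "t \<le> h" "0 \<le> s" "s \<le> h" for s t
  proof -
    have "dist y (y + t *\<^sub>R axis i 1 + s *\<^sub>R axis k 1) = norm (t *\<^sub>R axis i (1::real) + s *\<^sub>R axis k 1)"
    proof -
      have "y - (y + t *\<^sub>R axis i 1 + s *\<^sub>R axis k 1) = - (t *\<^sub>R axis i (1::real) + s *\<^sub>R axis k 1)"
        by simp
      then show ?thesis
        by (simp only: dist_norm norm_minus_cancel)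
    qed
    then show ?thesis using near[OF that] by simp
  qed
  have inball': "y + t *\<^sub>R axis i 1 + s *\<^sub>R axis k 1 \<in> ball y r" if "0 \<le> t" "t \<le> h" "0 \<le> s" "s \<le> h" for s t
    using inball[OF that] h by auto
  define G where "G t = f (y + h *\<^sub>R axis k 1 + t *\<^sub>R axis i 1) - f (y + t *\<^sub>R axis i 1)" for t
  have "(G has_real_derivative (pd i f (y + h *\<^sub>R axis k 1 + t *\<^sub>R axis i 1) - pd i f (y + t *\<^sub>R axis i 1))) (at t)"
    if "0 \<le> t" "t \<le> h" for t
    unfolding G_def
    by (intro DERIV_diff line C1) (use inball'[OF that, of h] inball'[OF that, of 0] h in \<open>auto simp: algebra_simps\<close>)
  then obtain t where t: "0 < t" "t < h"
    "G h - G 0 = (h - 0) * (pd i f (y + h *\<^sub>R axis k 1 + t *\<^sub>R axis i 1) - pd i f (y + t *\<^sub>R axis i 1))"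
    using MVT2[OF h(1), of G "\<lambda>t. pd i f (y + h *\<^sub>R axis k 1 + t *\<^sub>R axis i 1) - pd i f (y + t *\<^sub>R axis i 1)"] by blast
  have "((\<lambda>s. pd i f (y + t *\<^sub>R axis i 1 + s *\<^sub>R axis k 1)) has_real_derivative pd k (pd i f) (y + t *\<^sub>R axis i 1 + s *\<^sub>R axis k 1)) (at s)"
    if "0 \<le> s" "s \<le> h" for s
    by (intro line C1 inball') (use that t in auto)
  then obtain s where s: "0 < s" "s < h"
    "pd i f (y + t *\<^sub>R axis i 1 + h *\<^sub>R axis k 1) - pd i f (y + t *\<^sub>R axis i 1 + 0 *\<^sub>R axis k 1) =
      (h - 0) * pd k (pd i f) (y + t *\<^sub>R axis i 1 + s *\<^sub>R axis k 1)"
    using MVT2[OF h(1), of "\<lambda>s. pd i f (y + t *\<^sub>R axis i 1 + s *\<^sub>R axis k 1)"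
      "\<lambda>s. pd k (pd i f) (y + t *\<^sub>R axis i 1 + s *\<^sub>R axis k 1)"] by blast
  have "f (y + h *\<^sub>R axis i 1 + h *\<^sub>R axis k 1) - f (y + h *\<^sub>R axis i 1) - f (y + h *\<^sub>R axis k 1) + f y = G h - G 0"
    by (simp add: G_def algebra_simps)
  also have "\<dots> = h * h * pd k (pd i f) (y + t *\<^sub>R axis i 1 + s *\<^sub>R axis k 1)"
    using t(3) s(3) by (simp add: algebra_simps)
  finally show thesis
    using inball[of t s] t s by (intro that) auto
qed

text \<open>The second difference is symmetric in the two directions, and both mixed derivatives are
  limits of its quotient by the square of the step.\<close>

lemma pd_commute:
  fixes f :: "real^'m::finite \<Rightarrow> real"
  assumes "open S" "Ck_on 2 S f" "y \<in> S"
  shows "pd i (pd k f) y = pd k (pd i f) y"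
proof -
  obtain r where r: "r > 0" "ball y r \<subseteq> S"
    using assms(1,3) openE by blast
  have C2: "Ck_on 2 (ball y r) f"
    using Ck_on_subset[OF assms(2) r(2)] .
  have lim: "(\<lambda>n. pd k (pd i f) (z n)) \<longlonglongrightarrow> pd k (pd i f) y" if "\<And>n. dist y (z n) \<le> r / real (n + 2)" for z i k
  proof -
    have "continuous_on (ball y r) (pd k (pd i f))"
      using C2 by (simp add: numeral_2_eq_2)
    then have "isCont (pd k (pd i f)) y"
      using r by (simp add: continuous_on_eq_continuous_at)
    moreover have "z \<longlonglongrightarrow> y"
    proof (rule metric_LIMSEQ_I)
      fix e :: real assume "e > 0"
      obtain n0 :: nat where n0: "r / e < real n0" using reals_Archimedean2 by blast
      have "dist (z n) y < e" if "n \<ge> n0" for n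
      proof -
        have "r < e * real (n + 2)"
          using n0 that \<open>e > 0\<close> by (simp add: divide_less_eq mult.commute) (smt (verit) mult_left_mono of_nat_mono)
        then have "r / real (n + 2) < e" by (simp add: divide_less_eq)
        then show ?thesis using \<open>\<And>n. dist y (z n) \<le> r / real (n + 2)\<close>[of n] by (simp add: dist_commute)
      qed
      then show "\<exists>n0. \<forall>n\<ge>n0. dist (z n) y < e" by blast
    qed
    ultimately show ?thesis by (rule isCont_tendsto_compose)
  qed
  \<comment> \<open>The shift by 2 ensures \<open>2 * h n < r\<close> already for n = 0.\<close>
  define h where "h n = r / (2 * real (n + 2))" for n
  have h: "0 < h n" "2 * h n < r" "2 * h n = r / real (n + 2)" for n
    using r by (auto simp: h_def field_simps add_pos_nonneg)
  define \<Delta> where "\<Delta> n = f (y + h n *\<^sub>R axis i 1 + h n *\<^sub>R axis k 1) - f (y + h n *\<^sub>R axis i 1) - f (y + h n *\<^sub>R axis k 1) + f y" for n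
  have "\<exists>z. dist y z \<le> r / real (n + 2) \<and> \<Delta> n = h n * h n * pd k (pd i f) z" for n
    using second_difference_MVT[OF C2 h(1,2), of n i k] h(3)[of n] unfolding \<Delta>_def by (metis mem_cball)
  then obtain z where z: "\<And>n. dist y (z n) \<le> r / real (n + 2)" "\<And>n. \<Delta> n = h n * h n * pd k (pd i f) (z n)"
    by metis
  have "\<exists>z. dist y z \<le> r / real (n + 2) \<and> \<Delta> n = h n * h n * pd i (pd k f) z" for n
  proof -
    obtain z where "z \<in> cball y (2 * h n)"
      "f (y + h n *\<^sub>R axis k 1 + h n *\<^sub>R axis i 1) - f (y + h n *\<^sub>R axis k 1) - f (y + h n *\<^sub>R axis i 1) + f y = h n * h n * pd i (pd k f) z"
      using second_difference_MVT[OF C2 h(1,2)] .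
    moreover have "y + h n *\<^sub>R axis k 1 + h n *\<^sub>R axis i 1 = y + h n *\<^sub>R axis i 1 + h n *\<^sub>R axis k 1"
      by (simp add: add_ac)
    ultimately show ?thesis
      using h(3)[of n] by (intro exI[of _ z]) (auto simp: \<Delta>_def)
  qed
  then obtain w where w: "\<And>n. dist y (w n) \<le> r / real (n + 2)" "\<And>n. \<Delta> n = h n * h n * pd i (pd k f) (w n)"
    by metis
  have "pd k (pd i f) (z n) = pd i (pd k f) (w n)" for n
    using z(2)[of n] w(2)[of n] h(1)[of n] by simp
  moreover have "(\<lambda>n. pd k (pd i f) (z n)) \<longlonglongrightarrow> pd k (pd i f) y" "(\<lambda>n. pd i (pd k f) (w n)) \<longlonglongrightarrow> pd i (pd k f) y"
    by (intro lim z(1) w(1))+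
  ultimately show ?thesis
    using LIMSEQ_unique by auto
qed

lemma sum_swap3: "(\<Sum>b\<in>B. \<Sum>i\<in>I. \<Sum>j\<in>J. f b i j) = (\<Sum>i\<in>I. \<Sum>j\<in>J. \<Sum>b\<in>B. f b i j)"
  by (subst sum.swap) (intro sum.cong refl sum.swap)

section \<open>Chart independence and continuity of the mean curvature\<close>

context immersed
begin

lemma first_ff_eq: "c \<in> A \<Longrightarrow> q \<in> fst c \<Longrightarrow> first_ff c N X q = g c q"
  by (simp add: first_ff_def vec_eq_iff inner_differential matrix_vector_mult_basis inner_axis' column_def)

lemma invertible_metric: "c \<in> A \<Longrightarrow> q \<in> fst c \<Longrightarrow> invertible (g c q)"
proof -
  assume c: "c \<in> A" and q: "q \<in> fst c"
  have "v = 0" if "g c q *v v = 0" for v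
    using metric c q that unfolding riemannian_metric_def by (metis inner_zero_right less_irrefl)
  then have "\<exists>B. B ** g c q = mat 1"
    using matrix_left_invertible_ker[of "g c q"] by blast
  then show ?thesis
    using invertible_left_inverse by blast
qed

abbreviation "ginv c q \<equiv> matrix_inv (g c q)"

lemma ginv_change:
  assumes c: "c \<in> A" and d: "d \<in> A" and q: "q \<in> fst c" "q \<in> fst d"
  defines "J \<equiv> jac c d (snd c q)"
  shows "ginv d q = J ** ginv c q ** transpose J"
proof (rule matrix_inv_unique)
  have gc: "g c q = transpose J ** g d q ** J"
    using metric c d q unfolding riemannian_metric_def Let_def J_def jac_def by blast
  let ?J' = "jac d c (snd d q)"
  have J'J: "?J' ** J = mat 1"
    unfolding J_def by (rule jac_inverse[OF c d q])
  then have "transpose J ** transpose ?J' = mat 1"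
    by (metis matrix_transpose_mul transpose_mat)
  then have TJ: "transpose ?J' ** transpose J = mat 1"
    using matrix_left_right_inverse by blast
  have "g d q ** (J ** ginv c q ** transpose J) =
      (transpose ?J' ** transpose J) ** (g d q ** (J ** ginv c q ** transpose J))"
    by (simp add: TJ)
  also have "\<dots> = transpose ?J' ** (g c q ** ginv c q) ** transpose J"
    by (simp add: gc matrix_mul_assoc)
  also have "\<dots> = mat 1"
    by (simp add: matrix_inv_mult[OF invertible_metric[OF c q(1)]] TJ)
  finally show "g d q ** (J ** ginv c q ** transpose J) = mat 1" .
qed

text \<open>The metric trace of a covariant 2-tensor does not depend on the chart. It is applied to
  the tangential projection and to the second fundamental form.\<close>

lemma contract_ginv_change:
  assumes c: "c \<in> A" and d: "d \<in> A" and q: "q \<in> fst c" "q \<in> fst d"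
  defines "J \<equiv> jac c d (snd c q)"
  shows "(\<Sum>i\<in>UNIV. \<Sum>j\<in>UNIV. ginv c q $ i $ j * (\<Sum>a\<in>UNIV. \<Sum>b\<in>UNIV. J $ a $ i * J $ b $ j * t a b)) =
    (\<Sum>a\<in>UNIV. \<Sum>b\<in>UNIV. ginv d q $ a $ b * t a b)"
proof -
  have entry: "ginv d q $ a $ b = (\<Sum>i\<in>UNIV. \<Sum>j\<in>UNIV. ginv c q $ i $ j * (J $ a $ i * J $ b $ j))" for a b
    unfolding ginv_change[OF c d q] J_def[symmetric]
    by (simp add: matrix_matrix_mult_def transpose_def sum_distrib_left sum_distrib_right mult_ac) (rule sum.swap)
  have "(\<Sum>a\<in>UNIV. \<Sum>b\<in>UNIV. ginv d q $ a $ b * t a b) =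
    (\<Sum>a\<in>UNIV. \<Sum>b\<in>UNIV. \<Sum>i\<in>UNIV. \<Sum>j\<in>UNIV. ginv c q $ i $ j * (J $ a $ i * J $ b $ j * t a b))"
    by (simp add: entry sum_distrib_right mult.assoc)
  also have "\<dots> = (\<Sum>a\<in>UNIV. \<Sum>i\<in>UNIV. \<Sum>j\<in>UNIV. \<Sum>b\<in>UNIV. ginv c q $ i $ j * (J $ a $ i * J $ b $ j * t a b))"
    by (intro sum.cong refl sum_swap3)
  also have "\<dots> = (\<Sum>i\<in>UNIV. \<Sum>j\<in>UNIV. \<Sum>a\<in>UNIV. \<Sum>b\<in>UNIV. ginv c q $ i $ j * (J $ a $ i * J $ b $ j * t a b))"
    by (rule sum_swap3)
  finally show ?thesis
    by (simp add: sum_distrib_left)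
qed

lemma normal_part_eq:
  "c \<in> A \<Longrightarrow> q \<in> fst c \<Longrightarrow> normal_part c N X q w l = w l - (\<Sum>i\<in>UNIV. \<Sum>j\<in>UNIV. ginv c q $ i $ j *
     (eucl_inner N w (differential c X q (axis i 1)) * differential c X q (axis j 1) l))"
  by (simp add: normal_part_def first_ff_eq mult.assoc)

lemma differential_axis_change:
  assumes "c \<in> A" "d \<in> A" "q \<in> fst c" "q \<in> fst d"
  shows "differential c X q (axis i 1) = (\<lambda>l. \<Sum>a\<in>UNIV. jac c d (snd c q) $ a $ i * differential d X q (axis a 1) l)"
proof -
  have "transition c d (snd c q) = snd d q"
    using assms by (simp add: transition_def chart_inv_snd)
  then show ?thesis
    using pd_local_rep_change[OF assms(1,2) snd_in_dom[OF assms(1,3,4)]] assms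
    by (simp add: differential_axis mult.commute)
qed

lemma normal_part_change:
  assumes c: "c \<in> A" and d: "d \<in> A" and q: "q \<in> fst c" "q \<in> fst d"
  shows "normal_part c N X q w l = normal_part d N X q w l"
proof -
  let ?J = "jac c d (snd c q)" and ?e = "\<lambda>a. differential d X q (axis a 1)"
  have "eucl_inner N w (differential c X q (axis i 1)) * differential c X q (axis j 1) l =
    (\<Sum>a\<in>UNIV. \<Sum>b\<in>UNIV. ?J $ a $ i * ?J $ b $ j * (eucl_inner N w (?e a) * ?e b l))" for i j
  proof -
    have "eucl_inner N w (differential c X q (axis i 1)) = (\<Sum>a\<in>UNIV. ?J $ a $ i * eucl_inner N w (?e a))"
      unfolding differential_axis_change[OF c d q(1,2)] eucl_inner_commute[of N w] eucl_inner_sum_left eucl_inner_mult_left ..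
    moreover have "differential c X q (axis j 1) l = (\<Sum>b\<in>UNIV. ?J $ b $ j * ?e b l)"
      unfolding differential_axis_change[OF c d q(1,2)] ..
    ultimately show ?thesis
      by (simp only: sum_product) (simp only: mult_ac)
  qed
  then show ?thesis
    unfolding normal_part_eq[OF c q(1)] normal_part_eq[OF d q(2)] using contract_ginv_change[OF c d q] by simp
qed

lemma normal_part_add: "normal_part c N X q (\<lambda>l. v l + w l) l = normal_part c N X q v l + normal_part c N X q w l"
  by (simp add: normal_part_def eucl_inner_def sum.distrib algebra_simps)

lemma normal_part_mult: "normal_part c N X q (\<lambda>l. a * w l) l = a * normal_part c N X q w l"
  by (simp add: normal_part_def eucl_inner_mult_left sum_distrib_left algebra_simps)

lemma normal_part_zero: "normal_part c N X q (\<lambda>l. 0) l = 0"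
  by (simp add: normal_part_def eucl_inner_def)

lemma normal_part_sum: "normal_part c N X q (\<lambda>l. \<Sum>a\<in>I. w a l) l = (\<Sum>a\<in>I. normal_part c N X q (w a) l)"
  by (induction I rule: infinite_finite_induct) (simp_all add: normal_part_add normal_part_zero)

lemma normal_part_differential:
  assumes c: "c \<in> A" and q: "q \<in> fst c"
  shows "normal_part c N X q (differential c X q (axis a 1)) l = 0"
proof -
  let ?e = "\<lambda>a. differential c X q (axis a 1)"
  have "eucl_inner N (?e a) (?e i) = g c q $ i $ a" for i
    using metric c q inner_differential[OF c q, of "axis i 1" "axis a 1"]
    by (simp add: eucl_inner_commute[of N "?e a"] matrix_vector_mult_basis inner_axis' column_def)
  moreover have "(\<Sum>i\<in>UNIV. ginv c q $ i $ j * g c q $ i $ a) = (if j = a then 1 else 0)" for j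
  proof -
    have sym: "transpose (g c q) = g c q"
      using metric c q unfolding riemannian_metric_def by blast
    have "g c q ** transpose (ginv c q) = mat 1"
      using matrix_inv_mult(2)[OF invertible_metric[OF c q]] sym by (metis matrix_transpose_mul transpose_mat)
    then have "transpose (ginv c q) ** g c q = mat 1"
      using matrix_left_right_inverse by blast
    then have "(transpose (ginv c q) ** g c q) $ j $ a = (mat 1 :: real^'m^'m) $ j $ a" by simp
    then show ?thesis
      by (simp add: matrix_matrix_mult_def transpose_def mat_def)
  qed
  ultimately have "(\<Sum>i\<in>UNIV. \<Sum>j\<in>UNIV. ginv c q $ i $ j * (eucl_inner N (?e a) (?e i) * ?e j l)) = ?e a l"
    by (subst sum.swap) (simp add: sum_distrib_right[symmetric] mult.assoc[symmetric] if_distrib[of "\<lambda>x. x * _"] sum.delta cong: if_cong)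
  then show ?thesis
    by (simp add: normal_part_eq[OF c q])
qed

lemma pd2_local_rep_change:
  assumes c: "c \<in> A" and d: "d \<in> A" and y: "y \<in> dom c d"
  shows "pd i (pd j (local_rep c X l)) y =
    (\<Sum>a\<in>UNIV. \<Sum>b\<in>UNIV. jac c d y $ a $ i * jac c d y $ b $ j * pd a (pd b (local_rep d X l)) (transition c d y)) +
    (\<Sum>b\<in>UNIV. pd i (\<lambda>y. jac c d y $ b $ j) y * pd b (local_rep d X l) (transition c d y))"
proof -
  let ?\<phi> = "transition c d" and ?J = "jac c d"
  have od: "open (dom c d)" by (rule open_dom[OF c d])
  have d1: "pd b (local_rep d X l) differentiable (at (?\<phi> y))" for b
    using Ck_pd_local_rep[OF d, of b l] transition_in[OF d y] by simp
  have d2: "(\<lambda>y. ?\<phi> y $ a) differentiable (at y)" for a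
    using Ck_transition[OF c d, of 1 a] y by simp
  have d3: "(\<lambda>y. ?J y $ b $ j) differentiable (at y)" for b
    using Ck_jac[OF c d, of 1 b j] y by simp
  note d4 = pd_compose(1)[of "pd _ (local_rep d X l)" ?\<phi> y, OF d1 d2]
  have sum: "pd i (\<lambda>y. \<Sum>b\<in>I. F b y) y = (\<Sum>b\<in>I. pd i (F b) y) \<and> (\<lambda>y. \<Sum>b\<in>I. F b y) differentiable (at y)"
    if "finite I" "\<And>b. F b differentiable (at y)" for F :: "'m \<Rightarrow> real^'m \<Rightarrow> real" and I
    using that by (induction I rule: finite_induct)
      (simp_all add: pd_add pd_eqI[OF has_derivative_const] differentiable_add)
  have "pd i (pd j (local_rep c X l)) y = pd i (\<lambda>y. \<Sum>b\<in>UNIV. pd b (local_rep d X l) (?\<phi> y) * ?J y $ b $ j) y"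
    by (rule pd_cong[OF od y]) (rule pd_local_rep_change[OF c d])
  also have "\<dots> = (\<Sum>b\<in>UNIV. pd i (\<lambda>y. pd b (local_rep d X l) (?\<phi> y) * ?J y $ b $ j) y)"
    by (rule sum[THEN conjunct1]) (auto intro: differentiable_mult d4 d3)
  also have "\<dots> = (\<Sum>b\<in>UNIV. pd b (local_rep d X l) (?\<phi> y) * pd i (\<lambda>y. ?J y $ b $ j) y +
      (\<Sum>a\<in>UNIV. pd a (pd b (local_rep d X l)) (?\<phi> y) * ?J y $ a $ i) * ?J y $ b $ j)"
    by (simp add: pd_mult[OF d4 d3] pd_compose(2)[of "pd _ (local_rep d X l)" ?\<phi> y, OF d1 d2] jac_nth[OF c d y, symmetric])
  also have "\<dots> = (\<Sum>b\<in>UNIV. \<Sum>a\<in>UNIV. ?J y $ a $ i * ?J y $ b $ j * pd a (pd b (local_rep d X l)) (?\<phi> y)) +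
      (\<Sum>b\<in>UNIV. pd i (\<lambda>y. ?J y $ b $ j) y * pd b (local_rep d X l) (?\<phi> y))"
    by (simp add: sum.distrib sum_distrib_left sum_distrib_right mult_ac)
  finally show ?thesis
    by (subst (asm) sum.swap)
qed

text \<open>The second derivatives of \<open>X\<close> do not transform as a tensor, but the extra
  term, with the second derivatives of the transition map, is a combination of coordinate tangent
  vectors and disappears in the normal projection.\<close>

lemma second_ff_change:
  assumes c: "c \<in> A" and d: "d \<in> A" and q: "q \<in> fst c" "q \<in> fst d"
  shows "second_ff c N X q i j l =
    (\<Sum>a\<in>UNIV. \<Sum>b\<in>UNIV. jac c d (snd c q) $ a $ i * jac c d (snd c q) $ b $ j * second_ff d N X q a b l)"
proof -
  let ?J = "jac c d (snd c q)"
  have y: "snd c q \<in> dom c d" and tr: "transition c d (snd c q) = snd d q"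
    using c q by (auto simp: snd_in_dom transition_def chart_inv_snd)
  have "second_ff c N X q i j l = normal_part d N X q (\<lambda>l. pd i (pd j (local_rep c X l)) (snd c q)) l"
    unfolding second_ff_def by (rule normal_part_change[OF c d q])
  also have "(\<lambda>l. pd i (pd j (local_rep c X l)) (snd c q)) =
    (\<lambda>l. (\<Sum>a\<in>UNIV. \<Sum>b\<in>UNIV. ?J $ a $ i * ?J $ b $ j * pd a (pd b (local_rep d X l)) (snd d q)) +
      (\<Sum>b\<in>UNIV. pd i (\<lambda>y. jac c d y $ b $ j) (snd c q) * differential d X q (axis b 1) l))"
    using pd2_local_rep_change[OF c d y] tr by (simp add: differential_axis[OF d q(2)])
  also have "normal_part d N X q \<dots> l = (\<Sum>a\<in>UNIV. \<Sum>b\<in>UNIV. ?J $ a $ i * ?J $ b $ j * second_ff d N X q a b l)"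
    by (simp only: normal_part_add normal_part_sum normal_part_mult second_ff_def normal_part_differential[OF d q(2)]) simp
  finally show ?thesis .
qed

lemma mean_curvature_in_change:
  assumes c: "c \<in> A" and d: "d \<in> A" and q: "q \<in> fst c" "q \<in> fst d"
  shows "mean_curvature_in c N X q = mean_curvature_in d N X q"
  using contract_ginv_change[OF assms] c d q by (simp add: mean_curvature_in_def first_ff_eq second_ff_change[OF assms])

lemma mean_curvature_eq: "c \<in> A \<Longrightarrow> q \<in> fst c \<Longrightarrow> mean_curvature A N X q = mean_curvature_in c N X q"
  unfolding mean_curvature_def
  by (rule someI2[of "\<lambda>c. c \<in> A \<and> q \<in> fst c" c]) (auto intro: mean_curvature_in_change)

lemma continuous_mean_curvature_in:
  assumes c: "c \<in> A"
  shows "continuous_on (chart_image c) (\<lambda>y. mean_curvature_in c N X (chart_inv c y) l)"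
proof -
  let ?S = "chart_image c"
  have gc: "continuous_on ?S (\<lambda>y. g c (chart_inv c y) $ i $ j)" for i j
    using metric c unfolding riemannian_metric_def smooth_on_def by (meson Ck_on.simps(1))
  have dg: "det (g c (chart_inv c y)) \<noteq> 0" if "y \<in> ?S" for y
    using invertible_metric[OF c chart_inv_in[OF that]] by (simp add: invertible_det_nz)
  have gi: "continuous_on ?S (\<lambda>y. ginv c (chart_inv c y) $ i $ j)" for i j
    by (rule continuous_on_matrix_inv[OF gc dg])
  have d1: "continuous_on ?S (pd i (local_rep c X l))" for i l
    by (rule Ck_on_imp_continuous_on[OF Ck_pd_local_rep[OF c]])
  have d2: "continuous_on ?S (pd i (pd j (local_rep c X l)))" for i j l
    using Ck_pd_local_rep[OF c, of j l] by simp
  let ?H = "\<lambda>y. (\<Sum>i\<in>UNIV. \<Sum>j\<in>UNIV. ginv c (chart_inv c y) $ i $ j *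
     (pd i (pd j (local_rep c X l)) y - (\<Sum>a\<in>UNIV. \<Sum>b\<in>UNIV. ginv c (chart_inv c y) $ a $ b *
       ((\<Sum>k<N. pd i (pd j (local_rep c X k)) y * pd a (local_rep c X k) y) * pd b (local_rep c X l) y)))) / real CARD('m)"
  have "continuous_on ?S ?H"
    by (intro continuous_intros gi d1 d2) simp
  moreover have "?H y = mean_curvature_in c N X (chart_inv c y) l" if "y \<in> ?S" for y
    using chart_inv_in[OF that] c
    by (simp add: mean_curvature_in_def first_ff_eq second_ff_def normal_part_eq differential_axis snd_chart_inv[OF that] eucl_inner_def)
  ultimately show ?thesis
    by (simp cong: continuous_on_cong)
qed

section \<open>Integrability of the squared mean curvature\<close>

definition H2 :: "'a \<Rightarrow> real" where
  "H2 q = (eucl_norm N (mean_curvature A N X q))\<^sup>2"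

lemma H2_nonneg: "0 \<le> H2 q"
  by (simp add: H2_def)

lemma continuous_H2_chart:
  assumes c: "c \<in> A"
  shows "continuous_on (chart_image c) (\<lambda>y. H2 (chart_inv c y))"
proof -
  have "continuous_on (chart_image c) (\<lambda>y. \<Sum>l<N. (mean_curvature_in c N X (chart_inv c y) l) * (mean_curvature_in c N X (chart_inv c y) l))"
    by (intro continuous_intros continuous_mean_curvature_in c)
  then show ?thesis
    using mean_curvature_eq[OF c chart_inv_in]
    by (simp add: H2_def eucl_norm_square eucl_inner_def cong: continuous_on_cong)
qed

lemma continuous_map_H2: "continuous_map T euclideanreal H2"
  unfolding continuous_map_def
proof (intro conjI allI impI)
  fix U :: "real set" assume "openin euclidean U"
  then have U: "open U" by simp
  have "openin T {q \<in> fst c. H2 q \<in> U}" if c: "c \<in> A" for c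
  proof -
    have "open {y \<in> chart_image c. H2 (chart_inv c y) \<in> U}"
      using continuous_open_preimage[OF continuous_H2_chart[OF c] open_chart_image[OF c] U]
      by (simp add: Int_def vimage_def)
    from openin_chart_preimage[OF c this]
    have "openin T {q \<in> fst c. snd c q \<in> {y \<in> chart_image c. H2 (chart_inv c y) \<in> U}}" .
    moreover have "{q \<in> fst c. snd c q \<in> {y \<in> chart_image c. H2 (chart_inv c y) \<in> U}} = {q \<in> fst c. H2 q \<in> U}"
      using c by (auto simp: snd_in_image chart_inv_snd)
    ultimately show ?thesis by (simp only:)
  qed
  then have "openin T (\<Union>c\<in>A. {q \<in> fst c. H2 q \<in> U})"
    by (intro openin_Union) auto
  moreover have "{q \<in> topspace T. H2 q \<in> U} = (\<Union>c\<in>A. {q \<in> fst c. H2 q \<in> U})"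
    unfolding charts_cover[symmetric] by blast
  ultimately show "openin T {q \<in> topspace T. H2 q \<in> U}" by (simp only:)
qed simp

lemma measurable_H2: "H2 \<in> borel_measurable BT"
proof (rule borel_measurableI)
  fix U :: "real set" assume "open U"
  then have "openin T {q \<in> topspace T. H2 q \<in> U}"
    by (intro openin_continuous_map_preimage[OF continuous_map_H2]) simp
  moreover have "{q \<in> topspace T. H2 q \<in> U} = H2 -` U \<inter> space BT" by auto
  ultimately show "H2 -` U \<inter> space BT \<in> sets BT"
    using openin_sets by metis
qed

lemma H2_bounded: "\<exists>C. \<forall>q\<in>topspace T. H2 q \<le> C"
proof -
  have "compactin euclideanreal (H2 ` topspace T)"
    using image_compactin[OF _ continuous_map_H2] compact by (simp add: compact_space_def)
  then have "bounded (H2 ` topspace T)"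
    by (simp add: compact_imp_bounded)
  then show ?thesis
    by (auto simp: bounded_iff) (metis abs_le_D1)
qed

text \<open>The integral in \<open>mean_curvature_L2\<close> would be 0 by default for a
  non-integrable function. Continuity on a compact space of finite volume excludes this.\<close>

lemma integral_H2_eq:
  assumes fin: "emeasure (RV g) (topspace T) \<noteq> \<infinity>"
  shows "(\<integral>\<^sup>+q. ennreal (H2 q) \<partial>RV g) = ennreal (LINT q|RV g. H2 q)"
proof (rule nn_integral_eq_integral)
  interpret finite_measure "RV g"
    by (rule finite_measureI) (use fin in simp)
  obtain C where "\<forall>q\<in>topspace T. H2 q \<le> C"
    using H2_bounded by blast
  then show "integrable (RV g) H2"
    using measurable_H2 by (intro integrable_const_bound[of _ C]) (auto simp: measurable_RV H2_nonneg intro!: AE_I2)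
qed (simp add: H2_nonneg)

lemma integral_H2_chart_le:
  assumes fin: "emeasure (RV g) (topspace T) \<noteq> \<infinity>" and c: "c \<in> A"
  shows "(\<integral>\<^sup>+y. indicator (chart_image c) y * (ennreal (vol_density g c y) * ennreal (H2 (chart_inv c y))) \<partial>lborel)
    \<le> ennreal (LINT q|RV g. H2 q)"
proof -
  have "(\<integral>\<^sup>+y. indicator (chart_image c) y * (ennreal (vol_density g c y) * ennreal (H2 (chart_inv c y))) \<partial>lborel) =
      (\<integral>\<^sup>+q. ennreal (H2 q) \<partial>chart_volume T g c)"
    using measurable_H2 by (intro nn_integral_chart_volume[OF metric c, symmetric]) simp
  also have "\<dots> \<le> (\<integral>\<^sup>+q. ennreal (H2 q) \<partial>RV g)"
    by (rule nn_integral_chart_volume_le_RV[OF c])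
  finally show ?thesis
    by (simp add: integral_H2_eq[OF fin])
qed

text \<open>Where the metric is conformal to the coordinate metric, with factor \<open>\<phi>\<close>, the tangential part
  of the coordinate Laplacian of \<open>X\<close> is read off the derivatives of \<open>\<langle>\<partial>\<^sub>i X, \<partial>\<^sub>k X\<rangle> = \<phi> \<delta>\<^sub>i\<^sub>k\<close>.\<close>

lemma inner_laplacian_tangent:
  assumes c: "c \<in> A" and W: "open W" "W \<subseteq> chart_image c" and y: "y \<in> W"
    and conf: "\<And>y. y \<in> W \<Longrightarrow> g c (chart_inv c y) = \<phi> y *\<^sub>R mat 1"
    and \<phi>: "\<phi> differentiable (at y)"
  shows "(\<Sum>i\<in>UNIV. \<Sum>l<N. pd i (pd i (local_rep c X l)) y * pd k (local_rep c X l) y) =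
    (1 - real CARD('m) / 2) * pd k \<phi> y"
proof -
  let ?x = "local_rep c X"
  have diff: "pd i (?x l) differentiable (at y)" for i l
    using Ck_pd_local_rep[OF c, of i l] y W by auto
  have gram: "(\<Sum>l<N. pd i (?x l) y * pd j (?x l) y) = \<phi> y * (if i = j then 1 else 0)" if "y \<in> W" for y i j
  proof -
    have yc: "y \<in> chart_image c" using that W by auto
    show ?thesis
      using inner_differential[OF c chart_inv_in[OF yc], of "axis i 1" "axis j 1"] conf[OF that]
      by (simp add: differential_axis[OF c chart_inv_in[OF yc]] snd_chart_inv[OF yc] eucl_inner_def inner_axis_axis
          flip: scaleR_matrix_vector_assoc)
  qed
  have sum: "pd h (\<lambda>y. \<Sum>l\<in>I. F l y) y = (\<Sum>l\<in>I. pd h (F l) y) \<and> (\<lambda>y. \<Sum>l\<in>I. F l y) differentiable (at y)"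
    if "finite I" "\<And>l. F l differentiable (at y)" for F :: "nat \<Rightarrow> real^'m \<Rightarrow> real" and I h
    using that by (induction I rule: finite_induct)
      (simp_all add: pd_add pd_eqI[OF has_derivative_const] differentiable_add)
  have dgram: "(\<Sum>l<N. pd i (?x l) y * pd h (pd j (?x l)) y + pd h (pd i (?x l)) y * pd j (?x l) y) =
      pd h \<phi> y * (if i = j then 1 else 0)" for h i j
  proof -
    have "(\<Sum>l<N. pd i (?x l) y * pd h (pd j (?x l)) y + pd h (pd i (?x l)) y * pd j (?x l) y) =
        (\<Sum>l<N. pd h (\<lambda>y. pd i (?x l) y * pd j (?x l) y) y)"
      by (simp add: pd_mult[OF diff diff])
    also have "\<dots> = pd h (\<lambda>y. \<Sum>l<N. pd i (?x l) y * pd j (?x l) y) y"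
      by (rule sum[THEN conjunct1, symmetric]) (auto intro: differentiable_mult diff)
    also have "\<dots> = pd h (\<lambda>y. \<phi> y * (if i = j then 1 else 0)) y"
      by (rule pd_cong[OF W(1) y]) (rule gram)
    also have "\<dots> = pd h \<phi> y * (if i = j then 1 else 0)"
      by (subst pd_mult[OF \<phi>]) (simp_all add: pd_eqI[OF has_derivative_const])
    finally show ?thesis .
  qed
  have comm: "pd i (pd k (?x l)) y = pd k (pd i (?x l)) y" for i l
    by (rule pd_commute[OF W(1) Ck_on_subset[OF Ck_local_rep[OF c] W(2)] y])
  have half: "(\<Sum>l<N. pd i (?x l) y * pd k (pd i (?x l)) y) = pd k \<phi> y / 2" for i
    using dgram[of i k i] by (simp add: sum.distrib mult.commute flip: sum_distrib_left)
  \<comment> \<open>Differentiate the product of the i-th and k-th derivatives in direction i, and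
    subtract half the k-th derivative of the squared i-th one. Summation over i produces the factor
    \<open>1 - real CARD('m) / 2\<close>.\<close>
  have "(\<Sum>l<N. pd i (pd i (?x l)) y * pd k (?x l) y) = pd i \<phi> y * (if i = k then 1 else 0) - pd k \<phi> y / 2" for i
    using dgram[of i i k] half[of i] by (simp add: sum.distrib comm)
  then show ?thesis
    by (simp add: sum_subtractf left_diff_distrib if_distrib[of "\<lambda>x. _ * x"] sum.delta cong: if_cong)
qed

text \<open>In conformal coordinates the inverse metric is \<open>1 / \<phi>\<close> times the
  identity, so the normal part of the coordinate Laplacian is \<open>\<phi>\<close> times the trace
  of the second fundamental form; the tangential part is given by
  \<open>inner_laplacian_tangent\<close>.\<close>

lemma laplacian_eq_mean_curvature:
  assumes c: "c \<in> A" and W: "open W" "W \<subseteq> chart_image c" and y: "y \<in> W"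
    and conf: "\<And>y. y \<in> W \<Longrightarrow> g c (chart_inv c y) = \<phi> y *\<^sub>R mat 1" and pos: "\<phi> y > 0"
    and \<phi>: "\<phi> differentiable (at y)"
  shows "(\<Sum>i\<in>UNIV. pd i (pd i (local_rep c X l)) y) =
    \<phi> y * (real CARD('m) * mean_curvature A N X (chart_inv c y) l) +
    (1 - real CARD('m) / 2) / \<phi> y * (\<Sum>k\<in>UNIV. pd k \<phi> y * pd k (local_rep c X l) y)"
proof -
  let ?x = "local_rep c X" and ?q = "chart_inv c y"
  have yc: "y \<in> chart_image c" using y W by auto
  have q: "?q \<in> fst c" "snd c ?q = y" using yc by (simp_all add: chart_inv_in snd_chart_inv)
  have gi: "ginv c ?q = (1 / \<phi> y) *\<^sub>R mat 1"
    by (rule matrix_inv_unique)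
       (use pos in \<open>simp add: conf[OF y] matrix_eq flip: matrix_vector_mul_assoc scaleR_matrix_vector_assoc\<close>)
  have gi': "ginv c ?q $ i $ j = (if i = j then 1 / \<phi> y else 0)" for i j
    by (simp add: gi mat_def)
  have "real CARD('m) * mean_curvature A N X ?q l = (\<Sum>i\<in>UNIV. second_ff c N X ?q i i l) / \<phi> y"
    by (simp add: mean_curvature_eq[OF c q(1)] mean_curvature_in_def first_ff_eq[OF c q(1)] gi'
        if_distrib[of "\<lambda>x. x * _"] sum.delta sum_divide_distrib[symmetric] cong: if_cong)
  moreover have "second_ff c N X ?q i i l = pd i (pd i (?x l)) y -
      (\<Sum>k\<in>UNIV. (\<Sum>j<N. pd i (pd i (?x j)) y * pd k (?x j) y) * pd k (?x l) y) / \<phi> y" for i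
    by (simp add: second_ff_def normal_part_eq[OF c q(1)] gi' differential_axis[OF c q(1)] q(2) eucl_inner_def
        if_distrib[of "\<lambda>x. x * _"] sum.delta sum_divide_distrib cong: if_cong)
  ultimately have "\<phi> y * (real CARD('m) * mean_curvature A N X ?q l) =
      (\<Sum>i\<in>UNIV. pd i (pd i (?x l)) y) - (\<Sum>i\<in>UNIV. \<Sum>k\<in>UNIV. (\<Sum>j<N. pd i (pd i (?x j)) y * pd k (?x j) y) * pd k (?x l) y) / \<phi> y"
    using pos by (simp add: sum_subtractf sum_divide_distrib)
  also have "(\<Sum>i\<in>UNIV. \<Sum>k\<in>UNIV. (\<Sum>j<N. pd i (pd i (?x j)) y * pd k (?x j) y) * pd k (?x l) y) =
      (\<Sum>k\<in>UNIV. (\<Sum>i\<in>UNIV. \<Sum>j<N. pd i (pd i (?x j)) y * pd k (?x j) y) * pd k (?x l) y)"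
    by (subst sum.swap) (simp add: sum_distrib_right)
  also have "\<dots> = (1 - real CARD('m) / 2) * (\<Sum>k\<in>UNIV. pd k \<phi> y * pd k (?x l) y)"
    by (simp add: inner_laplacian_tangent[OF c W y conf \<phi>] sum_distrib_left mult.assoc)
  finally show ?thesis by simp
qed

end

section \<open>Lower bound for the mean curvature\<close>

lemma Ck_on_diff_const: "open S \<Longrightarrow> Ck_on k S f \<Longrightarrow> Ck_on k S (\<lambda>y. f y - c)"
  using Ck_on_add[OF _ _ Ck_on_const[of k S "- c"]] by simp

lemma Ck_on_powr:
  fixes u :: "real^'m::finite \<Rightarrow> real"
  assumes "open S" "Ck_on k S u" "\<And>y. y \<in> S \<Longrightarrow> u y > 0"
  shows "Ck_on k S (\<lambda>y. u y powr \<alpha>)"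
proof -
  define D where "D n x = (\<Prod>j<n. \<alpha> - real j) * x powr (\<alpha> - real n)" for n and x :: real
  have "(D n has_real_derivative D (Suc n) x) (at x)" if "x \<in> {0<..}" for n x
  proof -
    have "(D n has_real_derivative (\<Prod>j<n. \<alpha> - real j) * ((\<alpha> - real n) * x powr (\<alpha> - real n - 1))) (at x)"
      unfolding D_def using that by (intro DERIV_cmult has_real_derivative_powr) auto
    then show ?thesis
      by (simp add: D_def algebra_simps)
  qed
  then have "Ck_on k S (\<lambda>y. D 0 (u y))"
    using Ck_on_compose_real[OF assms(1) _ assms(2), of "{0<..}" D 0] assms(3) by blast
  then show ?thesis by (simp add: D_def)
qed

lemma pd_powr:
  assumes "u differentiable (at y)" "u y > 0"
  shows "pd i (\<lambda>y. u y powr \<alpha>) y = \<alpha> * (u y powr \<alpha> / u y) * pd i u y"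
proof -
  have "((\<lambda>x. x powr \<alpha>) has_derivative (*) (\<alpha> * u y powr (\<alpha> - 1))) (at (u y))"
    using has_real_derivative_powr[OF assms(2), of \<alpha>] by (simp add: has_field_derivative_def)
  from has_derivative_compose[OF has_derivative_pd[OF assms(1)] this]
  have "((\<lambda>y. u y powr \<alpha>) has_derivative (\<lambda>v. \<alpha> * u y powr (\<alpha> - 1) * (\<Sum>i\<in>UNIV. v $ i * pd i u y))) (at y)" .
  from pd_eqI[OF this] show ?thesis
    using assms(2) by (simp add: sum_axis_mult powr_diff)
qed

text \<open>The open sets \<open>W\<close> and the complement of the closed ball cover the space,
  and the extended function is of class C^k on each of them.\<close>

lemma Ck_on_extend:
  assumes W: "open W" "cball z R \<subseteq> W" and f: "Ck_on k W f" "\<And>y. y \<in> W \<Longrightarrow> y \<notin> cball z R \<Longrightarrow> f y = 0"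
  shows "Ck_on k UNIV (\<lambda>y. if y \<in> W then f y else 0)"
proof (rule Ck_on_local)
  fix y
  show "\<exists>V. open V \<and> y \<in> V \<and> Ck_on k V (\<lambda>y. if y \<in> W then f y else 0)"
  proof (cases "y \<in> W")
    case True
    have "Ck_on k W (\<lambda>y. if y \<in> W then f y else 0)"
      by (subst Ck_on_cong[OF W(1), of _ f]) (use f in auto)
    then show ?thesis using True W by blast
  next
    case False
    have "open (- cball z R)" by auto
    moreover have "Ck_on k (- cball z R) (\<lambda>y. if y \<in> W then f y else 0)"
      by (subst Ck_on_cong[OF \<open>open (- cball z R)\<close>, of _ "\<lambda>_. 0"]) (use f in \<open>auto intro: Ck_on_const\<close>)
    moreover have "y \<in> - cball z R" using False W by auto
    ultimately show ?thesis by blast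
  qed
qed

text \<open>The squared distance is written out in coordinates so that the argument of
  \<open>bump\<close> is visibly a polynomial.\<close>

definition radial_bump :: "real^'m::finite \<Rightarrow> real \<Rightarrow> real^'m \<Rightarrow> real" where
  "radial_bump z R y = bump (R\<^sup>2 - (\<Sum>i\<in>UNIV. (y $ i - z $ i) * (y $ i - z $ i)))"

lemma radial_bump_eq: "radial_bump z R y = bump (R\<^sup>2 - (norm (y - z))\<^sup>2)"
  by (simp add: radial_bump_def dot_square_norm[symmetric] inner_vec_def)

lemma Ck_radial_bump: "Ck_on k UNIV (radial_bump z R)"
proof -
  have "Ck_on k UNIV (\<lambda>y. bump (R\<^sup>2 + (-1) * (\<Sum>i\<in>UNIV. (y $ i + (- z $ i)) * (y $ i + (- z $ i)))))"
    by (intro Ck_on_bump Ck_on_intros open_UNIV)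
  then show ?thesis
    by (simp add: radial_bump_def[abs_def])
qed

lemma radial_bump_nonneg: "0 \<le> radial_bump z R y" and radial_bump_le_1: "radial_bump z R y \<le> 1"
  by (simp_all add: radial_bump_def bump_nonneg bump_le_1)

lemma radial_bump_pos_iff: "R > 0 \<Longrightarrow> 0 < radial_bump z R y \<longleftrightarrow> y \<in> ball z R"
proof -
  assume "R > 0"
  then have "(norm (y - z))\<^sup>2 < R\<^sup>2 \<longleftrightarrow> norm (y - z) < R"
    using power2_less_imp_less[of "norm (y - z)" R] power_strict_mono[of "norm (y - z)" R 2] by auto
  then show ?thesis
    by (simp add: radial_bump_eq bump_pos_iff dist_norm norm_minus_commute)
qed

lemma radial_bump_eq_0: "R > 0 \<Longrightarrow> y \<notin> ball z R \<Longrightarrow> radial_bump z R y = 0"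
  using radial_bump_pos_iff[of R z y] radial_bump_nonneg[of z R y] by linarith

context immersed
begin

text \<open>The divergence theorem for the vector field with coordinates
  \<open>\<psi> \<phi>\<^bsup>m/2-1\<^esup> \<langle>X - x\<^sub>0, \<partial>\<^sub>i X\<rangle>\<close>, where \<open>\<psi>\<close> is the cutoff; the factor \<open>\<phi>\<^bsup>m/2-1\<^esup>\<close> makes the tangential part of
  the coordinate Laplacian of \<open>X\<close> cancel.\<close>

lemma mean_curvature_inequality:
  assumes c: "c \<in> A" and W: "open W" "W \<subseteq> chart_image c" "cball z R \<subseteq> W" and R: "R > 0"
    and conf: "\<And>y. y \<in> W \<Longrightarrow> g c (chart_inv c y) = \<phi> y *\<^sub>R mat 1"
    and \<phi>: "Ck_on 1 W \<phi>" "\<And>y. y \<in> W \<Longrightarrow> \<phi> y > 0"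
    and D: "\<And>y. y \<in> cball z R \<Longrightarrow> eucl_norm N (\<lambda>l. X (chart_inv c y) l - x0 l) \<le> D" "D > 0"
    and b: "\<And>y. y \<in> cball z R \<Longrightarrow> (\<Sum>i\<in>UNIV. \<bar>pd i (radial_bump z R) y\<bar>) * sqrt (\<phi> y) ^ (CARD('m) - 1) \<le> b"
    and fin: "emeasure (RV g) (topspace T) \<noteq> \<infinity>"
  defines "\<Psi> \<equiv> \<lambda>y. if y \<in> W then radial_bump z R y * sqrt (\<phi> y) ^ CARD('m) else 0"
  shows "integrable lborel \<Psi>"
    and "real CARD('m) / 2 * (LINT y|lborel. \<Psi> y) \<le>
      real CARD('m) * D\<^sup>2 / 2 * (LINT q|RV g. H2 q) + D * b * measure lborel (cball z R)"
proof -
  let ?x = "local_rep c X" and ?m = "real CARD('m)" and ?H = "\<lambda>y. mean_curvature A N X (chart_inv c y)"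
  let ?\<psi> = "radial_bump z R"
  define P where "P y = \<phi> y powr (?m / 2 - 1)" for y
  define \<xi> where "\<xi> i y = (\<Sum>l<N. (?x l y - x0 l) * pd i (?x l) y)" for i y
  define u where "u i y = (if y \<in> W then ?\<psi> y * (P y * \<xi> i y) else 0)" for i y
  have \<psi>0: "?\<psi> y = 0" if "y \<notin> cball z R" for y
    using that R by (intro radial_bump_eq_0) auto
  \<comment> \<open>Multiplied by \<open>\<phi>\<close>, the weight \<open>P\<close> becomes the
    volume density; multiplied by the length \<open>sqrt \<phi>\<close> of a coordinate vector, it
    becomes the power in the hypothesis \<open>b\<close>.\<close>
  have dens: "P y * \<phi> y = sqrt (\<phi> y) ^ CARD('m)" and dens': "P y * sqrt (\<phi> y) = sqrt (\<phi> y) ^ (CARD('m) - 1)"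
    and Ppos: "P y > 0" if "y \<in> W" for y
  proof -
    have pos: "\<phi> y > 0" using \<phi>(2) that .
    then have root: "sqrt (\<phi> y) ^ n = \<phi> y powr (real n / 2)" for n
    proof -
      have "sqrt (\<phi> y) ^ n = (\<phi> y powr (1 / 2)) powr real n"
        using pos by (subst powr_realpow) (auto simp: powr_half_sqrt)
      then show ?thesis by (simp add: powr_powr)
    qed
    show "P y * \<phi> y = sqrt (\<phi> y) ^ CARD('m)"
      using pos powr_add[of "\<phi> y" "?m / 2 - 1" 1] by (simp add: root P_def)
    have "real (CARD('m) - 1) / 2 = (?m / 2 - 1) + 1 / 2"
      by (simp add: of_nat_diff Suc_leI field_simps)
    then show "P y * sqrt (\<phi> y) = sqrt (\<phi> y) ^ (CARD('m) - 1)"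
      using pos by (simp only: root P_def powr_add powr_half_sqrt less_imp_le)
    show "P y > 0" using pos by (simp add: P_def)
  qed
  have x1: "Ck_on 1 W (?x l)" "Ck_on 1 W (pd i (?x l))" for i l
    using Ck_on_subset[OF Ck_on_le[OF Ck_local_rep[OF c]] W(2), of 1] Ck_on_subset[OF Ck_pd_local_rep[OF c] W(2)] by auto
  have P1: "Ck_on 1 W P"
    unfolding P_def by (rule Ck_on_powr[OF W(1) \<phi>])
  have \<xi>1: "Ck_on 1 W (\<xi> i)" for i
    unfolding \<xi>_def by (intro Ck_on_sum Ck_on_mult Ck_on_diff_const W x1)
  have \<psi>1: "Ck_on 1 W ?\<psi>"
    by (rule Ck_on_subset[OF Ck_radial_bump]) simp
  have diff: "?\<psi> differentiable (at y)" "P differentiable (at y)" "\<xi> i differentiable (at y)" "\<phi> differentiable (at y)"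
    "?x l differentiable (at y)" "pd i (?x l) differentiable (at y)" if "y \<in> W" for y i l
    using \<psi>1 P1 \<xi>1[of i] \<phi>(1) x1(1)[of l] x1(2)[of i l] that by simp_all
  have "Ck_on 1 W (\<lambda>y. ?\<psi> y * (P y * \<xi> i y))" for i
    by (intro Ck_on_mult W \<psi>1 P1 \<xi>1)
  then have C1u: "Ck_on 1 UNIV (u i)" for i
    unfolding u_def by (rule Ck_on_extend[OF W(1,3)]) (simp add: \<psi>0)
  have supp: "u i y = 0" if "y \<notin> cball z R" for i y
    using that by (simp add: u_def \<psi>0)
  define F where "F y = (\<Sum>i\<in>UNIV. pd i (u i) y)" for y
  have F: "integrable lborel F" "(LINT y|lborel. F y) = 0"
    using integral_pd_eq_0[OF C1u supp] unfolding F_def by (auto intro: Bochner_Integration.integrable_sum)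
  have sum: "pd i (\<lambda>y. \<Sum>l\<in>I. G l y) y = (\<Sum>l\<in>I. pd i (G l) y) \<and> (\<lambda>y. \<Sum>l\<in>I. G l y) differentiable (at y)"
    if "finite I" "\<And>l. G l differentiable (at y)" for G :: "nat \<Rightarrow> real^'m \<Rightarrow> real" and I i y
    using that by (induction I rule: finite_induct)
      (simp_all add: pd_add pd_eqI[OF has_derivative_const] differentiable_add)
  have pd\<xi>: "pd i (\<xi> i) y = (\<Sum>l<N. (?x l y - x0 l) * pd i (pd i (?x l)) y) + \<phi> y" if y: "y \<in> W" for i y
  proof -
    have shift: "(\<lambda>y. ?x l y - x0 l) differentiable (at y)" "pd i (\<lambda>y. ?x l y - x0 l) y = pd i (?x l) y" for l
      using diff(5)[OF y] pd_add[OF diff(5)[OF y], of "\<lambda>_. - x0 l"]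
      by (auto intro: differentiable_diff simp: pd_eqI[OF has_derivative_const])
    have "pd i (\<xi> i) y = (\<Sum>l<N. pd i (\<lambda>y. (?x l y - x0 l) * pd i (?x l) y) y)"
      unfolding \<xi>_def by (rule sum[THEN conjunct1]) (auto intro: differentiable_mult shift diff(6)[OF y])
    also have "\<dots> = (\<Sum>l<N. (?x l y - x0 l) * pd i (pd i (?x l)) y + pd i (?x l) y * pd i (?x l) y)"
      by (simp add: pd_mult[OF shift(1) diff(6)[OF y]] shift(2))
    also have "(\<Sum>l<N. (?x l y - x0 l) * pd i (pd i (?x l)) y + pd i (?x l) y * pd i (?x l) y) =
        (\<Sum>l<N. (?x l y - x0 l) * pd i (pd i (?x l)) y) + \<phi> y"
    proof -
      have yc: "y \<in> chart_image c" using y W by auto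
      have "(\<Sum>l<N. pd i (?x l) y * pd i (?x l) y) = \<phi> y"
        using inner_differential[OF c chart_inv_in[OF yc], of "axis i 1" "axis i 1"] conf[OF y]
        by (simp add: differential_axis[OF c chart_inv_in[OF yc]] snd_chart_inv[OF yc] eucl_inner_def inner_axis_axis
            flip: scaleR_matrix_vector_assoc)
      then show ?thesis by (simp add: sum.distrib)
    qed
    finally show ?thesis .
  qed
  have F_eq: "F y = (\<Sum>i\<in>UNIV. pd i ?\<psi> y * (P y * \<xi> i y)) +
      ?\<psi> y * (P y * \<phi> y * (?m * (1 + (\<Sum>l<N. (?x l y - x0 l) * ?H y l))))" if y: "y \<in> W" for y
  proof -
    have pdu: "pd i (u i) y = pd i ?\<psi> y * (P y * \<xi> i y) + ?\<psi> y * (P y * pd i (\<xi> i) y + pd i P y * \<xi> i y)" for i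
    proof -
      have "pd i (u i) y = pd i (\<lambda>y. ?\<psi> y * (P y * \<xi> i y)) y"
        by (rule pd_cong[OF W(1) y]) (simp add: u_def)
      then show ?thesis
        by (simp add: pd_mult[OF diff(1)[OF y] differentiable_mult[OF diff(2)[OF y] diff(3)[OF y]]]
            pd_mult[OF diff(2)[OF y] diff(3)[OF y]])
    qed
    have pdP: "pd i P y = (?m / 2 - 1) * (P y / \<phi> y) * pd i \<phi> y" for i
      unfolding P_def by (rule pd_powr[OF diff(4)[OF y] \<phi>(2)[OF y]])
    have lap: "(\<Sum>i\<in>UNIV. pd i (pd i (?x l)) y) = \<phi> y * (?m * ?H y l) + (1 - ?m / 2) / \<phi> y * (\<Sum>k\<in>UNIV. pd k \<phi> y * pd k (?x l) y)" for l
      by (rule laplacian_eq_mean_curvature[OF c W(1,2) y conf \<phi>(2)[OF y] diff(4)[OF y]])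
    have "(\<Sum>i\<in>UNIV. pd i (\<xi> i) y) = (\<Sum>l<N. (?x l y - x0 l) * (\<Sum>i\<in>UNIV. pd i (pd i (?x l)) y)) + ?m * \<phi> y"
      by (simp add: pd\<xi>[OF y] sum.distrib sum_distrib_left) (rule sum.swap)
    also have "(\<Sum>l<N. (?x l y - x0 l) * (\<Sum>i\<in>UNIV. pd i (pd i (?x l)) y)) =
      \<phi> y * (?m * (\<Sum>l<N. (?x l y - x0 l) * ?H y l)) + (1 - ?m / 2) / \<phi> y * (\<Sum>l<N. (?x l y - x0 l) * (\<Sum>k\<in>UNIV. pd k \<phi> y * pd k (?x l) y))"
      unfolding lap by (simp add: distrib_left sum.distrib sum_distrib_left mult_ac)
    also have "(\<Sum>l<N. (?x l y - x0 l) * (\<Sum>k\<in>UNIV. pd k \<phi> y * pd k (?x l) y)) = (\<Sum>k\<in>UNIV. pd k \<phi> y * \<xi> k y)"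
      unfolding \<xi>_def sum_distrib_left by (subst sum.swap) (simp add: mult_ac)
    finally have div\<xi>: "(\<Sum>i\<in>UNIV. pd i (\<xi> i) y) = \<phi> y * (?m * (\<Sum>l<N. (?x l y - x0 l) * ?H y l)) +
      (1 - ?m / 2) / \<phi> y * (\<Sum>k\<in>UNIV. pd k \<phi> y * \<xi> k y) + ?m * \<phi> y" .
    have "(\<Sum>i\<in>UNIV. pd i P y * \<xi> i y) = (?m / 2 - 1) * (P y / \<phi> y) * (\<Sum>k\<in>UNIV. pd k \<phi> y * \<xi> k y)"
      by (simp add: pdP sum_distrib_left mult.assoc)
    \<comment> \<open>The gradient of \<open>\<phi>\<close> enters with factor
      \<open>1 - ?m / 2\<close> through the Laplacian and with the opposite factor through the
      derivative of \<open>P\<close>; the two contributions cancel.\<close>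
    then have "(\<Sum>i\<in>UNIV. P y * pd i (\<xi> i) y + pd i P y * \<xi> i y) = P y * \<phi> y * (?m * (1 + (\<Sum>l<N. (?x l y - x0 l) * ?H y l)))"
      using \<phi>(2)[OF y] by (simp add: sum.distrib div\<xi> flip: sum_distrib_left) (simp add: field_simps)
    then show ?thesis
      by (simp add: F_def pdu sum.distrib flip: sum_distrib_left)
  qed
  define \<Theta> where "\<Theta> y = (if y \<in> W then ?\<psi> y * (sqrt (\<phi> y) ^ CARD('m) * H2 (chart_inv c y)) else 0)" for y
  have cont\<phi>: "continuous_on W (\<lambda>y. sqrt (\<phi> y) ^ CARD('m))"
    by (intro continuous_intros Ck_on_imp_continuous_on[OF \<phi>(1)])
  have cont\<psi>: "continuous_on W ?\<psi>"
    by (rule Ck_on_imp_continuous_on[OF \<psi>1])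
  have "Ck_on 0 UNIV \<Psi>"
    unfolding \<Psi>_def by (rule Ck_on_extend[OF W(1,3)]) (auto intro!: continuous_intros cont\<phi> cont\<psi> simp: \<psi>0)
  then show int\<Psi>: "integrable lborel \<Psi>"
    by (intro integrable_continuous_compact_support[of _ z R]) (simp_all add: \<Psi>_def \<psi>0)
  have "Ck_on 0 UNIV \<Theta>"
    unfolding \<Theta>_def
    by (rule Ck_on_extend[OF W(1,3)])
       (auto intro!: continuous_intros cont\<phi> cont\<psi> continuous_on_subset[OF continuous_H2_chart[OF c] W(2)] simp: \<psi>0)
  then have int\<Theta>: "integrable lborel \<Theta>"
    by (intro integrable_continuous_compact_support[of _ z R]) (simp_all add: \<Theta>_def \<psi>0)
  have intb: "integrable lborel (\<lambda>y. D * b * indicator (cball z R) y)"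
    using emeasure_bounded_finite[of "cball z R"] by (intro integrable_mult_right integrable_real_indicator) auto
  have lower: "?m / 2 * \<Psi> y - ?m * D\<^sup>2 / 2 * \<Theta> y - D * b * indicator (cball z R) y \<le> F y" for y
  proof (cases "y \<in> cball z R")
    case False
    have "F y = 0"
      unfolding F_def using pd_eq_0_outside[OF supp False] by simp
    then show ?thesis using False by (simp add: \<Psi>_def \<Theta>_def \<psi>0)
  next
    case True
    then have y: "y \<in> W" using W by auto
    then have yc: "y \<in> chart_image c" using W by auto
    let ?v = "\<lambda>l. ?x l y - x0 l"
    have v: "eucl_norm N ?v \<le> D"
      using D(1)[OF True] by (simp add: local_rep_def)
    have "\<bar>\<Sum>l<N. ?v l * ?H y l\<bar> \<le> eucl_norm N ?v * eucl_norm N (?H y)"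
      using abs_eucl_inner_le[of N ?v "?H y"] by (simp add: eucl_inner_def)
    also have "\<dots> \<le> D * eucl_norm N (?H y)"
      using v eucl_norm_nonneg by (intro mult_right_mono)
    \<comment> \<open>Young's inequality, balanced so that it uses up exactly half of the volume
      term; this is the origin of the factors 1/2 on both sides of the conclusion.\<close>
    also have "\<dots> \<le> (1 + D\<^sup>2 * H2 (chart_inv c y)) / 2"
    proof -
      have "0 \<le> (1 - D * eucl_norm N (?H y))\<^sup>2" by simp
      then show ?thesis by (simp add: H2_def power2_diff power_mult_distrib)
    qed
    finally have "- (\<Sum>l<N. ?v l * ?H y l) \<le> (1 + D\<^sup>2 * H2 (chart_inv c y)) / 2"
      by (rule order_trans[OF abs_ge_minus_self])
    then have H: "(1 - D\<^sup>2 * H2 (chart_inv c y)) / 2 \<le> 1 + (\<Sum>l<N. ?v l * ?H y l)"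
      by (simp add: field_simps)
    have "\<bar>\<xi> i y\<bar> \<le> D * sqrt (\<phi> y)" for i
    proof -
      have "\<xi> i y = eucl_inner N ?v (differential c X (chart_inv c y) (axis i 1))"
        by (simp add: \<xi>_def eucl_inner_def differential_axis[OF c chart_inv_in[OF yc]] snd_chart_inv[OF yc])
      moreover have "eucl_norm N (differential c X (chart_inv c y) (axis i 1)) = sqrt (\<phi> y)"
        by (simp add: eucl_norm_def inner_differential[OF c chart_inv_in[OF yc]] conf[OF y] inner_axis_axis
            flip: scaleR_matrix_vector_assoc)
      ultimately have "\<bar>\<xi> i y\<bar> \<le> eucl_norm N ?v * sqrt (\<phi> y)"
        using abs_eucl_inner_le[of N ?v "differential c X (chart_inv c y) (axis i 1)"] by simp
      also have "\<dots> \<le> D * sqrt (\<phi> y)"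
        using v \<phi>(2)[OF y] by (intro mult_right_mono) auto
      finally show ?thesis .
    qed
    then have "\<bar>\<Sum>i\<in>UNIV. pd i ?\<psi> y * (P y * \<xi> i y)\<bar> \<le> (\<Sum>i\<in>UNIV. \<bar>pd i ?\<psi> y\<bar> * (P y * (D * sqrt (\<phi> y))))"
      using Ppos[OF y] by (intro order_trans[OF sum_abs] sum_mono) (auto simp: abs_mult intro!: mult_left_mono)
    also have "\<dots> = D * ((\<Sum>i\<in>UNIV. \<bar>pd i ?\<psi> y\<bar>) * (P y * sqrt (\<phi> y)))"
      by (simp add: sum_distrib_left sum_distrib_right mult_ac)
    also have "\<dots> \<le> D * b"
      unfolding dens'[OF y] using b[OF True] D(2) by (intro mult_left_mono) auto
    finally have 1: "- (D * b) \<le> (\<Sum>i\<in>UNIV. pd i ?\<psi> y * (P y * \<xi> i y))"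
      by linarith
    have "?\<psi> y * (sqrt (\<phi> y) ^ CARD('m) * (?m * ((1 - D\<^sup>2 * H2 (chart_inv c y)) / 2))) \<le>
      ?\<psi> y * (sqrt (\<phi> y) ^ CARD('m) * (?m * (1 + (\<Sum>l<N. ?v l * ?H y l))))"
      using H \<phi>(2)[OF y] by (intro mult_left_mono radial_bump_nonneg zero_le_power) auto
    with 1 show ?thesis
      using True y by (simp add: F_eq[OF y] dens[OF y] \<Psi>_def \<Theta>_def) (simp add: algebra_simps diff_divide_distrib)
  qed
  have "(LINT y|lborel. ?m / 2 * \<Psi> y - ?m * D\<^sup>2 / 2 * \<Theta> y - D * b * indicator (cball z R) y) \<le> (LINT y|lborel. F y)"
    using lower by (intro integral_mono F(1) Bochner_Integration.integrable_diff integrable_mult_right int\<Psi> int\<Theta> intb)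
  moreover have "(LINT y|lborel. ?m / 2 * \<Psi> y - ?m * D\<^sup>2 / 2 * \<Theta> y - D * b * indicator (cball z R) y) =
      ?m / 2 * (LINT y|lborel. \<Psi> y) - ?m * D\<^sup>2 / 2 * (LINT y|lborel. \<Theta> y) - D * b * measure lborel (cball z R)"
    by (subst Bochner_Integration.integral_diff Bochner_Integration.integral_diff,
        (intro Bochner_Integration.integrable_diff integrable_mult_right int\<Psi> int\<Theta> intb)+)+ simp
  ultimately have "?m / 2 * (LINT y|lborel. \<Psi> y) \<le> ?m * D\<^sup>2 / 2 * (LINT y|lborel. \<Theta> y) + D * b * measure lborel (cball z R)"
    using F(2) by simp
  also have "(LINT y|lborel. \<Theta> y) \<le> (LINT q|RV g. H2 q)"
  proof -
    have "ennreal (LINT y|lborel. \<Theta> y) = (\<integral>\<^sup>+y. ennreal (\<Theta> y) \<partial>lborel)"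
      using \<phi>(2) radial_bump_nonneg
      by (intro nn_integral_eq_integral[symmetric] int\<Theta>) (auto simp: \<Theta>_def H2_nonneg less_imp_le intro!: AE_I2 mult_nonneg_nonneg zero_le_power)
    also have "\<dots> \<le> (\<integral>\<^sup>+y. indicator (chart_image c) y * (ennreal (vol_density g c y) * ennreal (H2 (chart_inv c y))) \<partial>lborel)"
    proof (rule nn_integral_mono)
      fix y
      show "ennreal (\<Theta> y) \<le> indicator (chart_image c) y * (ennreal (vol_density g c y) * ennreal (H2 (chart_inv c y)))"
      proof (cases "y \<in> W")
        case True
        have "vol_density g c y = sqrt (\<phi> y) ^ CARD('m)"
          by (simp add: vol_density_def conf[OF True] det_scaleR real_sqrt_power)
        moreover have "?\<psi> y * (sqrt (\<phi> y) ^ CARD('m) * H2 (chart_inv c y)) \<le> sqrt (\<phi> y) ^ CARD('m) * H2 (chart_inv c y)"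
          using \<phi>(2)[OF True] by (intro mult_left_le_one_le radial_bump_nonneg radial_bump_le_1) (auto simp: H2_nonneg)
        ultimately show ?thesis
          using True W(2) \<phi>(2)[OF True] by (auto simp: \<Theta>_def H2_nonneg simp flip: ennreal_mult intro!: ennreal_leI)
      qed (simp add: \<Theta>_def)
    qed
    also have "\<dots> \<le> ennreal (LINT q|RV g. H2 q)"
      by (rule integral_H2_chart_le[OF fin c])
    finally show ?thesis
      by (subst (asm) ennreal_le_iff) (auto intro: integral_nonneg_AE simp: H2_nonneg)
  qed
  finally show "?m / 2 * (LINT y|lborel. \<Psi> y) \<le> ?m * D\<^sup>2 / 2 * (LINT q|RV g. H2 q) + D * b * measure lborel (cball z R)"
    by (simp add: mult_left_mono)
qed

end

section \<open>The grid metrics\<close>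

text \<open>Convexity of the power in the form of a tangent line, which is affine in x and can thus
  be integrated when only the mean of x is known.\<close>

lemma power_tangent_le:
  fixes x t :: real
  assumes "x \<ge> 0" "t \<ge> 0"
  shows "t ^ n + real n * t ^ (n - 1) * (x - t) \<le> x ^ n"
proof (induction n)
  case (Suc n)
  show ?case
  proof (cases n)
    case (Suc k)
    have "t ^ Suc n + real (Suc n) * t ^ n * (x - t) = x * (t ^ n + real n * t ^ (n - 1) * (x - t)) - real n * t ^ (n - 1) * (x - t)\<^sup>2"
      by (simp add: Suc power2_eq_square algebra_simps)
    also have "\<dots> \<le> x * x ^ n - 0"
      using Suc.IH assms by (intro diff_mono mult_left_mono) auto
    finally show ?thesis by simp
  qed simp
qed simp

lemma Ck_on_cos: "open S \<Longrightarrow> Ck_on k S u \<Longrightarrow> Ck_on k S (\<lambda>y. cos (u y))"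
  using Ck_on_sin[of S k "\<lambda>y. u y + pi / 2"] Ck_on_add[of S k u "\<lambda>_. pi / 2"] by (simp add: Ck_on_const sin_add)

lemma pd_sin_linear: "pd i (\<lambda>y. sin (\<omega> * (y $ j - a))) (y :: real^'m::finite) = (if i = j then \<omega> * cos (\<omega> * (y $ j - a)) else 0)"
proof -
  have "((\<lambda>y. sin (\<omega> * (y $ j - a))) has_derivative (\<lambda>v. cos (\<omega> * (y $ j - a)) * (\<omega> * v $ j))) (at y)"
    by (auto intro!: derivative_eq_intros bounded_linear_imp_has_derivative[OF bounded_linear_vec_nth])
  from pd_eqI[OF this] show ?thesis by (auto simp: axis_def)
qed

text \<open>Integration by parts in the i-th variable, on which \<open>G\<close> does not depend:
  the cosine is the derivative of a sine divided by \<open>\<omega>\<close>, and the derivative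
  falls on the cutoff alone.\<close>

lemma oscillating_integral_le:
  fixes z :: "real^'m::finite"
  assumes R: "R > 0" and G: "Ck_on 1 UNIV G" "\<And>y. pd i G y = 0" "\<And>y. \<bar>G y\<bar> \<le> 2" and \<omega>: "\<omega> > 0"
  shows "integrable lborel (\<lambda>y. radial_bump z R y * G y * cos (\<omega> * (y $ i - z $ i)))"
    and "\<bar>LINT y|lborel. radial_bump z R y * G y * cos (\<omega> * (y $ i - z $ i))\<bar> \<le> 2 / \<omega> * (LINT y|lborel. \<bar>pd i (radial_bump z R) y\<bar>)"
proof -
  let ?\<psi> = "radial_bump z R" and ?s = "\<lambda>y::real^'m. sin (\<omega> * (y $ i - z $ i))" and ?c = "\<lambda>y::real^'m. cos (\<omega> * (y $ i - z $ i))"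
  have lin1: "Ck_on 1 UNIV (\<lambda>y::real^'m. \<omega> * (y $ i - z $ i))"
    by (intro Ck_on_mult Ck_on_const Ck_on_diff_const Ck_on_nth open_UNIV)
  have s1: "Ck_on 1 UNIV ?s" and c1: "Ck_on 1 UNIV ?c"
    by (intro Ck_on_sin Ck_on_cos lin1 open_UNIV)+
  note \<psi>1 = Ck_radial_bump[of 1 z R]
  have \<psi>0: "?\<psi> y = 0" if "y \<notin> cball z R" for y
    using that R by (intro radial_bump_eq_0) auto
  have diff: "?\<psi> differentiable (at y)" "G differentiable (at y)" "?s differentiable (at y)" for y
    using \<psi>1 G(1) s1 by simp_all
  let ?v = "\<lambda>y. ?\<psi> y * G y * ?s y"
  have v1: "Ck_on 1 UNIV ?v"
    by (intro Ck_on_mult \<psi>1 G s1 open_UNIV)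
  have pdv: "pd i ?v y = pd i ?\<psi> y * G y * ?s y + \<omega> * (?\<psi> y * G y * ?c y)" for y
    by (simp add: pd_mult[OF differentiable_mult[OF diff(1) diff(2)] diff(3)] pd_mult[OF diff(1) diff(2)] G(2) pd_sin_linear)
  have pd\<psi>: "continuous_on UNIV (pd i ?\<psi>)"
    using \<psi>1 by simp
  have pd\<psi>0: "pd i ?\<psi> y = 0" if "y \<notin> cball z R" for y
    using \<psi>0 that by (rule pd_eq_0_outside)
  note cont = Ck_on_imp_continuous_on[OF \<psi>1] Ck_on_imp_continuous_on[OF G(1)] Ck_on_imp_continuous_on[OF s1] Ck_on_imp_continuous_on[OF c1]
  show int: "integrable lborel (\<lambda>y. ?\<psi> y * G y * ?c y)"
    by (rule integrable_continuous_compact_support[of _ z R]) (auto intro!: continuous_on_mult cont simp: \<psi>0)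
  have int1: "integrable lborel (\<lambda>y. pd i ?\<psi> y * G y * ?s y)"
    by (rule integrable_continuous_compact_support[of _ z R]) (auto intro!: continuous_on_mult cont pd\<psi> simp: pd\<psi>0)
  have int2: "integrable lborel (\<lambda>y. \<bar>pd i ?\<psi> y\<bar>)"
    by (rule integrable_continuous_compact_support[of _ z R]) (auto intro!: continuous_intros pd\<psi> simp: pd\<psi>0)
  have "0 = (LINT y|lborel. pd i ?v y)"
    by (rule integral_pd_eq_0(2)[OF v1, of z R, symmetric]) (simp add: \<psi>0)
  also have "\<dots> = (LINT y|lborel. pd i ?\<psi> y * G y * ?s y) + \<omega> * (LINT y|lborel. ?\<psi> y * G y * ?c y)"
    unfolding pdv using int1 int by simp
  finally have "(LINT y|lborel. pd i ?\<psi> y * G y * ?s y) = - (\<omega> * (LINT y|lborel. ?\<psi> y * G y * ?c y))"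
    by linarith
  then have eq: "\<omega> * \<bar>LINT y|lborel. ?\<psi> y * G y * ?c y\<bar> = \<bar>LINT y|lborel. pd i ?\<psi> y * G y * ?s y\<bar>"
    using \<omega> by (simp add: abs_mult)
  have "\<bar>LINT y|lborel. pd i ?\<psi> y * G y * ?s y\<bar> \<le> (LINT y|lborel. \<bar>pd i ?\<psi> y * G y * ?s y\<bar>)"
    by (rule integral_abs_bound)
  also have "\<dots> \<le> (LINT y|lborel. 2 * \<bar>pd i ?\<psi> y\<bar>)"
  proof (rule integral_mono)
    fix y
    have "\<bar>G y\<bar> * \<bar>?s y\<bar> \<le> 2 * 1"
      using G(3)[of y] by (intro mult_mono) auto
    then have "\<bar>pd i ?\<psi> y\<bar> * (\<bar>G y\<bar> * \<bar>?s y\<bar>) \<le> \<bar>pd i ?\<psi> y\<bar> * (2 * 1)"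
      by (rule mult_left_mono) simp
    then show "\<bar>pd i ?\<psi> y * G y * ?s y\<bar> \<le> 2 * \<bar>pd i ?\<psi> y\<bar>"
      by (simp add: abs_mult mult_ac)
  qed (use int1 int2 in auto)
  finally have "\<omega> * \<bar>LINT y|lborel. ?\<psi> y * G y * ?c y\<bar> \<le> 2 * (LINT y|lborel. \<bar>pd i ?\<psi> y\<bar>)"
    using int2 by (simp add: eq)
  then show "\<bar>LINT y|lborel. ?\<psi> y * G y * ?c y\<bar> \<le> 2 / \<omega> * (LINT y|lborel. \<bar>pd i ?\<psi> y\<bar>)"
    using \<omega> by (simp add: field_simps)
qed

text \<open>Vanishes on the walls \<open>y\<^sub>i - z\<^sub>i \<in> \<epsilon>\<int>\<close> and \<open>y\<^sub>j - z\<^sub>j \<in> \<epsilon>\<int>\<close> of a grid, and has mean 1/4 up to \<open>O(\<epsilon>)\<close>.\<close>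

definition grid_profile :: "real^'m::finite \<Rightarrow> 'm \<Rightarrow> 'm \<Rightarrow> real \<Rightarrow> real^'m \<Rightarrow> real" where
  "grid_profile z i j \<epsilon> y = (sin (pi / \<epsilon> * (y $ i - z $ i)) * sin (pi / \<epsilon> * (y $ j - z $ j)))\<^sup>2"

lemma grid_profile_nonneg: "0 \<le> grid_profile z i j \<epsilon> y"
  by (simp add: grid_profile_def)

lemma grid_profile_le_1: "grid_profile z i j \<epsilon> y \<le> 1"
proof -
  have "\<bar>sin (pi / \<epsilon> * (y $ i - z $ i)) * sin (pi / \<epsilon> * (y $ j - z $ j))\<bar> \<le> 1 * 1"
    unfolding abs_mult by (intro mult_mono) auto
  then show ?thesis
    by (simp add: grid_profile_def abs_square_le_1)
qed

lemma Ck_grid_profile: "Ck_on k UNIV (grid_profile z i j \<epsilon>)"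
  unfolding grid_profile_def[abs_def] power2_eq_square
  by (intro Ck_on_mult Ck_on_sin Ck_on_const Ck_on_diff_const Ck_on_nth open_UNIV)

text \<open>The constant Fourier term is the mean 1/4. The other terms are grouped into a cosine of
  one variable times a factor independent of that variable, as
  \<open>oscillating_integral_le\<close> requires.\<close>

lemma grid_profile_eq:
  "grid_profile z i j \<epsilon> y = 1 / 4 - 1 / 4 * cos (2 * pi / \<epsilon> * (y $ i - z $ i))
     - 1 / 4 * ((1 - cos (2 * pi / \<epsilon> * (y $ i - z $ i))) * cos (2 * pi / \<epsilon> * (y $ j - z $ j)))"
proof -
  have half: "(sin x)\<^sup>2 = (1 - cos (2 * x)) / 2" for x :: real
    by (simp add: cos_double_sin)
  have "(sin x * sin x')\<^sup>2 = 1 / 4 - 1 / 4 * cos (2 * x) - 1 / 4 * ((1 - cos (2 * x)) * cos (2 * x'))" for x x' :: real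
    unfolding power_mult_distrib half by (simp add: field_simps)
  from this[of "pi / \<epsilon> * (y $ i - z $ i)" "pi / \<epsilon> * (y $ j - z $ j)"] show ?thesis
    by (simp add: grid_profile_def mult.assoc)
qed

text \<open>The frequency is \<open>2 * pi / \<epsilon>\<close>, so both oscillating integrals are
  O(\<epsilon>). The indices must differ for the factor \<open>G\<close> to be constant in the j-th
  variable.\<close>

lemma grid_profile_mean:
  fixes z :: "real^'m::finite"
  assumes R: "R > 0" and ij: "i \<noteq> j"
  shows "\<exists>C\<ge>0. \<forall>\<epsilon>>0. integrable lborel (\<lambda>y. radial_bump z R y * grid_profile z i j \<epsilon> y) \<and>
    (LINT y|lborel. radial_bump z R y) / 4 - C * \<epsilon> \<le> (LINT y|lborel. radial_bump z R y * grid_profile z i j \<epsilon> y)"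
proof -
  let ?\<psi> = "radial_bump z R"
  define C where "C = (LINT y|lborel. \<bar>pd i ?\<psi> y\<bar>) + (LINT y|lborel. \<bar>pd j ?\<psi> y\<bar>)"
  have C: "C \<ge> 0" by (simp add: C_def)
  have \<psi>: "integrable lborel ?\<psi>"
    by (rule integrable_continuous_compact_support[of _ z R])
       (use R in \<open>auto intro!: radial_bump_eq_0 Ck_on_imp_continuous_on[OF Ck_radial_bump]\<close>)
  have "integrable lborel (\<lambda>y. ?\<psi> y * grid_profile z i j \<epsilon> y) \<and>
    (LINT y|lborel. ?\<psi> y) / 4 - C * \<epsilon> \<le> (LINT y|lborel. ?\<psi> y * grid_profile z i j \<epsilon> y)" if \<epsilon>: "\<epsilon> > 0" for \<epsilon>
  proof -
    define \<omega> where "\<omega> = 2 * pi / \<epsilon>"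
    have \<omega>: "\<omega> > 0" using \<epsilon> by (simp add: \<omega>_def)
    define G where "G y = 1 - cos (\<omega> * (y $ i - z $ i))" for y :: "real^'m"
    have "Ck_on 1 UNIV (\<lambda>y::real^'m. 1 + (-1) * cos (\<omega> * (y $ i - z $ i)))"
      by (intro Ck_on_add Ck_on_mult Ck_on_cos Ck_on_const Ck_on_diff_const Ck_on_nth open_UNIV)
    then have G1: "Ck_on 1 UNIV G" by (simp add: G_def[abs_def])
    have pdG: "pd j G y = 0" for y
    proof -
      have "(G has_derivative (\<lambda>v. sin (\<omega> * (y $ i - z $ i)) * (\<omega> * v $ i))) (at y)"
        unfolding G_def by (auto intro!: derivative_eq_intros bounded_linear_imp_has_derivative[OF bounded_linear_vec_nth])
      from pd_eqI[OF this] show ?thesis using ij by (simp add: axis_def)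
    qed
    have G2: "\<bar>G y\<bar> \<le> 2" for y
      using cos_ge_minus_one[of "\<omega> * (y $ i - z $ i)"] cos_le_one[of "\<omega> * (y $ i - z $ i)"] unfolding G_def by linarith
    note o1 = oscillating_integral_le[OF R Ck_on_const[of 1 UNIV 1] _ _ \<omega>, of i z]
    note o2 = oscillating_integral_le[OF R G1 pdG G2 \<omega>, of z]
    have pd1: "pd i (\<lambda>_. 1) y = 0" for y :: "real^'m"
      by (simp add: pd_eqI[OF has_derivative_const])
    have i1: "integrable lborel (\<lambda>y. ?\<psi> y * 1 * cos (\<omega> * (y $ i - z $ i)))"
      and b1: "\<bar>LINT y|lborel. ?\<psi> y * 1 * cos (\<omega> * (y $ i - z $ i))\<bar> \<le> 2 / \<omega> * (LINT y|lborel. \<bar>pd i ?\<psi> y\<bar>)"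
      using o1 pd1 by simp_all
    have eq: "?\<psi> y * grid_profile z i j \<epsilon> y = ?\<psi> y / 4 - (?\<psi> y * 1 * cos (\<omega> * (y $ i - z $ i))) / 4
        - (?\<psi> y * G y * cos (\<omega> * (y $ j - z $ j))) / 4" for y
    proof -
      have "p * (1 / 4 - 1 / 4 * a - 1 / 4 * ((1 - a) * b)) = p / 4 - (p * 1 * a) / 4 - (p * (1 - a) * b) / 4" for p a b :: real
        by (simp add: field_simps)
      then show ?thesis
        by (simp only: grid_profile_eq G_def \<omega>_def)
    qed
    have "integrable lborel (\<lambda>y. ?\<psi> y * grid_profile z i j \<epsilon> y)"
      unfolding eq using \<psi> i1 o2(1) by (intro Bochner_Integration.integrable_diff) auto
    moreover have "(LINT y|lborel. ?\<psi> y * grid_profile z i j \<epsilon> y) = (LINT y|lborel. ?\<psi> y) / 4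
        - (LINT y|lborel. ?\<psi> y * 1 * cos (\<omega> * (y $ i - z $ i))) / 4 - (LINT y|lborel. ?\<psi> y * G y * cos (\<omega> * (y $ j - z $ j))) / 4"
      unfolding eq using \<psi> i1 o2(1) by simp
    moreover have "2 / \<omega> * (LINT y|lborel. \<bar>pd i ?\<psi> y\<bar>) + 2 / \<omega> * (LINT y|lborel. \<bar>pd j ?\<psi> y\<bar>) \<le> 4 * (C * \<epsilon>)"
    proof -
      have "2 / \<omega> * (LINT y|lborel. \<bar>pd i ?\<psi> y\<bar>) + 2 / \<omega> * (LINT y|lborel. \<bar>pd j ?\<psi> y\<bar>) = \<epsilon> / pi * C"
        using \<epsilon> by (simp add: C_def \<omega>_def field_simps)
      also have "\<dots> \<le> 4 * \<epsilon> * C"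
        using \<epsilon> C pi_gt3 by (intro mult_right_mono) (auto simp: divide_le_eq)
      finally show ?thesis by (simp add: mult_ac)
    qed
    ultimately show ?thesis
      using b1 o2(2) by linarith
  qed
  with C show ?thesis by blast
qed

section \<open>Distances and volumes for a grid metric\<close>

context immersed
begin

lemma distance_le_conformal:
  assumes c: "c \<in> A" and W: "W \<subseteq> chart_image c"
    and conf: "\<And>y. y \<in> W \<Longrightarrow> g c (chart_inv c y) = \<phi> y *\<^sub>R mat 1"
    and seg: "\<And>t. 0 \<le> t \<Longrightarrow> t \<le> 1 \<Longrightarrow> y + t *\<^sub>R v \<in> W \<and> \<phi> (y + t *\<^sub>R v) \<le> B\<^sup>2" and B: "B \<ge> 0"
  shows "eucl_norm N (\<lambda>l. X (chart_inv c (y + v)) l - X (chart_inv c y) l) \<le> B * norm v"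
proof (rule distance_le_segment[OF c])
  fix t :: real assume t: "0 \<le> t" "t \<le> 1"
  let ?y = "y + t *\<^sub>R v"
  show yc: "?y \<in> chart_image c" using seg[OF t] W by auto
  have "eucl_norm N (differential c X (chart_inv c ?y) v) = sqrt (\<phi> ?y * (norm v)\<^sup>2)"
    using seg[OF t] by (simp add: eucl_norm_def inner_differential[OF c chart_inv_in[OF yc]] conf power2_norm_eq_inner
        flip: scaleR_matrix_vector_assoc)
  also have "\<dots> \<le> sqrt (B\<^sup>2 * (norm v)\<^sup>2)"
    using seg[OF t] by (intro real_sqrt_le_mono mult_right_mono) auto
  finally show "eucl_norm N (differential c X (chart_inv c ?y) v) \<le> B * norm v"
    using B by (simp add: real_sqrt_mult)
qed

text \<open>A point is joined to \<open>z\<close> by a short step to a wall of the grid and three segments inside walls.\<close>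

lemma distance_to_centre_le:
  assumes c: "c \<in> A" and R: "R > 0" "ball z R \<subseteq> chart_image c" and ij: "i \<noteq> j"
    and conf: "\<And>y. y \<in> ball z R \<Longrightarrow> g c (chart_inv c y) = \<phi> y *\<^sub>R mat 1"
    and le: "\<And>y. y \<in> ball z R \<Longrightarrow> \<phi> y \<le> s\<^sup>2 * (\<epsilon>\<^sup>2 + grid_profile z i j \<epsilon> y)"
    and s: "s > 0" and \<epsilon>: "0 < \<epsilon>" "\<epsilon> \<le> 1" and y: "y \<in> ball z R"
  shows "eucl_norm N (\<lambda>l. X (chart_inv c y) l - X (chart_inv c z) l) \<le> s * \<epsilon> * (2 + 3 * R)"
proof -
  let ?S = "grid_profile z i j \<epsilon>"
  define dist' where "dist' a b = eucl_norm N (\<lambda>l. X (chart_inv c a) l - X (chart_inv c b) l)" for a b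
  have tri: "dist' a d \<le> dist' a b + dist' b d" for a b d
    using eucl_norm_triangle[of N "\<lambda>l. X (chart_inv c a) l - X (chart_inv c b) l" "\<lambda>l. X (chart_inv c b) l - X (chart_inv c d) l"]
    by (simp add: dist'_def)
  have sym: "dist' a b = dist' b a" for a b
    by (simp add: dist'_def eucl_norm_def eucl_inner_def algebra_simps)
  \<comment> \<open>All points of the path arise from \<open>y\<close> by moving coordinates towards
    those of \<open>z\<close>, which never leaves the ball.\<close>
  have inball: "w \<in> ball z R" if "\<And>k. \<bar>w $ k - z $ k\<bar> \<le> \<bar>y $ k - z $ k\<bar>" for w
  proof -
    have "norm (w - z) \<le> norm (y - z)"
      using that by (intro norm_le_componentwise_cart) auto
    then show ?thesis using y by (simp add: dist_norm norm_minus_commute)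
  qed
  have comp: "\<bar>y $ k - z $ k\<bar> \<le> R" for k
    using y component_le_norm_cart[of "y - z" k] by (simp add: dist_norm norm_minus_commute)
  define d where "d = y $ i - z $ i"
  define n where "n = \<lfloor>\<bar>d\<bar> / \<epsilon>\<rfloor>"
  \<comment> \<open>The wall coordinate next to \<open>d\<close> on the side of 0: an integer
    multiple of \<open>\<epsilon>\<close> at distance at most \<open>\<epsilon>\<close>.\<close>
  define d' where "d' = sgn d * (\<epsilon> * of_int n)"
  have n: "n \<ge> 0" "\<epsilon> * of_int n \<le> \<bar>d\<bar>" "\<bar>d\<bar> \<le> \<epsilon> * of_int n + \<epsilon>"
  proof -
    show "n \<ge> 0" using \<epsilon> by (simp add: n_def)
    have "of_int n \<le> \<bar>d\<bar> / \<epsilon>" "\<bar>d\<bar> / \<epsilon> \<le> of_int n + 1"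
      unfolding n_def by linarith+
    then show "\<epsilon> * of_int n \<le> \<bar>d\<bar>" "\<bar>d\<bar> \<le> \<epsilon> * of_int n + \<epsilon>"
      using \<epsilon> by (simp_all add: field_simps)
  qed
  have dd': "\<bar>d - d'\<bar> \<le> \<epsilon>" and d'_between: "\<bar>d' + t * (d - d')\<bar> \<le> \<bar>d\<bar>" if "0 \<le> t" "t \<le> 1" for t
  proof -
    have "d = sgn d * \<bar>d\<bar>" by (simp add: sgn_mult_abs)
    then have eq: "d - d' = sgn d * (\<bar>d\<bar> - \<epsilon> * of_int n)"
      by (simp add: d'_def right_diff_distrib)
    have nonneg: "0 \<le> \<bar>d\<bar> - \<epsilon> * of_int n" "0 \<le> \<epsilon> * of_int n"
      using n \<epsilon> by auto
    show "\<bar>d - d'\<bar> \<le> \<epsilon>"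
      unfolding eq abs_mult using nonneg n \<epsilon> by (auto simp: abs_sgn_eq)
    have "d' + t * (d - d') = sgn d * (\<epsilon> * of_int n + t * (\<bar>d\<bar> - \<epsilon> * of_int n))"
      unfolding eq by (simp add: d'_def algebra_simps)
    moreover have "\<epsilon> * of_int n + t * (\<bar>d\<bar> - \<epsilon> * of_int n) \<le> \<epsilon> * of_int n + 1 * (\<bar>d\<bar> - \<epsilon> * of_int n)"
      using that nonneg by (intro add_left_mono mult_right_mono) auto
    moreover have "0 \<le> \<epsilon> * of_int n + t * (\<bar>d\<bar> - \<epsilon> * of_int n)"
      using add_nonneg_nonneg[OF nonneg(2) mult_nonneg_nonneg[OF that(1) nonneg(1)]] .
    ultimately show "\<bar>d' + t * (d - d')\<bar> \<le> \<bar>d\<bar>"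
      by (auto simp: abs_mult abs_sgn_eq)
  qed
  have wall_i: "?S w = 0" if "w $ i - z $ i = d'" for w
  proof -
    have "sin (pi / \<epsilon> * d') = 0"
    proof -
      have "pi / \<epsilon> * d' = sgn d * (of_int n * pi)" using \<epsilon> by (simp add: d'_def)
      then show ?thesis
        by (cases "d > 0"; cases "d = 0") (auto simp: sgn_if sin_zero_iff_int2)
    qed
    then show ?thesis by (simp add: grid_profile_def that)
  qed
  have wall_j: "?S w = 0" if "w $ j = z $ j" for w
    using that by (simp add: grid_profile_def)
  \<comment> \<open>From \<open>y\<close> to \<open>y1\<close> the path crosses a cell, with
    conformal factor at most the square of \<open>2 * s\<close> but length at most
    \<open>\<epsilon>\<close>. It goes on to \<open>y2\<close> in the wall through \<open>y1\<close>
    orthogonal to the i-th axis, and from there through \<open>y3\<close> to \<open>z\<close> in the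
    wall where the j-th coordinate is that of \<open>z\<close>.\<close>
  define y1 where "y1 = y - (d - d') *\<^sub>R axis i 1"
  define y2 where "y2 = y1 - (y $ j - z $ j) *\<^sub>R axis j 1"
  define y3 where "y3 = y2 - d' *\<^sub>R axis i 1"
  have y1: "y1 $ k = (if k = i then z $ i + d' else y $ k)" for k
    by (simp add: y1_def axis_def d_def)
  have y2: "y2 $ k = (if k = i then z $ i + d' else if k = j then z $ j else y $ k)" for k
    using ij by (simp add: y2_def y1 axis_def)
  have y3: "y3 $ k = (if k = i then z $ i else if k = j then z $ j else y $ k)" for k
    using ij by (simp add: y3_def y2 axis_def)
  have d'_le: "\<bar>d'\<bar> \<le> \<bar>d\<bar>"
    using d'_between[of 0] by simp
  have s\<epsilon>: "s * \<epsilon> \<ge> 0" using s \<epsilon> by simp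
  have step: "dist' (a + v) a \<le> s * \<epsilon> * norm v"
    if "\<And>t. 0 \<le> t \<Longrightarrow> t \<le> 1 \<Longrightarrow> a + t *\<^sub>R v \<in> ball z R \<and> ?S (a + t *\<^sub>R v) = 0" for a v
    unfolding dist'_def
  proof (rule distance_le_conformal[OF c R(2) conf _ s\<epsilon>])
    fix t :: real assume "0 \<le> t" "t \<le> 1"
    then show "a + t *\<^sub>R v \<in> ball z R \<and> \<phi> (a + t *\<^sub>R v) \<le> (s * \<epsilon>)\<^sup>2"
      using that[of t] le[of "a + t *\<^sub>R v"] by (simp add: power_mult_distrib)
  qed
  have 1: "dist' y y1 \<le> s * \<epsilon> * 2"
  proof -
    have "dist' (y1 + (d - d') *\<^sub>R axis i 1) y1 \<le> s * 2 * norm ((d - d') *\<^sub>R axis i (1 :: real))"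
      unfolding dist'_def
    proof (rule distance_le_conformal[OF c R(2) conf])
      fix t :: real assume t: "0 \<le> t" "t \<le> 1"
      let ?w = "y1 + t *\<^sub>R (d - d') *\<^sub>R axis i 1"
      have w: "?w \<in> ball z R"
      proof (rule inball)
        fix k show "\<bar>?w $ k - z $ k\<bar> \<le> \<bar>y $ k - z $ k\<bar>"
          using d'_between[OF t] by (auto simp: y1 axis_def d_def)
      qed
      have "\<epsilon>\<^sup>2 + ?S ?w \<le> 1 + 1"
        using \<epsilon> by (intro add_mono grid_profile_le_1 power_le_one) auto
      then have "s\<^sup>2 * (\<epsilon>\<^sup>2 + ?S ?w) \<le> s\<^sup>2 * 4"
        by (intro mult_left_mono) auto
      then show "?w \<in> ball z R \<and> \<phi> ?w \<le> (s * 2)\<^sup>2"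
        using w le[OF w] by (simp add: power_mult_distrib)
    qed (use s in auto)
    also have "\<dots> \<le> s * 2 * \<epsilon>"
      using dd'[of 0] s by (intro mult_left_mono) auto
    finally show ?thesis by (simp add: y1_def mult_ac)
  qed
  have 2: "dist' y1 y2 \<le> s * \<epsilon> * R"
  proof -
    have "dist' (y2 + (y $ j - z $ j) *\<^sub>R axis j 1) y2 \<le> s * \<epsilon> * norm ((y $ j - z $ j) *\<^sub>R axis j (1 :: real))"
    proof (rule step, rule conjI)
      fix t :: real assume t: "0 \<le> t" "t \<le> 1"
      have "\<bar>t * (y $ j - z $ j)\<bar> \<le> \<bar>y $ j - z $ j\<bar>"
        using t by (simp add: abs_mult mult_left_le_one_le)
      then show "y2 + t *\<^sub>R (y $ j - z $ j) *\<^sub>R axis j 1 \<in> ball z R"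
        using d'_le ij by (intro inball) (auto simp: y2 axis_def d_def)
      show "?S (y2 + t *\<^sub>R (y $ j - z $ j) *\<^sub>R axis j 1) = 0"
        using ij by (intro wall_i) (simp add: y2 axis_def)
    qed
    also have "\<dots> \<le> s * \<epsilon> * R"
      using comp[of j] s\<epsilon> by (intro mult_left_mono) auto
    finally show ?thesis by (simp add: y2_def)
  qed
  have 3: "dist' y2 y3 \<le> s * \<epsilon> * R"
  proof -
    have "dist' (y3 + d' *\<^sub>R axis i 1) y3 \<le> s * \<epsilon> * norm (d' *\<^sub>R axis i (1 :: real))"
    proof (rule step, rule conjI)
      fix t :: real assume t: "0 \<le> t" "t \<le> 1"
      have "\<bar>t * d'\<bar> \<le> \<bar>d'\<bar>"
        using t by (simp add: abs_mult mult_left_le_one_le)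
      then show "y3 + t *\<^sub>R d' *\<^sub>R axis i 1 \<in> ball z R"
        using d'_le ij by (intro inball) (auto simp: y3 axis_def d_def)
      show "?S (y3 + t *\<^sub>R d' *\<^sub>R axis i 1) = 0"
        using ij by (intro wall_j) (simp add: y3 axis_def)
    qed
    also have "\<dots> \<le> s * \<epsilon> * R"
      using comp[of i] d'_le s\<epsilon> by (intro mult_left_mono) (auto simp: d_def)
    finally show ?thesis by (simp add: y3_def)
  qed
  have 4: "dist' y3 z \<le> s * \<epsilon> * R"
  proof -
    have "dist' (z + (y3 - z)) z \<le> s * \<epsilon> * norm (y3 - z)"
    proof (rule step, rule conjI)
      fix t :: real assume t: "0 \<le> t" "t \<le> 1"
      show "z + t *\<^sub>R (y3 - z) \<in> ball z R"
        using t by (intro inball) (auto simp: y3 abs_mult mult_left_le_one_le)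
      show "?S (z + t *\<^sub>R (y3 - z)) = 0"
        using ij by (intro wall_j) (simp add: y3)
    qed
    also have "\<dots> \<le> s * \<epsilon> * R"
    proof (rule mult_left_mono[OF _ s\<epsilon>])
      have "norm (y3 - z) \<le> norm (y - z)"
        by (intro norm_le_componentwise_cart) (auto simp: y3)
      then show "norm (y3 - z) \<le> R"
        using y by (simp add: dist_norm norm_minus_commute)
    qed
    finally show ?thesis by simp
  qed
  have "dist' y z \<le> s * \<epsilon> * 2 + s * \<epsilon> * R + s * \<epsilon> * R + s * \<epsilon> * R"
    using tri[of y z y1] tri[of y1 z y2] tri[of y2 z y3] 1 2 3 4 by linarith
  then show ?thesis
    by (simp add: dist'_def algebra_simps)
qed

lemma openin_near:
  "openin T {q \<in> topspace T. eucl_norm N (\<lambda>l. X q l - x0 l) < r}"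
proof -
  have "openin T {q \<in> fst c. eucl_norm N (\<lambda>l. X q l - x0 l) < r}" if c: "c \<in> A" for c
  proof -
    let ?h = "\<lambda>y. eucl_norm N (\<lambda>l. X (chart_inv c y) l - x0 l)"
    have "continuous_on (chart_image c) (\<lambda>y. sqrt (\<Sum>l<N. (local_rep c X l y - x0 l) * (local_rep c X l y - x0 l)))"
      by (intro continuous_intros Ck_on_imp_continuous_on[OF Ck_local_rep[OF c]])
    then have "continuous_on (chart_image c) ?h"
      by (simp add: eucl_norm_def eucl_inner_def local_rep_def)
    from continuous_open_preimage[OF this open_chart_image[OF c] open_lessThan[of r]]
    have "open {y \<in> chart_image c. ?h y < r}"
      by (simp add: Int_def vimage_def)
    from openin_chart_preimage[OF c this]
    have "openin T {q \<in> fst c. snd c q \<in> {y \<in> chart_image c. ?h y < r}}" .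
    moreover have "{q \<in> fst c. snd c q \<in> {y \<in> chart_image c. ?h y < r}} = {q \<in> fst c. eucl_norm N (\<lambda>l. X q l - x0 l) < r}"
      using c by (auto simp: snd_in_image chart_inv_snd)
    ultimately show ?thesis by (simp only:)
  qed
  then have "openin T (\<Union>c\<in>A. {q \<in> fst c. eucl_norm N (\<lambda>l. X q l - x0 l) < r})"
    by (intro openin_Union) auto
  moreover have "{q \<in> topspace T. eucl_norm N (\<lambda>l. X q l - x0 l) < r} = (\<Union>c\<in>A. {q \<in> fst c. eucl_norm N (\<lambda>l. X q l - x0 l) < r})"
    unfolding charts_cover[symmetric] by blast
  ultimately show ?thesis by (simp only:)
qed

lemma portion_volume_ge:
  assumes c: "c \<in> A" and W: "W \<subseteq> chart_image c"
    and near: "\<And>y. y \<in> W \<Longrightarrow> eucl_norm N (\<lambda>l. X (chart_inv c y) l - x0 l) < r"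
    and total: "emeasure (RV g) (topspace T) = 1"
    and v: "ennreal v \<le> (\<integral>\<^sup>+y. ennreal (indicator W y * vol_density g c y) \<partial>lborel)"
  shows "v \<le> portion_volume T A g X (eucl_ball N x0 r)" "portion_volume T A g X (eucl_ball N x0 r) \<le> 1"
proof -
  let ?B = "{q \<in> topspace T. eucl_norm N (\<lambda>l. X q l - x0 l) < r}"
  \<comment> \<open>Openness makes the portion measurable; the \<open>measure\<close> of a
    non-measurable set would be 0 by default.\<close>
  have B: "?B \<in> sets BT"
    by (rule openin_sets[OF openin_near])
  have eq: "portion_volume T A g X (eucl_ball N x0 r) = measure (RV g) ?B"
    unfolding portion_volume_def eucl_ball_def
    by (rule arg_cong[where f = "measure (RV g)"]) (use X_in_E in auto)
  have le1: "emeasure (RV g) ?B \<le> 1"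
    unfolding total[symmetric] by (rule emeasure_mono) (auto simp: openin_sets)
  have "ennreal v \<le> (\<integral>\<^sup>+y. ennreal (indicator W y * vol_density g c y) \<partial>lborel)"
    by (rule v)
  also have "\<dots> \<le> (\<integral>\<^sup>+y. indicator (chart_image c) y * (ennreal (vol_density g c y) * indicator ?B (chart_inv c y)) \<partial>lborel)"
    using W near chart_inv_in_space[OF c] by (intro nn_integral_mono) (auto simp: indicator_def)
  also have "\<dots> = emeasure (chart_volume T g c) ?B"
    by (rule emeasure_chart_volume[OF metric c B, symmetric])
  also have "\<dots> \<le> emeasure (RV g) ?B"
    by (rule emeasure_chart_volume_le_RV[OF c])
  finally have "ennreal v \<le> emeasure (RV g) ?B" .
  also have fin: "emeasure (RV g) ?B = ennreal (measure (RV g) ?B)"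
    using le1 by (intro emeasure_eq_ennreal_measure) (auto simp: top_unique)
  finally show "v \<le> portion_volume T A g X (eucl_ball N x0 r)"
    unfolding eq by (cases "v \<ge> 0") (auto simp: ennreal_le_iff intro: order_trans[OF _ measure_nonneg])
  show "portion_volume T A g X (eucl_ball N x0 r) \<le> 1"
    unfolding eq using le1 unfolding fin by simp
qed

end

lemma integral_radial_bump_pos: "R > 0 \<Longrightarrow> 0 < (LINT y|lborel. radial_bump (z :: real^'m::finite) R y)"
proof -
  assume R: "R > 0"
  let ?b = "bump (R\<^sup>2 - (R / 2)\<^sup>2)"
  have b: "?b > 0" using R by (simp add: bump_pos_iff power_divide)
  have int: "integrable lborel (radial_bump z R)"
    by (rule integrable_continuous_compact_support[of _ z R])
       (use R in \<open>auto intro!: radial_bump_eq_0 Ck_on_imp_continuous_on[OF Ck_radial_bump]\<close>)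
  have "0 < ?b * measure lborel (ball z (R / 2))"
    using b R content_ball_pos[of "R / 2" z] by simp
  also have "\<dots> = (LINT y|lborel. ?b * indicator (ball z (R / 2)) y)"
    by simp
  also have "\<dots> \<le> (LINT y|lborel. radial_bump z R y)"
  proof (rule integral_mono[OF _ int])
    show "integrable lborel (\<lambda>y. ?b * indicator (ball z (R / 2)) y)"
      using emeasure_bounded_finite[of "ball z (R / 2)"] by (intro integrable_mult_right integrable_real_indicator) auto
    fix y
    show "?b * indicator (ball z (R / 2)) y \<le> radial_bump z R y"
    proof (cases "y \<in> ball z (R / 2)")
      case True
      then have "(norm (y - z))\<^sup>2 \<le> (R / 2)\<^sup>2"
        by (intro power_mono) (auto simp: dist_norm norm_minus_commute)
      then show ?thesis using True by (auto simp: radial_bump_eq intro: bump_mono)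
    qed (simp add: radial_bump_nonneg)
  qed
  finally show ?thesis .
qed

section \<open>Existence of grid metrics of volume one\<close>

context compact_manifold
begin

lemma ex_model_chart:
  obtains c0 R z0 I0 where "c0 \<in> A" "R > 0" "cball z0 R \<subseteq> chart_image c0" "finite I0"
    "\<forall>t\<in>I0. valid_patch t \<and> patch_set t \<inter> chart_inv c0 ` cball z0 (R / 2) = {}"
    "\<forall>q\<in>topspace T. (q \<in> fst c0 \<and> snd c0 q \<in> ball z0 R) \<or>
       (\<exists>t\<in>I0. q \<in> fst (patch_chart t) \<and> snd (patch_chart t) q \<in> patch_ball t)"
proof -
  obtain q0 where q0: "q0 \<in> topspace T" using nonempty by blast
  then obtain c0 where c0: "c0 \<in> A" "q0 \<in> fst c0"
    unfolding charts_cover[symmetric] by blast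
  obtain R where R: "R > 0" "cball (snd c0 q0) R \<subseteq> chart_image c0"
    using open_chart_image[OF c0(1)] snd_in_image[OF c0(2)] open_contains_cball by blast
  have "0 < R / 2" "R / 2 < R" using R by auto
  from ex_patches[OF c0(1) R(2) this] obtain I0 where I0: "finite I0"
    "\<forall>t\<in>I0. valid_patch t \<and> patch_set t \<inter> chart_inv c0 ` cball (snd c0 q0) (R / 2) = {}"
    "\<forall>q\<in>topspace T. (q \<in> fst c0 \<and> snd c0 q \<in> ball (snd c0 q0) R) \<or>
       (\<exists>t\<in>I0. q \<in> fst (patch_chart t) \<and> snd (patch_chart t) q \<in> patch_ball t)"
    by (elim exE conjE)
  show thesis
    by (rule that[OF c0(1) R I0])
qed

text \<open>Convexity of \<open>s \<mapsto> s\<^sup>m\<close> at the mean 1/4 of the grid profile bounds the volume from below independently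
  of \<open>\<epsilon>\<close>; it is also bounded above, so normalising the volume to one scales the metric by bounded factors \<open>s\<^sup>2\<close>.\<close>

lemma ex_grid_metrics:
  assumes ij: "i \<noteq> (j :: 'm)"
  obtains c z R S1 c4 where "c \<in> A" "R > 0" "ball z (2 * R) \<subseteq> chart_image c" "S1 > 0" "c4 > 0"
    "\<forall>\<^sub>F \<epsilon> in at_right 0. \<exists>g \<phi> s. riemannian_metric A g \<and> emeasure (RV g) (topspace T) = 1 \<and>
      0 < s \<and> s \<le> S1 \<and> Ck_on 1 UNIV \<phi> \<and>
      (\<forall>y\<in>ball z (2 * R). g c (chart_inv c y) = \<phi> y *\<^sub>R mat 1 \<and> 0 < \<phi> y \<and>
         \<phi> y \<le> s\<^sup>2 * (\<epsilon>\<^sup>2 + grid_profile z i j \<epsilon> y)) \<and>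
      c4 \<le> (LINT y|lborel. (if y \<in> ball z (2 * R) then radial_bump z R y * sqrt (\<phi> y) ^ CARD('m) else 0))"
proof -
  obtain c0 z0 R0 I0 where c0: "c0 \<in> A" and R0: "R0 > 0" "cball z0 R0 \<subseteq> chart_image c0" and I0: "finite I0"
    "\<forall>t\<in>I0. valid_patch t \<and> patch_set t \<inter> chart_inv c0 ` cball z0 (R0 / 2) = {}"
    and cover: "\<forall>q\<in>topspace T. (q \<in> fst c0 \<and> snd c0 q \<in> ball z0 R0) \<or>
       (\<exists>t\<in>I0. q \<in> fst (patch_chart t) \<and> snd (patch_chart t) q \<in> patch_ball t)"
    by (rule ex_model_chart)
  \<comment> \<open>The other patches avoid the closed ball of radius \<open>R0 / 2\<close>, and the
    bump of radius \<open>R0\<close> is bounded below on it. So \<open>W\<close> has radius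
    \<open>R0 / 2\<close>, and the cutoff of radius \<open>R0 / 4\<close> is supported well inside
    \<open>W\<close>.\<close>
  define R where "R = R0 / 4"
  have R: "R > 0" "2 * R = R0 / 2" using R0 by (simp_all add: R_def)
  define W where "W = ball z0 (2 * R)"
  have W: "open W" "cball z0 R \<subseteq> W" "W \<subseteq> chart_image c0" "W \<subseteq> ball z0 R0"
    using R R0 by (auto simp: W_def)
  define t0 where "t0 = (c0, z0, R0)"
  define I where "I = insert t0 I0"
  have valid: "valid_patch t" if "t \<in> I" for t
  proof (cases "t = t0")
    case True
    then show ?thesis using c0 R0 by (simp add: t0_def valid_patch_def)
  next
    case False
    then show ?thesis using that bspec[OF I0(2), of t] by (simp add: I_def)
  qed
  have finI: "finite I" using I0(1) by (simp add: I_def)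
  let ?S = "grid_profile z0 i j" and ?M = "CARD('m)" and ?\<psi> = "radial_bump z0 R"
  \<comment> \<open>All patches carry the small factor \<open>\<epsilon>\<^sup>2\<close>, which
    keeps the sum definite; only the distinguished patch also carries the grid profile, and with it
    a volume that does not shrink with \<epsilon>.\<close>
  define \<phi> where "\<phi> \<epsilon> t y = radial_bump (patch_centre t) (patch_radius t) y * (\<epsilon>\<^sup>2 + (if t = t0 then ?S \<epsilon> y else 0))"
    for \<epsilon> :: real and t :: "('a, 'm) patch" and y
  have fam: "bump_family I (\<lambda>t y. r * \<phi> \<epsilon> t y)" if "\<epsilon> > 0" "r > 0" for \<epsilon> r
  proof -
    have pos: "0 < \<epsilon>\<^sup>2 + (if t = t0 then ?S \<epsilon> y else 0)" for t y
      using that by (auto intro: add_pos_nonneg grid_profile_nonneg)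
    have "Ck_on k UNIV (\<lambda>y. r * \<phi> \<epsilon> t y)" for k t
    proof -
      have "Ck_on k UNIV (\<lambda>y. if t = t0 then ?S \<epsilon> y else 0)"
        by (cases "t = t0") (simp_all add: Ck_grid_profile Ck_on_const)
      then show ?thesis
        unfolding \<phi>_def by (intro Ck_on_mult Ck_on_add Ck_on_const Ck_radial_bump open_UNIV)
    qed
    moreover have "0 \<le> r * \<phi> \<epsilon> t y" for t y
      using that pos[of t y] by (simp add: \<phi>_def radial_bump_nonneg)
    moreover have "0 < r * \<phi> \<epsilon> t y \<longleftrightarrow> y \<in> patch_ball t" if "t \<in> I" for t y
      using \<open>r > 0\<close> pos[of t y] valid[OF that] radial_bump_pos_iff[of "patch_radius t" "patch_centre t" y]
      by (simp add: \<phi>_def zero_less_mult_iff valid_patch_def)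
    moreover have "\<exists>t\<in>I. q \<in> fst (patch_chart t) \<and> snd (patch_chart t) q \<in> patch_ball t" if "q \<in> topspace T" for q
      using bspec[OF cover that] by (auto simp: I_def t0_def)
    ultimately show ?thesis
      using finI valid by (simp add: bump_family_def)
  qed
  define G where "G r \<epsilon> = patch_metric I (\<lambda>t y. r * \<phi> \<epsilon> t y)" for r \<epsilon>
  have metricG: "riemannian_metric A (G r \<epsilon>)" if "\<epsilon> > 0" "r > 0" for r \<epsilon>
    unfolding G_def by (rule riemannian_patch_metric[OF fam[OF that]])
  have confG: "G r \<epsilon> c0 (chart_inv c0 y) = (r * \<phi> \<epsilon> t0 y) *\<^sub>R mat 1" if "\<epsilon> > 0" "r > 0" "y \<in> W" for r \<epsilon> y
  proof -
    have yc: "y \<in> chart_image c0" using that W by auto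
    have "chart_inv c0 y \<in> chart_inv c0 ` cball z0 (R0 / 2)"
      using that(3) R by (auto simp: W_def)
    then have "chart_inv c0 y \<notin> patch_set t" if "t \<in> I" "t \<noteq> t0" for t
      using that bspec[OF I0(2), of t] by (auto simp: I_def)
    then show ?thesis
      using patch_metric_conformal[OF fam[OF that(1,2)], of t0 "chart_inv c0 y"] yc
      by (simp add: G_def I_def t0_def chart_inv_in snd_chart_inv)
  qed
  have \<phi>_pos: "0 < \<phi> \<epsilon> t0 y" if "\<epsilon> > 0" "y \<in> W" for \<epsilon> y
    using that W R0 radial_bump_pos_iff[of R0 z0 y] grid_profile_nonneg[of z0 i j \<epsilon> y]
    by (auto simp: \<phi>_def t0_def intro!: mult_pos_pos add_pos_nonneg)
  have \<phi>_le: "\<phi> \<epsilon> t0 y \<le> \<epsilon>\<^sup>2 + ?S \<epsilon> y" for \<epsilon> y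
    by (simp add: \<phi>_def t0_def mult_left_le_one_le radial_bump_nonneg radial_bump_le_1 grid_profile_nonneg)
  have \<phi>_le2: "\<forall>t\<in>I. \<forall>y. 1 * \<phi> \<epsilon> t y \<le> 2" if "0 < \<epsilon>" "\<epsilon> \<le> 1" for \<epsilon>
  proof (intro ballI allI)
    fix t y
    have "\<epsilon>\<^sup>2 + (if t = t0 then ?S \<epsilon> y else 0) \<le> 1 + 1"
      using that by (intro add_mono) (auto simp: power_le_one grid_profile_le_1)
    then have "\<phi> \<epsilon> t y \<le> 1 * 2"
      unfolding \<phi>_def using radial_bump_le_1 radial_bump_nonneg
      by (intro mult_mono) (auto intro!: add_nonneg_nonneg grid_profile_nonneg)
    then show "1 * \<phi> \<epsilon> t y \<le> 2" by simp
  qed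
  obtain C0 where C0: "\<And>\<phi>. bump_family I \<phi> \<Longrightarrow> (\<forall>t\<in>I. \<forall>y. \<phi> t y \<le> 2) \<Longrightarrow> emeasure (RV (patch_metric I \<phi>)) (topspace T) \<le> ennreal C0"
    using patch_volume_bounded[OF finI valid] by blast
  define C where "C = max C0 1"
  have C: "C > 0" "\<And>\<epsilon>. 0 < \<epsilon> \<Longrightarrow> \<epsilon> \<le> 1 \<Longrightarrow> emeasure (RV (G 1 \<epsilon>)) (topspace T) \<le> ennreal C"
  proof -
    fix \<epsilon> :: real assume "0 < \<epsilon>" "\<epsilon> \<le> 1"
    then have "emeasure (RV (G 1 \<epsilon>)) (topspace T) \<le> ennreal C0"
      unfolding G_def by (intro C0 fam \<phi>_le2) auto
    also have "\<dots> \<le> ennreal C" by (rule ennreal_leI) (simp add: C_def)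
    finally show "emeasure (RV (G 1 \<epsilon>)) (topspace T) \<le> ennreal C" .
  qed (simp add: C_def)
  \<comment> \<open>A lower bound on \<open>W\<close> for the bump of the distinguished patch,
    attained at distance \<open>R0 / 2\<close> from the centre.\<close>
  define \<beta> where "\<beta> = bump (R0\<^sup>2 - (R0 / 2)\<^sup>2)"
  have \<beta>: "\<beta> > 0" using R0 by (simp add: \<beta>_def bump_pos_iff power_divide)
  define \<kappa> where "\<kappa> = sqrt \<beta> ^ ?M"
  have \<kappa>: "\<kappa> > 0" using \<beta> by (simp add: \<kappa>_def)
  define J where "J = (LINT y|lborel. ?\<psi> y)"
  have J: "J > 0" unfolding J_def by (rule integral_radial_bump_pos[OF R(1)])
  have int\<psi>: "integrable lborel ?\<psi>"
    by (rule integrable_continuous_compact_support[of _ z0 R])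
       (use R in \<open>auto intro!: radial_bump_eq_0 Ck_on_imp_continuous_on[OF Ck_radial_bump]\<close>)
  obtain C' where C': "C' \<ge> 0" "\<And>\<epsilon>. \<epsilon> > 0 \<Longrightarrow> integrable lborel (\<lambda>y. ?\<psi> y * ?S \<epsilon> y)"
    "\<And>\<epsilon>. \<epsilon> > 0 \<Longrightarrow> J / 4 - C' * \<epsilon> \<le> (LINT y|lborel. ?\<psi> y * ?S \<epsilon> y)"
    using grid_profile_mean[OF R(1) ij, of z0] unfolding J_def by blast
  let ?\<tau> = "1 / 4 :: real"
  \<comment> \<open>Half of what the tangent line at the mean 1/4 gives after integration; the other
    half absorbs the error \<open>C' * \<epsilon>\<close> of the mean.\<close>
  define c1 where "c1 = \<kappa> * ?\<tau> ^ ?M * J / 2"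
  have c1: "c1 > 0" using \<kappa> J by (simp add: c1_def)
  define \<Psi> where "\<Psi> r \<epsilon> y = (if y \<in> W then ?\<psi> y * sqrt (r * \<phi> \<epsilon> t0 y) ^ ?M else 0)" for r \<epsilon> y
  have \<psi>0: "?\<psi> y = 0" if "y \<notin> cball z0 R" for y
    using that R by (intro radial_bump_eq_0) auto
  have int\<Psi>: "integrable lborel (\<Psi> r \<epsilon>)" if "\<epsilon> > 0" "r > 0" for r \<epsilon>
  proof -
    have "Ck_on 0 UNIV (\<lambda>y. r * \<phi> \<epsilon> t0 y)"
      using fam[OF that] by (auto simp: bump_family_def I_def simp del: Ck_on.simps)
    then have "continuous_on W (\<lambda>y. r * \<phi> \<epsilon> t0 y)"
      by (auto elim: continuous_on_subset)
    from continuous_on_mult[OF continuous_on_subset[OF Ck_on_imp_continuous_on[OF Ck_radial_bump[of 0]]]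
      continuous_on_power[OF continuous_on_real_sqrt[OF this]]]
    have "continuous_on W (\<lambda>y. ?\<psi> y * sqrt (r * \<phi> \<epsilon> t0 y) ^ ?M)" by blast
    then have "Ck_on 0 UNIV (\<Psi> r \<epsilon>)"
      unfolding \<Psi>_def by (intro Ck_on_extend[OF W(1,2)]) (auto simp: \<psi>0)
    then show ?thesis
      by (intro integrable_continuous_compact_support[of _ z0 R]) (simp_all add: \<Psi>_def \<psi>0)
  qed
  have mass: "c1 \<le> (LINT y|lborel. \<Psi> 1 \<epsilon> y)" if \<epsilon>: "\<epsilon> > 0" and small: "real ?M * ?\<tau> ^ (?M - 1) * (C' * \<epsilon>) \<le> ?\<tau> ^ ?M * J / 2" for \<epsilon>
  proof -
    have point: "\<kappa> * (?\<tau> ^ ?M * ?\<psi> y + real ?M * ?\<tau> ^ (?M - 1) * (?\<psi> y * ?S \<epsilon> y - ?\<tau> * ?\<psi> y)) \<le> \<Psi> 1 \<epsilon> y" for y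
    proof (cases "y \<in> W")
      case False
      then have "?\<psi> y = 0" using W(2) by (intro \<psi>0) auto
      then show ?thesis using False by (simp add: \<Psi>_def)
    next
      case True
      let ?s = "?S \<epsilon> y"
      have s: "0 \<le> ?s" "?s \<le> 1" by (simp_all add: grid_profile_nonneg grid_profile_le_1)
      have "(norm (y - z0))\<^sup>2 \<le> (R0 / 2)\<^sup>2"
        using True R by (intro power_mono) (auto simp: W_def dist_norm norm_minus_commute)
      then have "\<beta> \<le> radial_bump z0 R0 y"
        by (auto simp: \<beta>_def radial_bump_eq intro: bump_mono)
      then have "\<beta> * ?s \<le> \<phi> \<epsilon> t0 y"
        unfolding \<phi>_def t0_def using \<beta> s by (simp, intro mult_mono) auto
      then have "sqrt \<beta> * sqrt ?s \<le> sqrt (1 * \<phi> \<epsilon> t0 y)"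
        by (simp flip: real_sqrt_mult)
      \<comment> \<open>The density involves the square root of the profile, whereas the known mean
        is that of the profile itself; as its values lie in [0, 1], the root may be dropped.\<close>
      moreover have "?s \<le> sqrt ?s"
        using s by (intro real_le_rsqrt) (simp add: power2_eq_square mult_left_le)
      ultimately have "sqrt \<beta> * ?s \<le> sqrt (1 * \<phi> \<epsilon> t0 y)"
        using \<beta> by (intro order_trans[OF mult_left_mono[of ?s "sqrt ?s" "sqrt \<beta>"]]) auto
      then have "(sqrt \<beta> * ?s) ^ ?M \<le> sqrt (1 * \<phi> \<epsilon> t0 y) ^ ?M"
        using \<beta> s by (intro power_mono) auto
      moreover have "\<kappa> * (?\<tau> ^ ?M + real ?M * ?\<tau> ^ (?M - 1) * (?s - ?\<tau>)) \<le> \<kappa> * ?s ^ ?M"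
        using \<kappa> s by (intro mult_left_mono power_tangent_le) auto
      ultimately have "\<kappa> * (?\<tau> ^ ?M + real ?M * ?\<tau> ^ (?M - 1) * (?s - ?\<tau>)) \<le> sqrt (1 * \<phi> \<epsilon> t0 y) ^ ?M"
        by (simp add: \<kappa>_def power_mult_distrib)
      then have "?\<psi> y * (\<kappa> * (?\<tau> ^ ?M + real ?M * ?\<tau> ^ (?M - 1) * (?s - ?\<tau>))) \<le> ?\<psi> y * sqrt (1 * \<phi> \<epsilon> t0 y) ^ ?M"
        by (intro mult_left_mono radial_bump_nonneg)
      then show ?thesis
        using True by (simp add: \<Psi>_def algebra_simps)
    qed
    have "c1 \<le> \<kappa> * (?\<tau> ^ ?M * J - real ?M * ?\<tau> ^ (?M - 1) * (C' * \<epsilon>))"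
    proof -
      have "?\<tau> ^ ?M * J / 2 \<le> ?\<tau> ^ ?M * J - real ?M * ?\<tau> ^ (?M - 1) * (C' * \<epsilon>)"
        using small by linarith
      from mult_left_mono[OF this less_imp_le[OF \<kappa>]] show ?thesis
        by (simp only: c1_def mult.assoc times_divide_eq_right)
    qed
    also have "\<dots> \<le> \<kappa> * (?\<tau> ^ ?M * J + real ?M * ?\<tau> ^ (?M - 1) * ((LINT y|lborel. ?\<psi> y * ?S \<epsilon> y) - ?\<tau> * J))"
    proof -
      have "real ?M * ?\<tau> ^ (?M - 1) * (- (C' * \<epsilon>)) \<le> real ?M * ?\<tau> ^ (?M - 1) * ((LINT y|lborel. ?\<psi> y * ?S \<epsilon> y) - ?\<tau> * J)"
        using C'(3)[OF \<epsilon>] by (intro mult_left_mono) auto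
      then show ?thesis using \<kappa> by (intro mult_left_mono) auto
    qed
    also have "\<dots> = (LINT y|lborel. \<kappa> * (?\<tau> ^ ?M * ?\<psi> y + real ?M * ?\<tau> ^ (?M - 1) * (?\<psi> y * ?S \<epsilon> y - ?\<tau> * ?\<psi> y)))"
      using int\<psi> C'(2)[OF \<epsilon>] by (simp add: J_def)
    also have "\<dots> \<le> (LINT y|lborel. \<Psi> 1 \<epsilon> y)"
      using int\<psi> C'(2)[OF \<epsilon>] int\<Psi>[OF \<epsilon>, of 1] by (intro integral_mono point) auto
    finally show ?thesis .
  qed
  \<comment> \<open>Volume one requires the power \<open>s ^ CARD('m)\<close> to be the inverse of
    the volume before scaling, and that volume is at least \<open>c1\<close>.\<close>
  define S1 where "S1 = root ?M (1 / c1)"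
  have S1: "S1 > 0" using c1 by (simp add: S1_def)
  have good: "\<exists>g \<phi> s. riemannian_metric A g \<and> emeasure (RV g) (topspace T) = 1 \<and>
      0 < s \<and> s \<le> S1 \<and> Ck_on 1 UNIV \<phi> \<and>
      (\<forall>y\<in>W. g c0 (chart_inv c0 y) = \<phi> y *\<^sub>R mat 1 \<and> 0 < \<phi> y \<and> \<phi> y \<le> s\<^sup>2 * (\<epsilon>\<^sup>2 + ?S \<epsilon> y)) \<and>
      c1 / C \<le> (LINT y|lborel. (if y \<in> W then ?\<psi> y * sqrt (\<phi> y) ^ ?M else 0))"
    if \<epsilon>: "0 < \<epsilon>" "\<epsilon> \<le> 1" and small: "real ?M * ?\<tau> ^ (?M - 1) * (C' * \<epsilon>) \<le> ?\<tau> ^ ?M * J / 2" for \<epsilon>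
  proof -
    have g1: "riemannian_metric A (G 1 \<epsilon>)" using metricG \<epsilon> by simp
    define v where "v = measure (RV (G 1 \<epsilon>)) (topspace T)"
    have v: "emeasure (RV (G 1 \<epsilon>)) (topspace T) = ennreal v"
      unfolding v_def using C(2)[OF \<epsilon>] by (intro emeasure_eq_ennreal_measure) (auto simp: top_unique)
    have vC: "v \<le> C"
      using C(2)[OF \<epsilon>] C(1) unfolding v by (subst (asm) ennreal_le_iff) auto
    have "ennreal (LINT y|lborel. \<Psi> 1 \<epsilon> y) = (\<integral>\<^sup>+y. ennreal (\<Psi> 1 \<epsilon> y) \<partial>lborel)"
    proof (rule nn_integral_eq_integral[symmetric, OF int\<Psi>[OF \<epsilon>(1)] AE_I2])
      show "0 \<le> \<Psi> 1 \<epsilon> y" for y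
        using \<phi>_pos[OF \<epsilon>(1), of y]
        by (cases "y \<in> W") (auto simp: \<Psi>_def less_imp_le intro!: mult_nonneg_nonneg radial_bump_nonneg)
    qed simp
    also have "\<dots> \<le> (\<integral>\<^sup>+y. indicator (chart_image c0) y * (ennreal (vol_density (G 1 \<epsilon>) c0 y) * indicator (topspace T) (chart_inv c0 y)) \<partial>lborel)"
    proof (rule nn_integral_mono)
      fix y
      show "ennreal (\<Psi> 1 \<epsilon> y) \<le> indicator (chart_image c0) y * (ennreal (vol_density (G 1 \<epsilon>) c0 y) * indicator (topspace T) (chart_inv c0 y))"
      proof (cases "y \<in> W")
        case True
        have "vol_density (G 1 \<epsilon>) c0 y = sqrt (1 * \<phi> \<epsilon> t0 y) ^ ?M"
          using confG[OF \<epsilon>(1), of 1 y] True by (simp add: vol_density_def det_scaleR real_sqrt_power)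
        moreover have "?\<psi> y * sqrt (1 * \<phi> \<epsilon> t0 y) ^ ?M \<le> sqrt (1 * \<phi> \<epsilon> t0 y) ^ ?M"
          using \<phi>_pos[OF \<epsilon>(1) True] by (intro mult_left_le_one_le radial_bump_nonneg radial_bump_le_1) auto
        moreover have "y \<in> chart_image c0" using True W by auto
        ultimately show ?thesis
          using True chart_inv_in_space[OF c0] by (simp add: \<Psi>_def ennreal_leI)
      qed (simp add: \<Psi>_def)
    qed
    also have "\<dots> = emeasure (chart_volume T (G 1 \<epsilon>) c0) (topspace T)"
      by (rule emeasure_chart_volume[OF g1 c0, symmetric]) (simp add: openin_sets)
    also have "\<dots> \<le> ennreal v"
      unfolding v[symmetric] by (rule emeasure_chart_volume_le_RV[OF c0])
    finally have "(LINT y|lborel. \<Psi> 1 \<epsilon> y) \<le> v"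
      by (subst (asm) ennreal_le_iff) (simp_all add: v_def)
    then have c1v: "c1 \<le> v"
      using mass[OF \<epsilon>(1) small] by linarith
    then have vpos: "v > 0" using c1 by linarith
    define s where "s = root ?M (1 / v)"
    have s: "s > 0" "s ^ ?M = 1 / v" "s \<le> S1"
      using vpos c1 c1v by (auto simp: s_def S1_def intro!: frac_le)
    let ?g = "G (s\<^sup>2) \<epsilon>" and ?\<phi> = "\<lambda>y. s\<^sup>2 * \<phi> \<epsilon> t0 y"
    have s2: "s\<^sup>2 > 0" using s by simp
    have g: "riemannian_metric A ?g" by (rule metricG[OF \<epsilon>(1) s2])
    have "emeasure (RV ?g) (topspace T) = ennreal (s ^ ?M) * emeasure (RV (G 1 \<epsilon>)) (topspace T)"
      by (rule emeasure_RV_scale[OF g1 g _ s(1)])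
         (auto simp: G_def openin_sets intro: patch_metric_scale)
    also have "\<dots> = 1"
      using vpos by (simp add: v s(2) flip: ennreal_mult)
    finally have total: "emeasure (RV ?g) (topspace T) = 1" .
    have "Ck_on 1 UNIV ?\<phi>"
      using fam[OF \<epsilon>(1) s2] by (auto simp: bump_family_def I_def simp del: Ck_on.simps One_nat_def)
    moreover have "\<forall>y\<in>W. ?g c0 (chart_inv c0 y) = ?\<phi> y *\<^sub>R mat 1 \<and> 0 < ?\<phi> y \<and> ?\<phi> y \<le> s\<^sup>2 * (\<epsilon>\<^sup>2 + ?S \<epsilon> y)"
      using confG[OF \<epsilon>(1) s2] \<phi>_pos[OF \<epsilon>(1)] \<phi>_le s by (auto intro!: mult_left_mono)
    moreover have "c1 / C \<le> (LINT y|lborel. (if y \<in> W then ?\<psi> y * sqrt (?\<phi> y) ^ ?M else 0))"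
    proof -
      have "(\<lambda>y. if y \<in> W then ?\<psi> y * sqrt (?\<phi> y) ^ ?M else 0) = (\<lambda>y. s ^ ?M * \<Psi> 1 \<epsilon> y)"
        using s by (auto simp: \<Psi>_def fun_eq_iff real_sqrt_mult power_mult_distrib)
      then have "(LINT y|lborel. (if y \<in> W then ?\<psi> y * sqrt (?\<phi> y) ^ ?M else 0)) = 1 / v * (LINT y|lborel. \<Psi> 1 \<epsilon> y)"
        by (simp add: s(2))
      \<comment> \<open>Scaling to volume one divides the mass by the former volume
        \<open>v\<close>, which is at most \<open>C\<close>.\<close>
      moreover have "c1 / C \<le> 1 / v * (LINT y|lborel. \<Psi> 1 \<epsilon> y)"
        using mass[OF \<epsilon>(1) small] c1 vC vpos by (simp add: frac_le)
      ultimately show ?thesis by simp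
    qed
    ultimately show ?thesis
      using g total s by blast
  qed
  have small1: "\<forall>\<^sub>F \<epsilon> in at_right (0::real). real ?M * ?\<tau> ^ (?M - 1) * (C' * \<epsilon>) < ?\<tau> ^ ?M * J / 2"
  proof (rule order_tendstoD(2))
    show "((\<lambda>\<epsilon>. real ?M * ?\<tau> ^ (?M - 1) * (C' * \<epsilon>)) \<longlongrightarrow> real ?M * ?\<tau> ^ (?M - 1) * (C' * 0)) (at_right 0)"
      by (intro tendsto_intros)
  qed (use J in simp)
  have small2: "\<forall>\<^sub>F \<epsilon> in at_right (0::real). \<epsilon> \<in> {0<..<1}"
    by (rule eventually_at_right_real) simp
  have "\<forall>\<^sub>F \<epsilon> in at_right 0. \<exists>g \<phi> s. riemannian_metric A g \<and> emeasure (RV g) (topspace T) = 1 \<and>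
      0 < s \<and> s \<le> S1 \<and> Ck_on 1 UNIV \<phi> \<and>
      (\<forall>y\<in>ball z0 (2 * R). g c0 (chart_inv c0 y) = \<phi> y *\<^sub>R mat 1 \<and> 0 < \<phi> y \<and> \<phi> y \<le> s\<^sup>2 * (\<epsilon>\<^sup>2 + ?S \<epsilon> y)) \<and>
      c1 / C \<le> (LINT y|lborel. (if y \<in> ball z0 (2 * R) then ?\<psi> y * sqrt (\<phi> y) ^ ?M else 0))"
    using small1 small2
  proof eventually_elim
    case (elim \<epsilon>)
    then show ?case unfolding W_def[symmetric] by (intro good) auto
  qed
  then show thesis
    using c0 R W S1 c1 C by (intro that[of c0 R z0 S1 "c1 / C"]) (auto simp: W_def)
qed

end

section \<open>The three conclusions for one immersion\<close>

context immersed
begin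

text \<open>The smallness conditions involve only \<open>D\<close>, \<open>b0\<close>,
  \<open>S1\<close>, \<open>v\<close>, \<open>R\<close>, \<open>K\<close> and the dimension, never
  \<open>p\<close> or \<open>X\<close>. This is what allows \<open>\<epsilon>\<close>, and with it
  the metric, to be fixed before the immersion is given.\<close>

lemma immersion_of_grid_metric:
  fixes K :: nat
  assumes N: "N = CARD('m) + p" and ij: "i \<noteq> j"
    and c: "c \<in> A" and R: "R > 0" and W: "ball z (2 * R) \<subseteq> chart_image c"
    and total: "emeasure (RV g) (topspace T) = 1"
    and s: "0 < s" "s \<le> S1" and \<epsilon>: "0 < \<epsilon>" "\<epsilon> < 1" and \<phi>: "Ck_on 1 UNIV \<phi>"
    and conf: "\<And>y. y \<in> ball z (2 * R) \<Longrightarrow> g c (chart_inv c y) = \<phi> y *\<^sub>R mat 1"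
      "\<And>y. y \<in> ball z (2 * R) \<Longrightarrow> 0 < \<phi> y"
      "\<And>y. y \<in> ball z (2 * R) \<Longrightarrow> \<phi> y \<le> s\<^sup>2 * (\<epsilon>\<^sup>2 + grid_profile z i j \<epsilon> y)"
    and v: "v > 0" "v \<le> (LINT y|lborel. (if y \<in> ball z (2 * R) then radial_bump z R y * sqrt (\<phi> y) ^ CARD('m) else 0))"
    and b0: "\<And>y. y \<in> cball z R \<Longrightarrow> (\<Sum>i\<in>UNIV. \<bar>pd i (radial_bump z R) y\<bar>) \<le> b0"
    and D: "S1 * \<epsilon> * (2 + 3 * (2 * R)) \<le> D"
    and big: "real K * measure lborel (cball (0 :: real^'m) (sqrt (real CARD('m)) * D / proj_const TYPE('m)))
        < proj_const TYPE('m) / 4 * v"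
    and small: "D * (b0 * (2 * S1) ^ (CARD('m) - 1)) * measure lborel (cball z R) \<le> real CARD('m) * v / 4"
      "D\<^sup>2 * (real K)\<^sup>2 < v / 2"
      "real K * measure lborel (ball (0 :: real^'m) 1) * (2 * D) ^ CARD('m) < v"
  shows "\<exists>P. affine_plane N p P \<and> transverse A N X P \<and> (\<exists>F. finite F \<and> F \<subseteq> {q \<in> topspace T. X q \<in> P} \<and> card F \<ge> K)"
    and "mean_curvature_L2 T A g N X > real K"
    and "\<exists>x r. x \<in> E N \<and> r > 0 \<and> 1 \<ge> portion_volume T A g X (eucl_ball N x r) \<and>
      portion_volume T A g X (eucl_ball N x r) > real K * measure lborel (ball (0 :: real^'m) 1) * r ^ CARD('m)"
proof -
  let ?W = "ball z (2 * R)" and ?M = "CARD('m)"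
  define x0 where "x0 = X (chart_inv c z)"
  have zW: "z \<in> ?W" using R by simp
  then have "z \<in> chart_image c" using W by blast
  then have x0: "x0 \<in> E N"
    unfolding x0_def by (intro X_in_E chart_inv_in_space[OF c])
  have S1: "S1 > 0" using s by linarith
  have "0 < S1 * \<epsilon> * (2 + 3 * (2 * R))" using S1 \<epsilon> R by simp
  then have Dpos: "D > 0" using D by linarith
  have near: "eucl_norm N (\<lambda>l. X (chart_inv c y) l - x0 l) \<le> D" if "y \<in> ?W" for y
  proof -
    have "eucl_norm N (\<lambda>l. X (chart_inv c y) l - x0 l) \<le> s * \<epsilon> * (2 + 3 * (2 * R))"
      unfolding x0_def using R s \<epsilon> that
      by (intro distance_to_centre_le[OF c _ W ij conf(1) conf(3)]) auto
    also have "\<dots> \<le> S1 * \<epsilon> * (2 + 3 * (2 * R))"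
      using s \<epsilon> R by (intro mult_right_mono) auto
    finally show ?thesis using D by linarith
  qed
  have sub: "cball z R \<subseteq> ?W" using R by auto
  have \<phi>W: "Ck_on 1 ?W \<phi>" by (rule Ck_on_subset[OF \<phi>]) auto
  have \<phi>_meas: "\<phi> \<in> borel_measurable borel"
    by (rule borel_measurable_continuous_onI[OF Ck_on_imp_continuous_on[OF \<phi>]])
  have sqrt_le: "sqrt (\<phi> y) \<le> 2 * S1" if "y \<in> ?W" for y
  proof -
    have "\<phi> y \<le> s\<^sup>2 * (\<epsilon>\<^sup>2 + grid_profile z i j \<epsilon> y)" by (rule conf(3)[OF that])
    also have "\<dots> \<le> S1\<^sup>2 * (1 + 1)"
      using s \<epsilon> by (intro mult_mono add_mono power_mono grid_profile_le_1)
        (auto simp: power_le_one intro!: add_nonneg_nonneg grid_profile_nonneg)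
    also have "\<dots> \<le> (2 * S1)\<^sup>2" by (simp add: power_mult_distrib)
    finally show ?thesis using S1 by (intro real_le_lsqrt) auto
  qed
  have b: "(\<Sum>i\<in>UNIV. \<bar>pd i (radial_bump z R) y\<bar>) * sqrt (\<phi> y) ^ (?M - 1) \<le> b0 * (2 * S1) ^ (?M - 1)"
    if "y \<in> cball z R" for y
  proof -
    have yW: "y \<in> ?W" using that sub by blast
    have "0 \<le> (\<Sum>i\<in>UNIV. \<bar>pd i (radial_bump z R) y\<bar>)" by (rule sum_nonneg) simp
    then have "0 \<le> b0" using b0[OF that] by linarith
    then show ?thesis
      using b0[OF that] sqrt_le[OF yW] conf(2)[OF yW] by (intro mult_mono power_mono) auto
  qed
  have near': "eucl_norm N (\<lambda>l. X (chart_inv c y) l - x0 l) \<le> D" if "y \<in> cball z R" for y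
    using near that sub by blast
  have fin: "emeasure (RV g) (topspace T) \<noteq> \<infinity>" using total by simp
  note mc = mean_curvature_inequality[OF c open_ball W sub R conf(1) \<phi>W conf(2) near' Dpos b fin]
  let ?I = "LINT y|lborel. (if y \<in> ?W then radial_bump z R y * sqrt (\<phi> y) ^ ?M else 0)"
  have "ennreal v \<le> ennreal ?I" using v(2) by (rule ennreal_leI)
  also have "\<dots> = (\<integral>\<^sup>+y. ennreal (if y \<in> ?W then radial_bump z R y * sqrt (\<phi> y) ^ ?M else 0) \<partial>lborel)"
    using mc(1) conf(2) by (intro nn_integral_eq_integral[symmetric] AE_I2)
      (auto simp: less_imp_le intro!: mult_nonneg_nonneg radial_bump_nonneg)
  also have "\<dots> \<le> (\<integral>\<^sup>+y. ennreal (indicator ?W y * sqrt (\<phi> y) ^ ?M) \<partial>lborel)"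
    using conf(2) by (intro nn_integral_mono ennreal_leI)
      (auto simp: less_imp_le intro!: mult_left_le_one_le radial_bump_nonneg radial_bump_le_1)
  finally have vI: "ennreal v \<le> (\<integral>\<^sup>+y. ennreal (indicator ?W y * sqrt (\<phi> y) ^ ?M) \<partial>lborel)" .
  have "(\<lambda>y. indicator ?W y * sqrt (\<phi> y) ^ ?M) \<in> borel_measurable borel"
    using \<phi>_meas by (intro borel_measurable_times borel_measurable_power borel_measurable_indicator measurable_compose[OF \<phi>_meas]) auto
  from ex_crowded_plane[OF N c open_ball W conf(1,2) near Dpos refl this vI less_imp_le[OF v(1)] big]
  show "\<exists>P. affine_plane N p P \<and> transverse A N X P \<and> (\<exists>F. finite F \<and> F \<subseteq> {q \<in> topspace T. X q \<in> P} \<and> card F \<ge> K)" .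
  show "mean_curvature_L2 T A g N X > real K"
  proof -
    let ?h = "LINT q|RV g. H2 q"
    \<comment> \<open>The boundary term of the divergence argument takes at most half of the left
      side, so \<open>v / 2\<close> is at most the square of \<open>D\<close> times the integral of
      \<open>H2\<close>.\<close>
    have "real ?M / 2 * v \<le> real ?M / 2 * ?I"
      using v(2) by (intro mult_left_mono) auto
    then have "real ?M / 2 * v \<le> real ?M * D\<^sup>2 / 2 * ?h + real ?M * v / 4"
      using mc(2) small(1) by linarith
    moreover have "real ?M / 2 * v = real ?M * (v / 2)" "real ?M * v / 4 = real ?M * (v / 2) / 2"
      "real ?M * D\<^sup>2 / 2 * ?h = real ?M * (D\<^sup>2 * ?h) / 2"
      by simp_all
    ultimately have "real ?M * (v / 2) \<le> real ?M * (D\<^sup>2 * ?h)"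
      by linarith
    then have "v / 2 \<le> D\<^sup>2 * ?h"
      by (subst (asm) mult_le_cancel_left_pos) simp_all
    then have "D\<^sup>2 * (real K)\<^sup>2 < D\<^sup>2 * ?h" using small(2) by linarith
    then have "(real K)\<^sup>2 < ?h" using Dpos by simp
    then show ?thesis
      unfolding mean_curvature_L2_def H2_def by (rule real_less_rsqrt)
  qed
  \<comment> \<open>The balls of the statement are open, so the radius is \<open>2 * D\<close> in
    place of \<open>D\<close>.\<close>
  have near2: "eucl_norm N (\<lambda>l. X (chart_inv c y) l - x0 l) < 2 * D" if "y \<in> ?W" for y
    using near[OF that] Dpos by linarith
  have "(\<lambda>y. ennreal (indicator ?W y * sqrt (\<phi> y) ^ ?M)) = (\<lambda>y. ennreal (indicator ?W y * vol_density g c y))"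
    using conf(1) by (auto simp: vol_density_def det_scaleR real_sqrt_power indicator_def fun_eq_iff)
  with vI have "ennreal v \<le> (\<integral>\<^sup>+y. ennreal (indicator ?W y * vol_density g c y) \<partial>lborel)" by simp
  note pv = portion_volume_ge[OF c W near2 total this]
  show "\<exists>x r. x \<in> E N \<and> r > 0 \<and> 1 \<ge> portion_volume T A g X (eucl_ball N x r) \<and>
      portion_volume T A g X (eucl_ball N x r) > real K * measure lborel (ball (0 :: real^'m) 1) * r ^ ?M"
    using x0 Dpos pv small(3) by (intro exI[of _ x0] exI[of _ "2 * D"]) auto
qed

end

theorem corollary1p3:
  fixes T :: "'a topology" and A :: "('a, 'm::finite) chart set"
  assumes "connected_smooth_manifold T A" and "compact_space T" and "CARD('m) \<ge> 3"
  shows "\<forall>K::nat. K > 0 \<longrightarrow>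
    (\<exists>g. riemannian_metric A g \<and> measure (riemannian_volume T A g) (topspace T) = 1 \<and>
      (\<forall>p\<ge>1. \<forall>X. isometric_immersion T A g (CARD('m) + p) X \<longrightarrow>
         (\<exists>P. affine_plane (CARD('m) + p) p P \<and> transverse A (CARD('m) + p) X P \<and>
            (\<exists>F. finite F \<and> F \<subseteq> {q \<in> topspace T. X q \<in> P} \<and> card F \<ge> K)) \<and>
         mean_curvature_L2 T A g (CARD('m) + p) X > real K \<and>
         (\<exists>x r. x \<in> topspace (Euclidean_space (CARD('m) + p)) \<and> r > 0 \<and>
            1 \<ge> portion_volume T A g X (eucl_ball (CARD('m) + p) x r) \<and>
            portion_volume T A g X (eucl_ball (CARD('m) + p) x r)
              > real K * measure lborel (ball (0 :: real^'m) 1) * r ^ CARD('m))))"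
proof (intro allI impI)
  fix K :: nat
  assume "K > 0"
  interpret compact_manifold T A
    using assms by unfold_locales
  \<comment> \<open>The two coordinate directions of the grid.\<close>
  obtain i j :: 'm where ij: "i \<noteq> j"
  proof -
    have "\<not> (\<forall>i. i = (undefined :: 'm))"
    proof
      assume "\<forall>i. i = (undefined :: 'm)"
      then have "UNIV = {undefined :: 'm}" by blast
      then have "CARD('m) = card {undefined :: 'm}" by (rule arg_cong)
      then show False using assms(3) by simp
    qed
    then show thesis using that by blast
  qed
  obtain c z R S1 v where c: "c \<in> A" and R: "R > 0" and W: "ball z (2 * R) \<subseteq> chart_image c" and S1: "S1 > 0" and v: "v > 0"
    and ev: "\<forall>\<^sub>F \<epsilon> in at_right 0. \<exists>g \<phi> s. riemannian_metric A g \<and> emeasure (riemannian_volume T A g) (topspace T) = 1 \<and>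
      0 < s \<and> s \<le> S1 \<and> Ck_on 1 UNIV \<phi> \<and>
      (\<forall>y\<in>ball z (2 * R). g c (chart_inv c y) = \<phi> y *\<^sub>R mat 1 \<and> 0 < \<phi> y \<and>
         \<phi> y \<le> s\<^sup>2 * (\<epsilon>\<^sup>2 + grid_profile z i j \<epsilon> y)) \<and>
      v \<le> (LINT y|lborel. (if y \<in> ball z (2 * R) then radial_bump z R y * sqrt (\<phi> y) ^ CARD('m) else 0))"
    by (rule ex_grid_metrics[OF ij])
  let ?M = "CARD('m)" and ?pc = "proj_const TYPE('m)"
  \<comment> \<open>A bound for the gradient of the cutoff; the cutoff depends on \<open>z\<close>
    and \<open>R\<close> only, so the bound precedes the choice of
    \<open>\<epsilon>\<close>.\<close>
  have "continuous_on UNIV (\<lambda>y. \<Sum>i\<in>UNIV. \<bar>pd i (radial_bump z R) y\<bar>)"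
    using Ck_radial_bump[of "Suc 0" z R] by (intro continuous_intros) simp
  then have "compact ((\<lambda>y. \<Sum>i\<in>UNIV. \<bar>pd i (radial_bump z R) y\<bar>) ` cball z R)"
    by (intro compact_continuous_image[OF _ compact_cball]) (auto elim: continuous_on_subset)
  from compact_imp_bounded[OF this] obtain b0
    where b0: "\<And>y. y \<in> cball z R \<Longrightarrow> (\<Sum>i\<in>UNIV. \<bar>pd i (radial_bump z R) y\<bar>) \<le> b0"
    unfolding bounded_iff by fastforce
  \<comment> \<open>The bound of \<open>distance_to_centre_le\<close> for the ball of radius
    \<open>2 * R\<close>, with the scaling factor replaced by its upper bound
    \<open>S1\<close>.\<close>
  define D where "D \<epsilon> = S1 * \<epsilon> * (2 + 3 * (2 * R))" for \<epsilon>
  have D0: "(D \<longlongrightarrow> 0) (at_right 0)"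
  proof -
    have "(D \<longlongrightarrow> S1 * 0 * (2 + 3 * (2 * R))) (at_right 0)"
      unfolding D_def by (intro tendsto_intros)
    then show ?thesis by simp
  qed
  let ?r = "\<lambda>\<epsilon>. sqrt (real ?M) * D \<epsilon> / ?pc"
  have pos: "\<forall>\<^sub>F \<epsilon> in at_right 0. \<epsilon> \<in> {0<..<1::real}"
    by (rule eventually_at_right_real) simp
  \<comment> \<open>The volume of the ball is written as an explicit function of its radius, so that
    limit rules apply.\<close>
  have "((\<lambda>\<epsilon>. real K * (unit_ball_vol (real DIM(real^'m)) * ?r \<epsilon> ^ DIM(real^'m))) \<longlongrightarrow>
      real K * (unit_ball_vol (real DIM(real^'m)) * (sqrt (real ?M) * 0 / ?pc) ^ DIM(real^'m))) (at_right 0)"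
    using proj_const_pos[where 'm = 'm] by (intro tendsto_intros D0) simp
  then have ev1: "\<forall>\<^sub>F \<epsilon> in at_right 0. real K * (unit_ball_vol (real DIM(real^'m)) * ?r \<epsilon> ^ DIM(real^'m)) < ?pc / 4 * v"
    by (rule order_tendstoD(2)) (use v proj_const_pos[where 'm = 'm] in \<open>simp add: zero_power\<close>)
  have "((\<lambda>\<epsilon>. D \<epsilon> * (b0 * (2 * S1) ^ (?M - 1)) * measure lborel (cball z R)) \<longlongrightarrow>
      0 * (b0 * (2 * S1) ^ (?M - 1)) * measure lborel (cball z R)) (at_right 0)"
    by (intro tendsto_intros D0)
  then have ev2: "\<forall>\<^sub>F \<epsilon> in at_right 0. D \<epsilon> * (b0 * (2 * S1) ^ (?M - 1)) * measure lborel (cball z R) < real ?M * v / 4"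
    by (rule order_tendstoD(2)) (use v in \<open>simp add: zero_power\<close>)
  have "((\<lambda>\<epsilon>. (D \<epsilon>)\<^sup>2 * (real K)\<^sup>2) \<longlongrightarrow> 0\<^sup>2 * (real K)\<^sup>2) (at_right 0)"
    by (intro tendsto_intros D0)
  then have ev3: "\<forall>\<^sub>F \<epsilon> in at_right 0. (D \<epsilon>)\<^sup>2 * (real K)\<^sup>2 < v / 2"
    by (rule order_tendstoD(2)) (use v in \<open>simp add: zero_power\<close>)
  have "((\<lambda>\<epsilon>. real K * measure lborel (ball (0 :: real^'m) 1) * (2 * D \<epsilon>) ^ ?M) \<longlongrightarrow>
      real K * measure lborel (ball (0 :: real^'m) 1) * (2 * 0) ^ ?M) (at_right 0)"
    by (intro tendsto_intros D0)
  then have ev4: "\<forall>\<^sub>F \<epsilon> in at_right 0. real K * measure lborel (ball (0 :: real^'m) 1) * (2 * D \<epsilon>) ^ ?M < v"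
    by (rule order_tendstoD(2)) (use v in \<open>simp add: zero_power\<close>)
  from eventually_happens[OF eventually_conj[OF ev eventually_conj[OF pos eventually_conj[OF ev1
    eventually_conj[OF ev2 eventually_conj[OF ev3 ev4]]]]]]
  obtain \<epsilon> g \<phi> s where \<epsilon>: "0 < \<epsilon>" "\<epsilon> < 1"
    and small: "real K * (unit_ball_vol (real DIM(real^'m)) * ?r \<epsilon> ^ DIM(real^'m)) < ?pc / 4 * v"
      "D \<epsilon> * (b0 * (2 * S1) ^ (?M - 1)) * measure lborel (cball z R) < real ?M * v / 4"
      "(D \<epsilon>)\<^sup>2 * (real K)\<^sup>2 < v / 2" "real K * measure lborel (ball (0 :: real^'m) 1) * (2 * D \<epsilon>) ^ ?M < v"
    and g: "riemannian_metric A g" "emeasure (riemannian_volume T A g) (topspace T) = 1" "0 < s" "s \<le> S1" "Ck_on 1 UNIV \<phi>"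
      "\<forall>y\<in>ball z (2 * R). g c (chart_inv c y) = \<phi> y *\<^sub>R mat 1 \<and> 0 < \<phi> y \<and>
         \<phi> y \<le> s\<^sup>2 * (\<epsilon>\<^sup>2 + grid_profile z i j \<epsilon> y)"
      "v \<le> (LINT y|lborel. (if y \<in> ball z (2 * R) then radial_bump z R y * sqrt (\<phi> y) ^ CARD('m) else 0))"
    by (simp only: trivial_limit_at_right_real greaterThanLessThan_iff) (elim disjE FalseE exE conjE)
  have r: "?r \<epsilon> \<ge> 0"
    using S1 \<epsilon> R proj_const_pos[where 'm = 'm] by (simp add: D_def)
  have big: "real K * measure lborel (cball (0 :: real^'m) (?r \<epsilon>)) < ?pc / 4 * v"
    using small(1) content_cball[OF r, of "0 :: real^'m"] by simp
  show "\<exists>g. riemannian_metric A g \<and> measure (riemannian_volume T A g) (topspace T) = 1 \<and>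
      (\<forall>p\<ge>1. \<forall>X. isometric_immersion T A g (CARD('m) + p) X \<longrightarrow>
         (\<exists>P. affine_plane (CARD('m) + p) p P \<and> transverse A (CARD('m) + p) X P \<and>
            (\<exists>F. finite F \<and> F \<subseteq> {q \<in> topspace T. X q \<in> P} \<and> card F \<ge> K)) \<and>
         mean_curvature_L2 T A g (CARD('m) + p) X > real K \<and>
         (\<exists>x r. x \<in> topspace (Euclidean_space (CARD('m) + p)) \<and> r > 0 \<and>
            1 \<ge> portion_volume T A g X (eucl_ball (CARD('m) + p) x r) \<and>
            portion_volume T A g X (eucl_ball (CARD('m) + p) x r)
              > real K * measure lborel (ball (0 :: real^'m) 1) * r ^ CARD('m)))"
  proof (intro exI[of _ g] conjI allI impI)
    show "riemannian_metric A g" by fact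
    show "measure (riemannian_volume T A g) (topspace T) = 1"
      using g(2) by (simp add: measure_def)
    fix p :: nat and X
    assume X: "isometric_immersion T A g (?M + p) X"
    interpret immersed T A g "?M + p" X
      using g(1) X by unfold_locales
    have conf: "g c (chart_inv c y) = \<phi> y *\<^sub>R mat 1" "0 < \<phi> y" "\<phi> y \<le> s\<^sup>2 * (\<epsilon>\<^sup>2 + grid_profile z i j \<epsilon> y)"
      if "y \<in> ball z (2 * R)" for y
      using bspec[OF g(6) that] by blast+
    note * = immersion_of_grid_metric[OF refl ij c R W g(2,3,4) \<epsilon> g(5) conf v g(7) b0 eq_refl[OF D_def[symmetric]] big
      less_imp_le[OF small(2)] small(3,4)]
    show "\<exists>P. affine_plane (?M + p) p P \<and> transverse A (?M + p) X P \<and>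
        (\<exists>F. finite F \<and> F \<subseteq> {q \<in> topspace T. X q \<in> P} \<and> card F \<ge> K)"
      by (rule *(1))
    show "mean_curvature_L2 T A g (?M + p) X > real K"
      by (rule *(2))
    show "\<exists>x r. x \<in> topspace (Euclidean_space (?M + p)) \<and> r > 0 \<and>
        1 \<ge> portion_volume T A g X (eucl_ball (?M + p) x r) \<and>
        portion_volume T A g X (eucl_ball (?M + p) x r) > real K * measure lborel (ball (0 :: real^'m) 1) * r ^ ?M"
      by (rule *(3))
  qed
qed

end
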